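(* Let $f(z_1,\dots,z_n)$ be a holomorphic function near the origin with $m:=\operatorname{mult}_0 f\geq 2$, let $X=\bigl(xy=f(z_1,\dots,z_n)\bigr)\subset\mathbb{C}^{n+2}$ be the corresponding $cA$-type singularity, and assume that $\dim X\geq 3$. Then $\operatorname{ShArc}(0\in X)$ has exactly $m-1$ irreducible components $\operatorname{ShArc}_i(0\in X)$, $0<i<m$, and there are dense open subsets $\operatorname{ShArc}_i^{\circ}(0\in X)\subset\operatorname{ShArc}_i(0\in X)$ such that a short arc $\bigl(\psi_1(t),\psi_2(t),\phi_1(t),\dots,\phi_n(t)\bigr)$ lies in $\operatorname{ShArc}_i^{\circ}(0\in X)$ if and only if $\operatorname{mult}\psi_1(t)=i$, $\operatorname{mult}\psi_2(t)=m-i$ and $\operatorname{mult} f\bigl(\phi_1(t),\dots,\phi_n(t)\bigr)=m$.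
   Context: Let $\mathbb{D}\subset\mathbb{C}$ be the open unit disc and $\overline{\mathbb{D}}$ its closure; a subscript indicates the name of the coordinate. Let $X$ be an analytic space and $p\in X$. A short arc on $(p\in X)$ is a holomorphic map $\phi(t):\overline{\mathbb{D}}_t\to X$ such that $\operatorname{Supp}\phi^{-1}(p)=\{0\}$. The space of all short arcs, with its natural topology (uniform convergence on $\overline{\mathbb{D}}$) and its natural (infinite-dimensional) analytic structure, is denoted $\operatorname{ShArc}(p\in X)$; irreducible components are those of this space. A deformation of short arcs is a holomorphic map $\Phi(t,s):\overline{\mathbb{D}}_t\times\mathbb{D}_s\to X$ such that $\Phi(\cdot,s_0)$ is a short arc for every $s_0\in\mathbb{D}_s$; equivalently $\operatorname{Supp}\Phi^{-1}(p)=\{0\}\times\mathbb{D}_s$. For $X=(xy=f)$ with coordinates $(x,y,z_1,\dots,z_n)$ a short arc is written in coordinates as $(\psi_1,\psi_2,\phi_1,\dots,\phi_n)$; $\operatorname{mult}$ of a function of $t$ is its order of vanishing at $t=0$. *)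

theory Defs
  imports "HOL-Complex_Analysis.Complex_Analysis" "HOL-Library.Extended_Nat"
begin

class complex_normed_space = real_normed_vector +
  fixes cscale :: "complex \<Rightarrow> 'a \<Rightarrow> 'a" (infixr "*\<^sub>C" 75)
  assumes cscale_add_right: "c *\<^sub>C (x + y) = c *\<^sub>C x + c *\<^sub>C y"
    and cscale_add_left: "(c + d) *\<^sub>C x = c *\<^sub>C x + d *\<^sub>C x"
    and cscale_cscale: "c *\<^sub>C d *\<^sub>C x = (c * d) *\<^sub>C x"
    and cscale_of_real: "of_real r *\<^sub>C x = r *\<^sub>R x"
    and norm_cscale: "norm (c *\<^sub>C x) = norm c * norm x"

instantiation complex :: complex_normed_space
begin

definition cscale_complex_def: "c *\<^sub>C (z :: complex) = c * z"

instance
  by standard (auto simp: cscale_complex_def algebra_simps norm_mult scaleR_conv_of_real)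

end

instantiation prod :: (complex_normed_space, complex_normed_space) complex_normed_space
begin

definition cscale_prod_def: "c *\<^sub>C (v :: 'a \<times> 'b) = (c *\<^sub>C fst v, c *\<^sub>C snd v)"

instance
proof
  fix c :: complex and v :: "'a \<times> 'b"
  have "norm (c *\<^sub>C v) = sqrt ((norm c)\<^sup>2 * ((norm (fst v))\<^sup>2 + (norm (snd v))\<^sup>2))"
    by (simp add: cscale_prod_def norm_prod_def norm_cscale power_mult_distrib algebra_simps)
  thus "norm (c *\<^sub>C v) = norm c * norm v"
    by (simp add: real_sqrt_mult norm_prod_def)
qed (auto simp: cscale_prod_def cscale_add_right cscale_add_left cscale_cscale cscale_of_real
       prod_eq_iff)

end

instantiation vec :: (complex_normed_space, finite) complex_normed_space
begin

definition cscale_vec_def: "c *\<^sub>C (v :: 'a ^ 'b) = (\<chi> i. c *\<^sub>C (v $ i))"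

instance
proof
  fix c :: complex and v :: "'a ^ 'b"
  show "norm (c *\<^sub>C v) = norm c * norm v"
    by (simp add: cscale_vec_def norm_vec_def norm_cscale L2_set_right_distrib)
qed (auto simp: cscale_vec_def cscale_add_right cscale_add_left cscale_cscale cscale_of_real
       vec_eq_iff)

end

text \<open>
  As with \<^const>\<open>analytic_on\<close>, holomorphy on an arbitrary set means holomorphy on some open
  neighbourhood of it.
\<close>

definition holomorphic_map_on ::
    "('a::complex_normed_space \<Rightarrow> 'b::complex_normed_space) \<Rightarrow> 'a set \<Rightarrow> bool"
    (infixl "holomorphic'_map'_on" 50) where
  "f holomorphic_map_on S \<longleftrightarrow>
     (\<exists>U. open U \<and> S \<subseteq> U \<and>
       (\<forall>z\<in>U. \<exists>L. (f has_derivative L) (at z) \<and> (\<forall>c v. L (c *\<^sub>C v) = c *\<^sub>C L v)))"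

lemma holomorphic_map_on_complex_iff:
  fixes f :: "complex \<Rightarrow> complex"
  shows "f holomorphic_map_on S \<longleftrightarrow> f analytic_on S"
proof -
  have "(\<exists>L. (f has_derivative L) (at z) \<and> (\<forall>c v. L (c *\<^sub>C v) = c *\<^sub>C L v)) \<longleftrightarrow>
        f field_differentiable at z" (is "?l \<longleftrightarrow> ?r") for z
  proof
    assume ?l
    then obtain L where L: "(f has_derivative L) (at z)" "\<And>c v. L (c * v) = c * L v"
      unfolding cscale_complex_def by blast
    define D where "D = L 1"
    have "L = (*) D"
    proof
      fix v show "L v = D * v"
        using L(2)[of v 1] by (simp add: D_def mult.commute)
    qed
    with L(1) show ?r
      by (auto simp: field_differentiable_def has_field_derivative_def)
  next
    assume ?r
    then obtain D where "(f has_derivative (*) D) (at z)"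
      by (auto simp: field_differentiable_def has_field_derivative_def)
    thus ?l
      by (intro exI[of _ "(*) D"]) (simp add: cscale_complex_def mult.left_commute)
  qed
  thus ?thesis
    unfolding holomorphic_map_on_def analytic_on_holomorphic
    by (simp add: holomorphic_on_open field_differentiable_def cong: conj_cong)
qed

text \<open>The order of vanishing is \<open>\<infinity>\<close> if \<open>g\<close> vanishes identically near 0.\<close>

definition vanishing_order :: "(complex \<Rightarrow> complex) \<Rightarrow> enat" where
  "vanishing_order g = Inf {enat k |k. (deriv ^^ k) g 0 \<noteq> 0}"

text \<open>
  The degree \<open>k\<close> part \<open>f\<^sub>k\<close> of the Taylor expansion \<open>f = f\<^sub>0 + f\<^sub>1 + \<dots>\<close> at the origin is a
  homogeneous polynomial, and \<open>f (s v) = (\<Sum>k. s\<^sup>k f\<^sub>k(v))\<close> for small \<open>s\<close>.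
\<close>

definition homogeneous_part ::
    "('a::complex_normed_space \<Rightarrow> complex) \<Rightarrow> nat \<Rightarrow> 'a \<Rightarrow> complex" where
  "homogeneous_part f k v = (deriv ^^ k) (\<lambda>s. f (s *\<^sub>C v)) 0 / fact k"

definition mult0 :: "('a::complex_normed_space \<Rightarrow> complex) \<Rightarrow> enat" where
  "mult0 f = Inf {enat k |k. \<exists>v. homogeneous_part f k v \<noteq> 0}"

text \<open>
  Dimension of an analytic set at one of its points: the least number of holomorphic equations that
  cut out the point, as a set, from a neighbourhood of it (Chevalley dimension).
\<close>

definition local_dim :: "'a::complex_normed_space set \<Rightarrow> 'a \<Rightarrow> nat" where
  "local_dim X p =
     (LEAST d. \<exists>(g :: nat \<Rightarrow> 'a \<Rightarrow> complex) U. open U \<and> p \<in> U \<and>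
        (\<forall>j<d. g j holomorphic_map_on U) \<and>
        {q \<in> X \<inter> U. \<forall>j<d. g j q = 0} = {p})"

text \<open>
  Arcs are kept extensional, i.e. constantly \<^const>\<open>undefined\<close> outside the closed disc, so that
  equality of functions is equality of arcs. They extend holomorphically across the boundary.
\<close>

definition short_arcs ::
    "'a::complex_normed_space set \<Rightarrow> 'a \<Rightarrow> (complex \<Rightarrow> 'a) set" where
  "short_arcs X p =
     {\<phi>. (\<exists>h. h holomorphic_map_on cball 0 1 \<and> \<phi> = restrict h (cball 0 1)) \<and>
         \<phi> ` cball 0 1 \<subseteq> X \<and> {t \<in> cball 0 1. \<phi> t = p} = {0}}"

definition short_arc_topology ::
    "'a::complex_normed_space set \<Rightarrow> 'a \<Rightarrow> (complex \<Rightarrow> 'a) topology" where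
  "short_arc_topology X p =
     subtopology (mtopology_of (funspace (cball 0 1) euclidean_metric)) (short_arcs X p)"

definition arc_at :: "(complex \<times> complex \<Rightarrow> 'a) \<Rightarrow> complex \<Rightarrow> complex \<Rightarrow> 'a" where
  "arc_at \<Phi> s = restrict (\<lambda>t. \<Phi> (t, s)) (cball 0 1)"

definition short_arc_deformation ::
    "'a::complex_normed_space set \<Rightarrow> 'a \<Rightarrow> (complex \<times> complex \<Rightarrow> 'a) \<Rightarrow> bool" where
  "short_arc_deformation X p \<Phi> \<longleftrightarrow>
     \<Phi> holomorphic_map_on (cball 0 1 \<times> ball 0 1) \<and>
     (\<forall>s\<in>ball 0 1. arc_at \<Phi> s \<in> short_arcs X p)"

text \<open>
  A deformation of short arcs is a holomorphic map from the disc to the space of short arcs. The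
  holomorphic functions on an open set of short arcs are the continuous functions that are
  holomorphic along every deformation inside that set. (On a finite-dimensional complex manifold
  this gives exactly the holomorphic functions; on a reduced complex space it gives the continuous
  weakly holomorphic ones, which have the same analytic zero sets and hence the same irreducible
  components.)
\<close>

definition holomorphic_on_arcs ::
    "'a::complex_normed_space set \<Rightarrow> 'a \<Rightarrow> (complex \<Rightarrow> 'a) set \<Rightarrow> ((complex \<Rightarrow> 'a) \<Rightarrow> complex) \<Rightarrow> bool"
  where
  "holomorphic_on_arcs X p W G \<longleftrightarrow>
     continuous_map (subtopology (short_arc_topology X p) W) euclidean G \<and>
     (\<forall>\<Phi>. short_arc_deformation X p \<Phi> \<and> (\<forall>s\<in>ball 0 1. arc_at \<Phi> s \<in> W) \<longrightarrow>
        (\<lambda>s. G (arc_at \<Phi> s)) holomorphic_on ball 0 1)"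

definition analytic_arc_set ::
    "'a::complex_normed_space set \<Rightarrow> 'a \<Rightarrow> (complex \<Rightarrow> 'a) set \<Rightarrow> bool" where
  "analytic_arc_set X p A \<longleftrightarrow>
     A \<subseteq> short_arcs X p \<and>
     (\<forall>\<phi>\<in>short_arcs X p. \<exists>W Gs. openin (short_arc_topology X p) W \<and> \<phi> \<in> W \<and>
        (\<forall>G\<in>Gs. holomorphic_on_arcs X p W G) \<and>
        A \<inter> W = {\<psi> \<in> W. \<forall>G\<in>Gs. G \<psi> = 0})"

definition irreducible_arc_set ::
    "'a::complex_normed_space set \<Rightarrow> 'a \<Rightarrow> (complex \<Rightarrow> 'a) set \<Rightarrow> bool" where
  "irreducible_arc_set X p Z \<longleftrightarrow>
     analytic_arc_set X p Z \<and> Z \<noteq> {} \<and>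
     (\<forall>A B. analytic_arc_set X p A \<and> analytic_arc_set X p B \<and> Z = A \<union> B \<longrightarrow> Z = A \<or> Z = B)"

definition arc_components ::
    "'a::complex_normed_space set \<Rightarrow> 'a \<Rightarrow> (complex \<Rightarrow> 'a) set set" where
  "arc_components X p =
     {Z. irreducible_arc_set X p Z \<and>
         (\<forall>Z'. irreducible_arc_set X p Z' \<and> Z \<subseteq> Z' \<longrightarrow> Z' = Z)}"

definition cA_hypersurface ::
    "(complex ^ 'n) set \<Rightarrow> (complex ^ 'n \<Rightarrow> complex) \<Rightarrow> (complex \<times> complex \<times> (complex ^ 'n)) set" where
  "cA_hypersurface U f = {(x, y, z). z \<in> U \<and> x * y = f z}"

end

theory Submission
  imports Defs
begin

text \<open>
  In coordinates a short arc on \<open>X = (xy = f)\<close> is a triple \<open>(\<psi>\<^sub>1, \<psi>\<^sub>2, \<phi>)\<close> with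
  \<open>\<psi>\<^sub>1 \<psi>\<^sub>2 = f \<circ> \<phi>\<close>. All three vanish at 0; hence the order of \<open>f \<circ> \<phi>\<close> at 0 is at least \<open>m\<close>, and the
  orders of \<open>\<psi>\<^sub>1\<close> and \<open>\<psi>\<^sub>2\<close> are positive and add up to at least \<open>m\<close>. Hence the sets
  \<open>component i\<close>, given by \<open>ord \<psi>\<^sub>1 \<ge> i\<close> and \<open>ord \<psi>\<^sub>2 \<ge> m - i\<close> for \<open>0 < i < m\<close>, cover the space of
  short arcs, and every irreducible set lies in one of them (\<open>irreducible_subset_component\<close>). They
  are analytic, because Taylor coefficients are holomorphic functions on the space of arcs
  (\<open>taylor_deriv_holomorphic\<close>). An arc in \<open>generic_part i\<close>, with orders exactly \<open>i\<close> and \<open>m - i\<close>,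
  lies in no other one of them. So everything follows once the generic part is dense in
  \<open>component i\<close> and \<open>component i\<close> is irreducible.

  Density (\<open>generic_part_dense\<close>). After a small change neither \<open>\<psi>\<^sub>1\<close> nor \<open>\<psi>\<^sub>2\<close> is identically
  zero, so \<open>\<psi>\<^sub>1 = t\<^sup>a G\<^sub>1\<close> and \<open>\<psi>\<^sub>2 = t\<^sup>b G\<^sub>2\<close> with \<open>G\<^sub>1(0), G\<^sub>2(0) \<noteq> 0\<close>. Move \<open>\<phi>\<close> to
  \<open>\<phi> + t G\<^sub>1 G\<^sub>2 w\<close> with a small constant vector \<open>w\<close>. For generic \<open>w\<close> the tangent direction at 0
  is no zero of the leading form of \<open>f\<close>, so that \<open>f\<close> now has order exactly \<open>m\<close> along the arc. The
  factor \<open>G\<^sub>1 G\<^sub>2\<close> guarantees that \<open>f\<close> of the new \<open>\<phi>\<close> is still divisible by \<open>G\<^sub>1 G\<^sub>2\<close>: it equals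
  \<open>t\<^sup>m G\<^sub>1 G\<^sub>2 h\<close>, where \<open>h\<close> is close to \<open>t\<close> to the power \<open>a + b - m\<close>. The zeros of \<open>h\<close> near 0 can be
  distributed at will (\<open>factor_near_power\<close>), which yields new \<open>\<psi>\<^sub>1\<close> and \<open>\<psi>\<^sub>2\<close> of orders \<open>i\<close> and
  \<open>m - i\<close> close to the old ones. The new arc must not return to the origin. This is where \<open>dim X \<ge> 3\<close>
  enters: a curve in a space of dimension at least 2 misses almost every point
  (\<open>generic_direction\<close>).

  Irreducibility (\<open>component_irreducible\<close>). The one tool is the identity theorem: if a deformation over
  the disc lies in an analytic set for the parameters in a nonempty open set, then it lies there
  completely (\<open>deformation_identity\<close>). Suppose that \<open>component i\<close> is the union of two proper analytic
  subsets \<open>A\<close> and \<open>B\<close>. By density there is a generic arc \<open>\<gamma>\<close> outside \<open>A\<close>. The arcs \<open>\<gamma>(ct)\<close> with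
  \<open>0 < |c| < 1\<close> form a deformation, hence some of them with very small \<open>c\<close> lie outside \<open>A\<close>, and for
  these \<open>\<psi>\<^sub>1 = t\<^sup>i u\<close> with \<open>u\<close> free of zeros on the closed disc and \<open>\<phi>\<close> small
  (\<open>small_arc_outside\<close>). The same holds for \<open>B\<close>. Arcs of this kind are parametrized by \<open>log u\<close> and
  \<open>\<phi>\<close> without any condition, since \<open>\<psi>\<^sub>2 = f(\<phi>) / \<psi>\<^sub>1\<close>. Therefore linear interpolation puts any two
  of them into one deformation inside \<open>component i\<close> (\<open>linking_deformation\<close>). Near its first arc it
  avoids \<open>A\<close>, so it runs in \<open>B\<close>; by the identity theorem the second arc lies in \<open>B\<close>, a
  contradiction. Rescaling cannot be omitted: where \<open>\<psi>\<^sub>1\<close> has zeros away from 0, the space of arcs may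
  be locally reducible.
\<close>

section \<open>Holomorphic maps between complex normed spaces\<close>

text \<open>
  A holomorphic map on a set is one with this property at all points of a neighbourhood. The pointwise
  notion composes by the rules of calculus, without a choice of neighbourhoods.
\<close>

definition hol_at ::
    "('a::complex_normed_space \<Rightarrow> 'b::complex_normed_space) \<Rightarrow> 'a \<Rightarrow> bool" where
  "hol_at f z \<longleftrightarrow> (\<exists>L. (f has_derivative L) (at z) \<and> (\<forall>c v. L (c *\<^sub>C v) = c *\<^sub>C L v))"

lemma hol_atI:
  "(f has_derivative L) (at z) \<Longrightarrow> (\<And>c v. L (c *\<^sub>C v) = c *\<^sub>C L v) \<Longrightarrow> hol_at f z"
  unfolding hol_at_def by blast

lemma hol_atE:
  assumes "hol_at f z"
  obtains L where "(f has_derivative L) (at z)" "\<And>c v. L (c *\<^sub>C v) = c *\<^sub>C L v"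
  using assms unfolding hol_at_def by blast

lemma holomorphic_map_on_iff_hol_at:
  "f holomorphic_map_on S \<longleftrightarrow> (\<exists>V. open V \<and> S \<subseteq> V \<and> (\<forall>z\<in>V. hol_at f z))"
  unfolding holomorphic_map_on_def hol_at_def ..

lemma holomorphic_map_on_open:
  assumes "open S"
  shows "f holomorphic_map_on S \<longleftrightarrow> (\<forall>z\<in>S. hol_at f z)"
  using assms unfolding holomorphic_map_on_iff_hol_at by blast

lemma hol_at_complex_iff:
  fixes f :: "complex \<Rightarrow> complex"
  shows "hol_at f z \<longleftrightarrow> f field_differentiable at z"
proof
  assume "hol_at f z"
  then obtain L where L: "(f has_derivative L) (at z)" "\<And>c v. L (c * v) = c * L v"
    unfolding hol_at_def cscale_complex_def by blast
  have "L v = L 1 * v" for v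
    using L(2)[of v 1] by (simp add: mult.commute)
  hence "L = (*) (L 1)"
    by (intro ext)
  with L(1) have "(f has_field_derivative L 1) (at z)"
    unfolding has_field_derivative_def by metis
  thus "f field_differentiable at z"
    by (auto simp: field_differentiable_def)
next
  assume "f field_differentiable at z"
  then obtain d where "(f has_derivative (*) d) (at z)"
    by (auto simp: field_differentiable_def has_field_derivative_def)
  thus "hol_at f z"
    by (rule hol_atI) (simp add: cscale_complex_def mult.left_commute)
qed

lemma hol_at_imp_continuous: "hol_at f z \<Longrightarrow> isCont f z"
  by (auto elim!: hol_atE dest: has_derivative_continuous)

lemma hol_at_imp_continuous_on: "(\<And>z. z \<in> S \<Longrightarrow> hol_at f z) \<Longrightarrow> continuous_on S f"
  by (simp add: continuous_at_imp_continuous_on hol_at_imp_continuous)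

lemma hol_at_imp_holomorphic_on:
  "(\<And>z. z \<in> S \<Longrightarrow> hol_at f z) \<Longrightarrow> f holomorphic_on S"
  by (simp add: holomorphic_on_def hol_at_complex_iff field_differentiable_at_within)

lemma holomorphic_on_imp_hol_at:
  "f holomorphic_on S \<Longrightarrow> open S \<Longrightarrow> z \<in> S \<Longrightarrow> hol_at f z"
  by (simp add: hol_at_complex_iff holomorphic_on_imp_differentiable_at)

lemma cscale_zero_right [simp]: "c *\<^sub>C (0::'a::complex_normed_space) = 0"
  by (metis cscale_add_right add_cancel_right_right)

lemma cscale_zero_left [simp]: "0 *\<^sub>C (v::'a::complex_normed_space) = 0"
  using cscale_of_real[of 0 v] by simp

lemma cscale_one [simp]: "1 *\<^sub>C (v::'a::complex_normed_space) = v"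
  using cscale_of_real[of 1 v] by simp

lemma cscale_minus_right: "c *\<^sub>C (- v::'a::complex_normed_space) = - (c *\<^sub>C v)"
  using cscale_add_right[of c v "- v"] by (simp add: add_eq_0_iff)

lemma cscale_diff_right: "c *\<^sub>C (v - w::'a::complex_normed_space) = c *\<^sub>C v - c *\<^sub>C w"
  using cscale_add_right[of c v "- w"] by (simp add: cscale_minus_right)

lemma bounded_bilinear_cscale:
  "bounded_bilinear ((*\<^sub>C) :: complex \<Rightarrow> 'a::complex_normed_space \<Rightarrow> 'a)"
proof
  show "(r *\<^sub>R a) *\<^sub>C b = r *\<^sub>R (a *\<^sub>C b)" for r a and b :: 'a
    by (simp add: scaleR_conv_of_real flip: cscale_cscale cscale_of_real)
  show "a *\<^sub>C (r *\<^sub>R b) = r *\<^sub>R (a *\<^sub>C b)" for r a and b :: 'a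
    by (simp add: cscale_cscale mult.commute flip: cscale_of_real)
  show "\<exists>K. \<forall>a (b::'a). norm (a *\<^sub>C b) \<le> norm a * norm b * K"
    by (rule exI[of _ 1]) (simp add: norm_cscale)
qed (simp_all add: cscale_add_left cscale_add_right)

lemma hol_at_ident: "hol_at (\<lambda>z. z) z"
  by (rule hol_atI[OF has_derivative_ident]) simp

lemma hol_at_const: "hol_at (\<lambda>z. c) z"
  by (rule hol_atI[OF has_derivative_const]) simp

lemma hol_at_fst: "hol_at f z \<Longrightarrow> hol_at (\<lambda>z. fst (f z)) z"
  by (erule hol_atE, rule hol_atI, erule has_derivative_fst) (simp add: cscale_prod_def)

lemma hol_at_snd: "hol_at f z \<Longrightarrow> hol_at (\<lambda>z. snd (f z)) z"
  by (erule hol_atE, rule hol_atI, erule has_derivative_snd) (simp add: cscale_prod_def)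

lemma hol_at_Pair: "hol_at f z \<Longrightarrow> hol_at g z \<Longrightarrow> hol_at (\<lambda>z. (f z, g z)) z"
  by (erule hol_atE, erule hol_atE, rule hol_atI, erule has_derivative_Pair, assumption)
    (simp add: cscale_prod_def)

lemma hol_at_add: "hol_at f z \<Longrightarrow> hol_at g z \<Longrightarrow> hol_at (\<lambda>z. f z + g z) z"
  by (erule hol_atE, erule hol_atE, rule hol_atI, erule has_derivative_add, assumption)
    (simp add: cscale_add_right)

lemma hol_at_diff: "hol_at f z \<Longrightarrow> hol_at g z \<Longrightarrow> hol_at (\<lambda>z. f z - g z) z"
  by (erule hol_atE, erule hol_atE, rule hol_atI, erule has_derivative_diff, assumption)
    (simp add: cscale_diff_right)

lemma hol_at_cscale:
  assumes "hol_at g z" "hol_at f z"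
  shows "hol_at (\<lambda>z. g z *\<^sub>C f z) z"
proof -
  obtain L M where L: "(g has_derivative L) (at z)" "\<And>c v. L (c *\<^sub>C v) = c *\<^sub>C L v"
    and M: "(f has_derivative M) (at z)" "\<And>c v. M (c *\<^sub>C v) = c *\<^sub>C M v"
    using assms by (auto elim!: hol_atE)
  show ?thesis
    by (rule hol_atI[OF bounded_bilinear.FDERIV[OF bounded_bilinear_cscale L(1) M(1)]])
      (simp add: L(2) M(2) cscale_add_right cscale_cscale mult.commute cscale_complex_def)
qed

lemma hol_at_mult:
  fixes f g :: "'a::complex_normed_space \<Rightarrow> complex"
  shows "hol_at f z \<Longrightarrow> hol_at g z \<Longrightarrow> hol_at (\<lambda>z. f z * g z) z"
  using hol_at_cscale[of f z g] by (simp add: cscale_complex_def)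

lemma hol_at_compose:
  assumes "hol_at g z" "hol_at f (g z)"
  shows "hol_at (\<lambda>x. f (g x)) z"
proof -
  obtain L M where L: "(g has_derivative L) (at z)" "\<And>c v. L (c *\<^sub>C v) = c *\<^sub>C L v"
    and M: "(f has_derivative M) (at (g z))" "\<And>c v. M (c *\<^sub>C v) = c *\<^sub>C M v"
    using assms by (auto elim!: hol_atE)
  show ?thesis
    by (rule hol_atI[OF has_derivative_compose[OF L(1) M(1)]]) (simp add: L(2) M(2))
qed

lemma hol_at_vec_nth: "hol_at f z \<Longrightarrow> hol_at (\<lambda>z. vec_nth (f z) k) z"
  by (erule hol_atE, rule hol_atI,
      erule bounded_linear.has_derivative[OF bounded_linear_vec_nth]) (simp add: cscale_vec_def)

lemma hol_at_inverse:
  fixes f :: "'a::complex_normed_space \<Rightarrow> complex"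
  assumes "hol_at f z" "f z \<noteq> 0"
  shows "hol_at (\<lambda>z. inverse (f z)) z"
proof (rule hol_at_compose[of f z inverse, OF assms(1)])
  show "hol_at inverse (f z)"
    by (rule holomorphic_on_imp_hol_at[of _ "- {0}"])
      (use assms(2) in \<open>auto intro!: holomorphic_intros\<close>)
qed

lemma hol_at_divide:
  fixes f g :: "'a::complex_normed_space \<Rightarrow> complex"
  shows "hol_at f z \<Longrightarrow> hol_at g z \<Longrightarrow> g z \<noteq> 0 \<Longrightarrow> hol_at (\<lambda>z. f z / g z) z"
  unfolding divide_inverse by (intro hol_at_mult hol_at_inverse)

lemma hol_at_power:
  fixes f :: "'a::complex_normed_space \<Rightarrow> complex"
  shows "hol_at f z \<Longrightarrow> hol_at (\<lambda>z. f z ^ k) z"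
  by (induction k) (simp_all add: hol_at_const hol_at_mult)

lemma hol_at_exp:
  fixes f :: "'a::complex_normed_space \<Rightarrow> complex"
  shows "hol_at f z \<Longrightarrow> hol_at (\<lambda>z. exp (f z)) z"
  by (erule hol_at_compose, rule holomorphic_on_imp_hol_at[of _ UNIV]) (auto intro: holomorphic_on_exp)

lemmas hol_at_intros = hol_at_ident hol_at_const hol_at_fst hol_at_snd hol_at_Pair hol_at_add
  hol_at_diff hol_at_cscale hol_at_mult hol_at_power hol_at_exp hol_at_divide hol_at_vec_nth

section \<open>Separately holomorphic functions of two variables\<close>

text \<open>
  Schwarz's lemma for the increment, whose modulus is at most \<open>2 M\<close>. With the constant 3 instead of 2 the
  normalized function maps into the open unit disc.
\<close>

lemma holomorphic_increment_bound:
  assumes g: "g holomorphic_on ball a r" and "M > 0" and M: "\<And>z. z \<in> ball a r \<Longrightarrow> norm (g z) \<le> M"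
    and z: "z \<in> ball a r"
  shows "norm (g z - g a) \<le> 3 * M / r * norm (z - a)"
proof -
  have r: "r > 0"
    using z by (metis ball_empty empty_iff not_less)
  define F where "F \<zeta> = (g (a + of_real r * \<zeta>) - g a) / of_real (3 * M)" for \<zeta>
  have mem: "a + of_real r * \<zeta> \<in> ball a r" if "norm \<zeta> < 1" for \<zeta>
    using that r by (simp add: dist_norm norm_mult)
  have "F holomorphic_on ball 0 1"
    unfolding F_def using \<open>M > 0\<close> mem
    by (intro holomorphic_intros holomorphic_on_compose_gen[OF _ g, unfolded o_def]) auto
  moreover have "F 0 = 0"
    by (simp add: F_def)
  moreover have "norm (F \<zeta>) < 1" if "norm \<zeta> < 1" for \<zeta>
  proof -
    have "norm (g (a + of_real r * \<zeta>) - g a) \<le> M + M"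
      using M[OF mem[OF that]] M[of a] r by (intro norm_triangle_le_diff) auto
    thus ?thesis
      using \<open>M > 0\<close> by (simp add: F_def norm_divide divide_simps)
  qed
  moreover have "norm ((z - a) / of_real r) < 1"
    using z r by (simp add: norm_divide dist_norm norm_minus_commute)
  ultimately have "norm (F ((z - a) / of_real r)) \<le> norm ((z - a) / of_real r)"
    by (intro Schwarz_Lemma(1)) auto
  thus ?thesis
    using r \<open>M > 0\<close> by (simp add: F_def norm_divide field_simps)
qed

lemma difference_quotient_holomorphic:
  assumes g: "g holomorphic_on S" and S: "open S" and a: "a \<in> S"
  shows "(\<lambda>z. if z = a then deriv g a else (g z - g a) / (z - a)) holomorphic_on S"
proof (rule pole_theorem_open_0[where g = "\<lambda>z. g z - g a" and a = a])
  show "(\<lambda>z. g z - g a) holomorphic_on S"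
    using g by (intro holomorphic_intros)
  have "deriv (\<lambda>z. g z - g a) a = deriv g a"
    using holomorphic_on_imp_differentiable_at[OF g S a] by simp
  thus "(if a = a then deriv g a else (g a - g a) / (a - a)) = deriv (\<lambda>z. g z - g a) a"
    by simp
qed (use S in auto)

lemma difference_quotient_bound:
  assumes g: "g holomorphic_on ball a r" and "M > 0" and M: "\<And>z. z \<in> ball a r \<Longrightarrow> norm (g z) \<le> M"
    and z: "z \<in> ball a r"
  shows "norm (if z = a then deriv g a else (g z - g a) / (z - a)) \<le> 3 * M / r"
proof -
  define d where "d z = (if z = a then deriv g a else (g z - g a) / (z - a))" for z
  have r: "r > 0"
    using z by (metis ball_empty empty_iff not_less)
  have d: "d holomorphic_on ball a r"
    unfolding d_def using g r by (intro difference_quotient_holomorphic) auto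
  have b: "norm (d w) \<le> 3 * M / r" if "w \<in> ball a r" "w \<noteq> a" for w
    using holomorphic_increment_bound[OF g \<open>M > 0\<close> M that(1)] that r
    by (simp add: d_def norm_divide divide_simps)
  have "norm (d a) \<le> 3 * M / r"
  proof (rule Lim_norm_ubound)
    show "(d \<longlongrightarrow> d a) (at a)"
      using holomorphic_on_imp_continuous_on[OF d] r
      by (simp add: continuous_on_eq_continuous_at continuous_at)
    show "eventually (\<lambda>w. norm (d w) \<le> 3 * M / r) (at a)"
      using b r eventually_at_in_open[of "ball a r" a] by (auto elim!: eventually_mono)
  qed simp
  thus ?thesis
    using b z unfolding d_def by metis
qed

text \<open>
  The increment bound, applied to the difference quotient of \<open>g\<close>. What matters is that the constant
  depends only on \<open>M\<close> and \<open>r\<close>: difference quotients converge uniformly in any parameter that leaves the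
  bound \<open>M\<close> intact.
\<close>

lemma holomorphic_first_order_bound:
  assumes g: "g holomorphic_on ball a r" and "M > 0" and M: "\<And>z. z \<in> ball a r \<Longrightarrow> norm (g z) \<le> M"
    and z: "z \<in> ball a r"
  shows "norm (g z - g a - deriv g a * (z - a)) \<le> 9 * M / r\<^sup>2 * (norm (z - a))\<^sup>2"
proof (cases "z = a")
  case False
  define d where "d z = (if z = a then deriv g a else (g z - g a) / (z - a))" for z
  have r: "r > 0"
    using z by (metis ball_empty empty_iff not_less)
  have "d holomorphic_on ball a r"
    unfolding d_def using g r by (intro difference_quotient_holomorphic) auto
  moreover have "norm (d w) \<le> 3 * M / r" if "w \<in> ball a r" for w
    unfolding d_def using difference_quotient_bound[OF g \<open>M > 0\<close> M that] .
  ultimately have "norm (d z - d a) \<le> 3 * (3 * M / r) / r * norm (z - a)"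
    using \<open>M > 0\<close> r z by (intro holomorphic_increment_bound) auto
  hence "norm (d z - d a) * norm (z - a) \<le> 3 * (3 * M / r) / r * norm (z - a) * norm (z - a)"
    by (rule mult_right_mono) simp
  moreover have "g z - g a - deriv g a * (z - a) = (d z - d a) * (z - a)"
    using False by (simp add: d_def field_simps)
  moreover have "3 * (3 * M / r) / r * norm (z - a) * norm (z - a) = 9 * M / r\<^sup>2 * (norm (z - a))\<^sup>2"
    by (simp add: power2_eq_square)
  ultimately show ?thesis
    by (simp only: norm_mult)
qed simp

text \<open>
  Division by a variable and partial differentiation are easily seen to preserve separate holomorphy with
  local bounds. By Osgood's lemma (\<open>sep_holomorphic_imp_hol_at\<close> below) the notion agrees with joint
  holomorphy, so these operations preserve the latter as well.
\<close>

definition sep_holomorphic ::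
    "complex set \<Rightarrow> complex set \<Rightarrow> (complex \<Rightarrow> complex \<Rightarrow> complex) \<Rightarrow> bool" where
  "sep_holomorphic T S K \<longleftrightarrow> open T \<and> open S \<and>
     (\<forall>s\<in>S. (\<lambda>t. K t s) holomorphic_on T) \<and> (\<forall>t\<in>T. K t holomorphic_on S) \<and>
     (\<forall>t\<in>T. \<forall>s\<in>S. \<exists>r>0. \<exists>M>0. ball t r \<subseteq> T \<and> ball s r \<subseteq> S \<and>
        (\<forall>t'\<in>ball t r. \<forall>s'\<in>ball s r. norm (K t' s') \<le> M))"

lemma sep_holomorphicE:
  assumes "sep_holomorphic T S K" "t \<in> T" "s \<in> S"
  obtains r M where "r > 0" "M > 0" "ball t r \<subseteq> T" "ball s r \<subseteq> S"
    "\<And>t' s'. t' \<in> ball t r \<Longrightarrow> s' \<in> ball s r \<Longrightarrow> norm (K t' s') \<le> M"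
  using assms unfolding sep_holomorphic_def by meson


lemma hol_at_imp_sep_holomorphic:
  fixes K :: "complex \<Rightarrow> complex \<Rightarrow> complex"
  assumes "open T" "open S" and K: "\<And>t s. t \<in> T \<Longrightarrow> s \<in> S \<Longrightarrow> hol_at (\<lambda>(t, s). K t s) (t, s)"
  shows "sep_holomorphic T S K"
  unfolding sep_holomorphic_def
proof (intro conjI ballI)
  fix s assume s: "s \<in> S"
  have "hol_at (\<lambda>t. K t s) t" if "t \<in> T" for t
    using hol_at_compose[of "\<lambda>t. (t, s)" t "\<lambda>(t, s). K t s"] K[OF that s]
    by (simp add: hol_at_intros)
  thus "(\<lambda>t. K t s) holomorphic_on T"
    by (rule hol_at_imp_holomorphic_on)
next
  fix t assume t: "t \<in> T"
  have "hol_at (K t) s" if "s \<in> S" for s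
    using hol_at_compose[of "\<lambda>s. (t, s)" s "\<lambda>(t, s). K t s"] K[OF t that]
    by (simp add: hol_at_intros)
  thus "K t holomorphic_on S"
    by (rule hol_at_imp_holomorphic_on)
next
  fix t s assume ts: "t \<in> T" "s \<in> S"
  have "isCont (\<lambda>(t, s). K t s) (t, s)"
    using K[OF ts] by (rule hol_at_imp_continuous)
  then obtain d where d: "d > 0"
    "\<And>x. dist x (t, s) < d \<Longrightarrow> dist ((\<lambda>(t, s). K t s) x) (K t s) < 1"
    unfolding continuous_at_eps_delta by (metis case_prod_conv zero_less_one)
  obtain r1 where r1: "r1 > 0" "ball t r1 \<subseteq> T"
    using assms(1) ts openE by blast
  obtain r2 where r2: "r2 > 0" "ball s r2 \<subseteq> S"
    using assms(2) ts openE by blast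
  define r where "r = min (d / 2) (min r1 r2)"
  have "norm (K t' s') \<le> norm (K t s) + 1" if "t' \<in> ball t r" "s' \<in> ball s r" for t' s'
  proof -
    have "dist (t', s') (t, s) \<le> dist t' t + dist s' s"
      unfolding dist_Pair_Pair by (rule sqrt_sum_squares_le_sum) auto
    also have "\<dots> < d"
      using that by (auto simp: r_def dist_commute)
    finally have "dist (K t' s') (K t s) < 1"
      using d(2)[of "(t', s')"] by simp
    thus ?thesis
      using norm_triangle_sub[of "K t' s'" "K t s"] by (simp add: dist_norm)
  qed
  moreover have "r > 0" "ball t r \<subseteq> T" "ball s r \<subseteq> S"
    using d r1 r2 by (auto simp: r_def)
  ultimately show "\<exists>r>0. \<exists>M>0. ball t r \<subseteq> T \<and> ball s r \<subseteq> S \<and>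
        (\<forall>t'\<in>ball t r. \<forall>s'\<in>ball s r. norm (K t' s') \<le> M)"
    by (intro exI[of _ r] conjI exI[of _ "norm (K t s) + 1"]) (auto simp: add_nonneg_pos)
qed (use assms in auto)

text \<open>
  The difference quotients in \<open>t\<close> are holomorphic in \<open>s\<close>, and the first order bound makes them converge
  locally uniformly in \<open>s\<close>.
\<close>

lemma sep_holomorphic_deriv_param:
  assumes K: "sep_holomorphic T S K" and t: "t \<in> T"
  shows "(\<lambda>s. deriv (\<lambda>t. K t s) t) holomorphic_on S"
proof -
  have S: "open S" and Kt: "\<And>s. s \<in> S \<Longrightarrow> (\<lambda>t. K t s) holomorphic_on T"
    and Ks: "\<And>t. t \<in> T \<Longrightarrow> K t holomorphic_on S"
    using K by (auto simp: sep_holomorphic_def)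
  have "\<exists>e>0. (\<lambda>s. deriv (\<lambda>t. K t s) t) holomorphic_on ball s0 e" if s0: "s0 \<in> S" for s0
  proof -
    obtain r M where r: "r > 0" "M > 0" "ball t r \<subseteq> T" "ball s0 r \<subseteq> S"
      and M: "\<And>t' s'. t' \<in> ball t r \<Longrightarrow> s' \<in> ball s0 r \<Longrightarrow> norm (K t' s') \<le> M"
      using sep_holomorphicE[OF K t s0] by metis
    define Q where "Q h s = (K h s - K t s) / (h - t)" for h s
    define g where "g s = deriv (\<lambda>t. K t s) t" for s
    have sub: "cball s0 (r / 2) \<subseteq> ball s0 r"
      using r by auto
    have near: "eventually (\<lambda>h. h \<in> ball t r \<and> h \<noteq> t) (at t)"
      using eventually_at_in_open[of "ball t r" t] r by (auto elim: eventually_mono)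
    have "eventually (\<lambda>h. continuous_on (cball s0 (r / 2)) (Q h) \<and> Q h holomorphic_on ball s0 (r / 2)) (at t)"
      using near
    proof eventually_elim
      case (elim h)
      hence "Q h holomorphic_on S"
        unfolding Q_def using Ks t r by (auto intro!: holomorphic_intros)
      thus ?case
        using sub r(4) ball_subset_cball
        by (meson holomorphic_on_imp_continuous_on holomorphic_on_subset subset_trans)
    qed
    moreover have "uniform_limit (cball s0 (r / 2)) Q g (at t)"
    proof (rule uniform_limitI)
      fix e :: real assume "e > 0"
      have "((\<lambda>h. 9 * M / r\<^sup>2 * norm (h - t)) \<longlongrightarrow> 9 * M / r\<^sup>2 * norm (t - t)) (at t)"
        by (intro tendsto_intros)
      hence "eventually (\<lambda>h. 9 * M / r\<^sup>2 * norm (h - t) < e) (at t)"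
        using \<open>e > 0\<close> order_tendstoD(2) by fastforce
      with near show "eventually (\<lambda>h. \<forall>s\<in>cball s0 (r / 2). dist (Q h s) (g s) < e) (at t)"
      proof eventually_elim
        case (elim h)
        show ?case
        proof
          fix s assume "s \<in> cball s0 (r / 2)"
          hence s: "s \<in> ball s0 r"
            using sub by blast
          have "norm (K h s - K t s - deriv (\<lambda>t. K t s) t * (h - t)) \<le> 9 * M / r\<^sup>2 * (norm (h - t))\<^sup>2"
            using holomorphic_on_subset[OF Kt r(3)] s r M elim
            by (intro holomorphic_first_order_bound) auto
          also have "K h s - K t s - deriv (\<lambda>t. K t s) t * (h - t) = (Q h s - g s) * (h - t)"
            using elim by (simp add: Q_def g_def field_simps)
          finally have "norm (Q h s - g s) * norm (h - t) \<le> 9 * M / r\<^sup>2 * norm (h - t) * norm (h - t)"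
            by (simp add: norm_mult power2_eq_square mult.assoc)
          hence "norm (Q h s - g s) \<le> 9 * M / r\<^sup>2 * norm (h - t)"
            by (rule mult_right_le_imp_le) (use elim in auto)
          thus "dist (Q h s) (g s) < e"
            using elim by (simp add: dist_norm)
        qed
      qed
    qed
    ultimately have "g holomorphic_on ball s0 (r / 2)"
      by (rule holomorphic_uniform_limit) auto
    thus ?thesis
      using r unfolding g_def by (intro exI[of _ "r / 2"]) auto
  qed
  hence "(\<lambda>s. deriv (\<lambda>t. K t s) t) analytic_on S"
    by (auto simp: analytic_on_def)
  thus ?thesis
    by (rule analytic_imp_holomorphic)
qed

lemma sep_holomorphic_deriv:
  assumes K: "sep_holomorphic T S K"
  shows "sep_holomorphic T S (\<lambda>t s. deriv (\<lambda>t. K t s) t)"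
  unfolding sep_holomorphic_def
proof (intro conjI ballI)
  show "open T" "open S"
    using K by (auto simp: sep_holomorphic_def)
  show "(\<lambda>t. deriv (\<lambda>t. K t s) t) holomorphic_on T" if "s \<in> S" for s
    using K that by (auto simp: sep_holomorphic_def intro: holomorphic_deriv)
  show "(\<lambda>s. deriv (\<lambda>t. K t s) t) holomorphic_on S" if "t \<in> T" for t
    using sep_holomorphic_deriv_param[OF K that] .
  fix t s assume ts: "t \<in> T" "s \<in> S"
  obtain r M where r: "r > 0" "M > 0" "ball t r \<subseteq> T" "ball s r \<subseteq> S"
    and M: "\<And>t' s'. t' \<in> ball t r \<Longrightarrow> s' \<in> ball s r \<Longrightarrow> norm (K t' s') \<le> M"
    using sep_holomorphicE[OF K ts] by metis
  have "norm (deriv (\<lambda>t. K t s') t') \<le> 3 * M / (r / 2)"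
    if "t' \<in> ball t (r / 2)" "s' \<in> ball s (r / 2)" for t' s'
  proof -
    have "dist t x < r" if "dist t' x < r / 2" for x
      using that \<open>t' \<in> _\<close> dist_triangle[of t x t'] by auto
    hence sub: "ball t' (r / 2) \<subseteq> ball t r"
      by auto
    have s': "s' \<in> ball s r"
      using that r by auto
    have "(\<lambda>t. K t s') holomorphic_on T"
      using K s' r by (auto simp: sep_holomorphic_def)
    hence "(\<lambda>t. K t s') holomorphic_on ball t' (r / 2)"
      by (rule holomorphic_on_subset) (use r sub in blast)
    moreover have "norm (K z s') \<le> M" if "z \<in> ball t' (r / 2)" for z
      using M sub s' that by blast
    ultimately have "norm (if t' = t' then deriv (\<lambda>t. K t s') t' else (K t' s' - K t' s') / (t' - t'))
        \<le> 3 * M / (r / 2)"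
      using \<open>M > 0\<close> r by (intro difference_quotient_bound) auto
    thus ?thesis
      by simp
  qed
  thus "\<exists>r>0. \<exists>N>0. ball t r \<subseteq> T \<and> ball s r \<subseteq> S \<and>
        (\<forall>t'\<in>ball t r. \<forall>s'\<in>ball s r. norm (deriv (\<lambda>t. K t s') t') \<le> N)"
    using r by (intro exI[of _ "r / 2"] conjI exI[of _ "3 * M / (r / 2)"]) auto
qed

lemma sep_holomorphic_higher_deriv:
  assumes "sep_holomorphic T S K"
  shows "sep_holomorphic T S (\<lambda>t s. (deriv ^^ k) (\<lambda>t. K t s) t)"
proof (induction k)
  case (Suc k)
  from sep_holomorphic_deriv[OF this] show ?case
    by simp
qed (use assms in simp)

text \<open>
  Osgood's lemma. The increment is split at the point \<open>(t, s')\<close>. The first order remainder in \<open>t\<close> is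
  quadratic uniformly in \<open>s'\<close>, and the partial derivative in \<open>t\<close> depends continuously on \<open>s'\<close> by the
  previous lemmas.
\<close>

lemma sep_holomorphic_imp_hol_at:
  assumes K: "sep_holomorphic T S K" and ts: "t \<in> T" "s \<in> S"
  shows "hol_at (\<lambda>(t, s). K t s) (t, s)"
proof -
  obtain r M where r: "r > 0" "M > 0" "ball t r \<subseteq> T" "ball s r \<subseteq> S"
    and M: "\<And>t' s'. t' \<in> ball t r \<Longrightarrow> s' \<in> ball s r \<Longrightarrow> norm (K t' s') \<le> M"
    using sep_holomorphicE[OF K ts] by metis
  define a where "a s' = deriv (\<lambda>t. K t s') t" for s'
  define b where "b = deriv (K t) s"
  have a: "isCont a s"
    using sep_holomorphic_deriv_param[OF K ts(1)] K ts(2)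
    unfolding a_def sep_holomorphic_def
    by (intro continuous_on_interior[OF holomorphic_on_imp_continuous_on])
      (use ts in \<open>auto simp: interior_open\<close>)
  have b: "(K t has_derivative (*) b) (at s)"
    using K ts unfolding b_def has_field_derivative_def[symmetric]
    by (auto simp: sep_holomorphic_def intro: holomorphic_derivI)
  define L where "L = (\<lambda>v. a s * fst v + b * snd v)"
  have "((\<lambda>(t, s). K t s) has_derivative L) (at (t, s))"
    unfolding has_derivative_at_alt
  proof (intro conjI allI impI)
    show "bounded_linear L"
      unfolding L_def
      by (rule bounded_linear_add; rule bounded_linear_const_mult)
        (rule bounded_linear_fst bounded_linear_snd)+
    fix e :: real assume e: "e > 0"
    have e3: "e / 3 > 0"
      using e by simp
    obtain d1 where d1: "d1 > 0" "\<And>s'. norm (s' - s) < d1 \<Longrightarrow> norm (a s' - a s) < e / 3"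
      using a[unfolded continuous_at_eps_delta dist_norm, rule_format, OF e3] by blast
    obtain d2 where d2: "d2 > 0"
      "\<And>s'. norm (s' - s) < d2 \<Longrightarrow> norm (K t s' - K t s - b * (s' - s)) \<le> e / 3 * norm (s' - s)"
      using b[unfolded has_derivative_at_alt, THEN conjunct2, rule_format, OF e3] by blast
    define C where "C = 9 * M / r\<^sup>2"
    have C: "C > 0"
      using r by (simp add: C_def)
    define d where "d = Min {d1, d2, r, e / (3 * C)}"
    have d: "d > 0" "d \<le> d1" "d \<le> d2" "d \<le> r" "d \<le> e / (3 * C)"
      using d1 d2 r e C by (auto simp: d_def)
    have "norm (K t' s' - K t s - L ((t', s') - (t, s))) \<le> e * norm ((t', s') - (t, s))"
      if lt: "norm ((t', s') - (t, s)) < d" for t' s'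
    proof -
      let ?n = "norm ((t', s') - (t, s))"
      have n: "norm (t' - t) \<le> ?n" "norm (s' - s) \<le> ?n"
        using norm_fst_le[of "t' - t" "s' - s"] norm_snd_le[of "s' - s" "t' - t"] by auto
      have t': "t' \<in> ball t r" and s': "s' \<in> ball s r"
        using n lt d by (auto simp: dist_norm norm_minus_commute)
      have "(\<lambda>t. K t s') holomorphic_on T"
        using K s' r by (auto simp: sep_holomorphic_def)
      hence hol: "(\<lambda>t. K t s') holomorphic_on ball t r"
        by (rule holomorphic_on_subset) (use r in blast)
      have "norm (K t' s' - K t s' - a s' * (t' - t)) \<le> C * (norm (t' - t))\<^sup>2"
        unfolding C_def a_def using hol s' t' r M
        by (intro holomorphic_first_order_bound) auto
      also have "\<dots> \<le> C * (e / (3 * C) * ?n)"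
        unfolding power2_eq_square using n lt d C by (intro mult_left_mono mult_mono) auto
      also have "\<dots> = e / 3 * ?n"
        using C by simp
      finally have 1: "norm (K t' s' - K t s' - a s' * (t' - t)) \<le> e / 3 * ?n" .
      have 2: "norm ((a s' - a s) * (t' - t)) \<le> e / 3 * ?n"
        unfolding norm_mult using d1(2)[of s'] n lt d e by (intro mult_mono) auto
      have "norm (K t s' - K t s - b * (s' - s)) \<le> e / 3 * norm (s' - s)"
        using n lt d by (intro d2(2)) linarith
      also have "\<dots> \<le> e / 3 * ?n"
        using n e by (intro mult_left_mono) auto
      finally have 3: "norm (K t s' - K t s - b * (s' - s)) \<le> e / 3 * ?n" .
      have "K t' s' - K t s - L ((t', s') - (t, s)) =
          (K t' s' - K t s' - a s' * (t' - t)) + (a s' - a s) * (t' - t)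
          + (K t s' - K t s - b * (s' - s))"
        by (simp add: L_def algebra_simps)
      also have "norm \<dots> \<le> e / 3 * ?n + e / 3 * ?n + e / 3 * ?n"
        by (intro norm_triangle_mono 1 2 3)
      finally show ?thesis
        by simp
    qed
    thus "\<exists>d>0. \<forall>y. norm (y - (t, s)) < d \<longrightarrow>
        norm ((case y of (t, s) \<Rightarrow> K t s) - (case (t, s) of (t, s) \<Rightarrow> K t s) - L (y - (t, s)))
          \<le> e * norm (y - (t, s))"
      using d(1) by (intro exI[of _ d]) auto
  qed
  thus ?thesis
    by (rule hol_atI) (simp add: L_def cscale_prod_def cscale_complex_def algebra_simps)
qed

lemma sep_holomorphic_divide_var:
  assumes K: "sep_holomorphic T S K" and 0: "0 \<in> T" and K0: "\<And>s. s \<in> S \<Longrightarrow> K 0 s = 0"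
  shows "\<exists>Q. sep_holomorphic T S Q \<and> (\<forall>t\<in>T. \<forall>s\<in>S. K t s = t * Q t s)"
proof -
  define Q where "Q t s = (if t = 0 then deriv (\<lambda>t. K t s) 0 else K t s / t)" for t s
  have "sep_holomorphic T S Q"
    unfolding sep_holomorphic_def
  proof (intro conjI ballI)
    show "open T" "open S"
      using K by (auto simp: sep_holomorphic_def)
    fix s assume s: "s \<in> S"
    have "(\<lambda>t. if t = 0 then deriv (\<lambda>t. K t s) 0 else (K t s - K 0 s) / (t - 0)) holomorphic_on T"
      using K s 0 by (intro difference_quotient_holomorphic) (auto simp: sep_holomorphic_def)
    thus "(\<lambda>t. Q t s) holomorphic_on T"
      using K0[OF s] by (simp add: Q_def cong: if_cong)
  next
    fix t assume t: "t \<in> T"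
    show "Q t holomorphic_on S"
    proof (cases "t = 0")
      case True
      thus ?thesis
        using sep_holomorphic_deriv_param[OF K 0] by (simp add: Q_def[abs_def])
    next
      case False
      have "(\<lambda>s. K t s / t) holomorphic_on S"
        using K t False by (auto simp: sep_holomorphic_def intro!: holomorphic_intros)
      thus ?thesis
        using False by (simp add: Q_def[abs_def])
    qed
  next
    fix t s assume ts: "t \<in> T" "s \<in> S"
    show "\<exists>r>0. \<exists>M>0. ball t r \<subseteq> T \<and> ball s r \<subseteq> S \<and>
        (\<forall>t'\<in>ball t r. \<forall>s'\<in>ball s r. norm (Q t' s') \<le> M)"
    proof (cases "t = 0")
      case True
      obtain r M where r: "r > 0" "M > 0" "ball 0 r \<subseteq> T" "ball s r \<subseteq> S"
        and M: "\<And>t' s'. t' \<in> ball 0 r \<Longrightarrow> s' \<in> ball s r \<Longrightarrow> norm (K t' s') \<le> M"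
        using sep_holomorphicE[OF K 0 ts(2)] by metis
      have "norm (Q t' s') \<le> 3 * M / r" if "t' \<in> ball 0 r" "s' \<in> ball s r" for t' s'
      proof -
        have "(\<lambda>t. K t s') holomorphic_on T"
          using K that r by (auto simp: sep_holomorphic_def)
        hence "(\<lambda>t. K t s') holomorphic_on ball 0 r"
          by (rule holomorphic_on_subset) (use r in blast)
        from difference_quotient_bound[OF this \<open>M > 0\<close> _ that(1)] show ?thesis
          using M that K0[of s'] r by (auto simp: Q_def split: if_splits)
      qed
      thus ?thesis
        using r True by (intro exI[of _ r] conjI exI[of _ "3 * M / r"]) auto
    next
      case False
      obtain r M where r: "r > 0" "M > 0" "ball t r \<subseteq> T" "ball s r \<subseteq> S"
        and M: "\<And>t' s'. t' \<in> ball t r \<Longrightarrow> s' \<in> ball s r \<Longrightarrow> norm (K t' s') \<le> M"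
        using sep_holomorphicE[OF K ts] by metis
      define q where "q = min r (norm t / 2)"
      have "norm (Q t' s') \<le> M / (norm t / 2)" if "t' \<in> ball t q" "s' \<in> ball s q" for t' s'
      proof -
        have "norm t' \<ge> norm t / 2"
          using that norm_triangle_sub[of t t'] by (auto simp: q_def dist_norm)
        moreover have "norm (K t' s') \<le> M"
          using that by (intro M) (auto simp: q_def)
        ultimately have "norm (K t' s') / norm t' \<le> M / (norm t / 2)"
          using False r(2) by (intro frac_le) auto
        moreover have "t' \<noteq> 0"
          using \<open>norm t' \<ge> norm t / 2\<close> False by auto
        ultimately show ?thesis
          by (simp add: Q_def norm_divide)
      qed
      moreover have "q > 0" "ball t q \<subseteq> T" "ball s q \<subseteq> S"
        using r False by (auto simp: q_def)
      ultimately show ?thesis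
        using r False by (intro exI[of _ q] conjI exI[of _ "M / (norm t / 2)"]) auto
    qed
  qed
  moreover have "K t s = t * Q t s" if "t \<in> T" "s \<in> S" for t s
    using K0 that by (simp add: Q_def)
  ultimately show ?thesis
    by blast
qed


section \<open>Orders of vanishing along arcs\<close>

definition vanishes_to_order :: "nat \<Rightarrow> (complex \<Rightarrow> complex) \<Rightarrow> bool" where
  "vanishes_to_order k g \<longleftrightarrow> (\<forall>j<k. (deriv ^^ j) g 0 = 0)"

lemma higher_deriv_cong_open:
  fixes f g :: "complex \<Rightarrow> complex"
  assumes "open S" "z \<in> S" "\<And>w. w \<in> S \<Longrightarrow> f w = g w"
  shows "(deriv ^^ i) f z = (deriv ^^ i) g z"
  by (rule higher_deriv_cong_ev) (use assms in \<open>auto simp: eventually_nhds\<close>)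

lemma higher_deriv_times_var:
  assumes "h holomorphic_on S" "open S" "0 \<in> S"
  shows "(deriv ^^ j) (\<lambda>t. t * h t) 0 = of_nat j * (deriv ^^ (j - 1)) h 0"
proof -
  have "(deriv ^^ j) (\<lambda>t. t * h t) 0 =
      (\<Sum>i = 0..j. of_nat (j choose i) * (deriv ^^ i) (\<lambda>t. t) 0 * (deriv ^^ (j - i)) h 0)"
    using assms by (intro higher_deriv_mult[of _ S]) (auto intro: holomorphic_intros)
  also have "\<dots> = (\<Sum>i \<in> {0..j}. if i = 1 then of_nat j * (deriv ^^ (j - 1)) h 0 else 0)"
    by (intro sum.cong) auto
  also have "\<dots> = of_nat j * (deriv ^^ (j - 1)) h 0"
    by auto
  finally show ?thesis .
qed

lemma higher_deriv_times_power:
  assumes "h holomorphic_on S" "open S" "0 \<in> S"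
  shows "vanishes_to_order k (\<lambda>t. t ^ k * h t) \<and> (deriv ^^ k) (\<lambda>t. t ^ k * h t) 0 = fact k * h 0"
proof (induction k)
  case (Suc k)
  have "(\<lambda>t. t ^ k * h t) holomorphic_on S"
    using assms by (intro holomorphic_intros)
  from higher_deriv_times_var[OF this assms(2,3)]
  have *: "(deriv ^^ j) (\<lambda>t. t ^ Suc k * h t) 0 = of_nat j * (deriv ^^ (j - 1)) (\<lambda>t. t ^ k * h t) 0" for j
    by (simp add: mult.assoc)
  show ?case
    unfolding vanishes_to_order_def *
  proof (intro conjI allI impI)
    fix j assume "j < Suc k"
    thus "of_nat j * (deriv ^^ (j - 1)) (\<lambda>t. t ^ k * h t) 0 = 0"
      using Suc by (cases j) (auto simp: vanishes_to_order_def)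
  qed (use Suc in simp)
qed (simp add: vanishes_to_order_def)

text \<open>
  This turns the pointwise information that \<open>K\<close> has order at least \<open>k\<close> in \<open>t\<close> for each \<open>s\<close> into a
  factorization that is holomorphic in both variables.
\<close>

lemma sep_holomorphic_divide_power:
  assumes "sep_holomorphic T S K" "0 \<in> T" "\<And>s. s \<in> S \<Longrightarrow> vanishes_to_order k (\<lambda>t. K t s)"
  shows "\<exists>Q. sep_holomorphic T S Q \<and> (\<forall>t\<in>T. \<forall>s\<in>S. K t s = t ^ k * Q t s)"
  using assms
proof (induction k arbitrary: K)
  case (Suc k)
  have "K 0 s = 0" if "s \<in> S" for s
    using Suc.prems(3)[OF that] by (auto simp: vanishes_to_order_def dest: spec[of _ 0])
  then obtain Q where Q: "sep_holomorphic T S Q" "\<forall>t\<in>T. \<forall>s\<in>S. K t s = t * Q t s"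
    using sep_holomorphic_divide_var[OF Suc.prems(1,2)] by blast
  have T: "open T"
    using Q by (simp add: sep_holomorphic_def)
  have "vanishes_to_order k (\<lambda>t. Q t s)" if s: "s \<in> S" for s
    unfolding vanishes_to_order_def
  proof (intro allI impI)
    fix j assume "j < k"
    hence "0 = (deriv ^^ Suc j) (\<lambda>t. K t s) 0"
      using Suc.prems(3)[OF s] by (simp add: vanishes_to_order_def del: funpow.simps)
    also have "\<dots> = (deriv ^^ Suc j) (\<lambda>t. t * Q t s) 0"
      using Q(2) s Suc.prems(2) by (intro higher_deriv_cong_open[OF T]) auto
    also have "\<dots> = of_nat (Suc j) * (deriv ^^ (Suc j - 1)) (\<lambda>t. Q t s) 0"
      using Q(1) s Suc.prems(2) by (intro higher_deriv_times_var[of _ T]) (auto simp: sep_holomorphic_def)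
    finally show "(deriv ^^ j) (\<lambda>t. Q t s) 0 = 0"
      by (simp del: of_nat_Suc funpow.simps)
  qed
  from Suc.IH[OF Q(1) Suc.prems(2) this] obtain R where
    R: "sep_holomorphic T S R" "\<forall>t\<in>T. \<forall>s\<in>S. Q t s = t ^ k * R t s"
    by blast
  thus ?case
    using Q by (intro exI[of _ R]) (auto simp: mult.assoc)
qed auto

lemma vanishes_to_order_divide:
  assumes "g holomorphic_on S" "open S" "0 \<in> S" "vanishes_to_order k g"
  shows "\<exists>h. h holomorphic_on S \<and> (\<forall>t\<in>S. g t = t ^ k * h t)"
proof -
  have "sep_holomorphic S UNIV (\<lambda>t s. g t)"
    by (rule hol_at_imp_sep_holomorphic)
      (use assms in \<open>auto intro!: hol_at_compose[of fst _ g] hol_at_intros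
         simp: case_prod_unfold intro: holomorphic_on_imp_hol_at\<close>)
  from sep_holomorphic_divide_power[OF this assms(3) assms(4)] obtain Q
    where "sep_holomorphic S UNIV Q" "\<forall>t\<in>S. \<forall>s\<in>UNIV. g t = t ^ k * Q t s"
    by blast
  thus ?thesis
    by (intro exI[of _ "\<lambda>t. Q t 0"]) (auto simp: sep_holomorphic_def)
qed

lemma factored_order:
  assumes "h holomorphic_on S" "open S" "0 \<in> S" "\<And>t. t \<in> S \<Longrightarrow> g t = t ^ k * h t"
  shows "vanishes_to_order k g" "(deriv ^^ k) g 0 = fact k * h 0"
proof -
  have "(deriv ^^ j) g 0 = (deriv ^^ j) (\<lambda>t. t ^ k * h t) 0" for j
    using assms by (intro higher_deriv_cong_open[of S]) auto
  thus "vanishes_to_order k g" "(deriv ^^ k) g 0 = fact k * h 0"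
    using higher_deriv_times_power[OF assms(1-3), of k] by (auto simp: vanishes_to_order_def)
qed

lemma enat_Inf_mem:
  fixes A :: "enat set"
  assumes "A \<noteq> {}"
  shows "Inf A \<in> A"
proof -
  obtain a where "a \<in> A"
    using assms by blast
  hence "(LEAST x. x \<in> A) \<in> A"
    by (rule LeastI)
  thus ?thesis
    using assms unfolding Inf_enat_def by (simp only: simp_thms if_False)
qed

lemma vanishing_order_eq_iff:
  "vanishing_order g = enat k \<longleftrightarrow> vanishes_to_order k g \<and> (deriv ^^ k) g 0 \<noteq> 0"
proof -
  let ?A = "{enat k |k. (deriv ^^ k) g 0 \<noteq> 0}"
  show ?thesis
  proof
    assume eq: "vanishing_order g = enat k"
    have "?A \<noteq> {}"
    proof
      assume "?A = {}"
      hence "vanishing_order g = \<infinity>"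
        by (simp only: vanishing_order_def Inf_enat_def simp_thms if_True)
      thus False
        using eq by simp
    qed
    hence "Inf ?A \<in> ?A"
      by (rule enat_Inf_mem)
    moreover have "enat j \<notin> ?A" if "j < k" for j
    proof
      assume "enat j \<in> ?A"
      hence "Inf ?A \<le> enat j"
        by (rule Inf_lower)
      thus False
        using eq that by (simp add: vanishing_order_def)
    qed
    ultimately show "vanishes_to_order k g \<and> (deriv ^^ k) g 0 \<noteq> 0"
      using eq by (auto simp: vanishing_order_def vanishes_to_order_def)
  next
    assume A: "vanishes_to_order k g \<and> (deriv ^^ k) g 0 \<noteq> 0"
    show "vanishing_order g = enat k"
      unfolding vanishing_order_def
    proof (rule antisym)
      show "Inf ?A \<le> enat k"
        using A by (intro Inf_lower) auto
      show "enat k \<le> Inf ?A"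
        using A by (intro Inf_greatest) (auto simp: vanishes_to_order_def not_less[symmetric])
    qed
  qed
qed

lemma mult0_eq_imp:
  assumes "mult0 f = enat m"
  shows "\<And>j v. j < m \<Longrightarrow> homogeneous_part f j v = 0" "\<exists>v. homogeneous_part f m v \<noteq> 0"
proof -
  let ?A = "{enat k |k. \<exists>v. homogeneous_part f k v \<noteq> 0}"
  have "?A \<noteq> {}"
  proof
    assume "?A = {}"
    hence "mult0 f = \<infinity>"
      by (simp only: mult0_def Inf_enat_def simp_thms if_True)
    thus False
      using assms by simp
  qed
  hence "Inf ?A \<in> ?A"
    by (rule enat_Inf_mem)
  thus "\<exists>v. homogeneous_part f m v \<noteq> 0"
    using assms by (auto simp: mult0_def)
  fix j v assume "j < m"
  show "homogeneous_part f j v = 0"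
  proof (rule ccontr)
    assume "homogeneous_part f j v \<noteq> 0"
    hence "Inf ?A \<le> enat j"
      by (intro Inf_lower) auto
    thus False
      using assms \<open>j < m\<close> by (simp add: mult0_def)
  qed
qed

lemma hol_at_sum:
  "(\<And>i. i \<in> I \<Longrightarrow> hol_at (f i) z) \<Longrightarrow> hol_at (\<lambda>z. \<Sum>i\<in>I. f i z) z"
  by (induction I rule: infinite_finite_induct) (auto intro: hol_at_const hol_at_add)

lemma hol_at_vec_lambda:
  fixes F :: "'n::finite \<Rightarrow> 'a::complex_normed_space \<Rightarrow> complex"
  assumes "\<And>k. hol_at (F k) z"
  shows "hol_at (\<lambda>z. \<chi> k. F k z) z"
proof -
  have "(\<lambda>z. \<chi> k. F k z) = (\<lambda>z. \<Sum>k\<in>UNIV. F k z *\<^sub>C axis k 1)"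
    by (auto simp: vec_eq_iff cscale_vec_def axis_def cscale_complex_def if_distrib sum.delta
          cong: if_cong)
  moreover have "hol_at (\<lambda>z. \<Sum>k\<in>UNIV. F k z *\<^sub>C (axis k 1 :: complex ^ 'n)) z"
    by (intro hol_at_sum hol_at_cscale hol_at_const assms)
  ultimately show ?thesis
    by simp
qed

lemma hol_at_divide_var:
  fixes \<phi> :: "complex \<Rightarrow> complex ^ 'n"
  assumes "open S" "0 \<in> S" "\<And>t. t \<in> S \<Longrightarrow> hol_at \<phi> t" "\<phi> 0 = 0"
  obtains \<eta> where "\<And>t. t \<in> S \<Longrightarrow> hol_at \<eta> t" "\<And>t. t \<in> S \<Longrightarrow> \<phi> t = t *\<^sub>C \<eta> t"
proof -
  have "\<exists>h. h holomorphic_on S \<and> (\<forall>t\<in>S. vec_nth (\<phi> t) k = t ^ 1 * h t)" for k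
    by (rule vanishes_to_order_divide)
      (use assms in \<open>auto intro!: hol_at_imp_holomorphic_on hol_at_intros simp: vanishes_to_order_def\<close>)
  then obtain h where h: "\<And>k. h k holomorphic_on S" "\<And>k t. t \<in> S \<Longrightarrow> vec_nth (\<phi> t) k = t * h k t"
    by (metis power_one_right)
  show thesis
    by (rule that[of "\<lambda>t. \<chi> k. h k t"])
      (use h assms in \<open>auto intro!: hol_at_vec_lambda holomorphic_on_imp_hol_at[of _ S]
         simp: vec_eq_iff cscale_vec_def cscale_complex_def\<close>)
qed

text \<open>
  In \<open>f (t \<eta>(s))\<close> with \<open>t\<close> and \<open>s\<close> independent, the Taylor coefficients in \<open>t\<close> are the homogeneous
  parts of \<open>f\<close> at \<open>\<eta>(s)\<close>, so \<open>t\<^sup>m\<close> can be divided out holomorphically in both variables. On the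
  diagonal \<open>s = t\<close> the quotient is \<open>h\<close>.
\<close>

lemma order_along_arc:
  fixes f :: "'a::complex_normed_space \<Rightarrow> complex"
  assumes U: "open U" "0 \<in> U" and f: "\<And>z. z \<in> U \<Longrightarrow> hol_at f z"
    and S: "open S" "0 \<in> S" and \<eta>: "\<And>t. t \<in> S \<Longrightarrow> hol_at \<eta> t"
    and m: "\<And>j v. j < m \<Longrightarrow> homogeneous_part f j v = 0"
  shows "\<exists>r>0. \<exists>h. h holomorphic_on ball 0 r \<and> (\<forall>t\<in>ball 0 r. f (t *\<^sub>C \<eta> t) = t ^ m * h t) \<and>
           h 0 = homogeneous_part f m (\<eta> 0)"
proof -
  define G where "G = (\<lambda>p :: complex \<times> complex. fst p *\<^sub>C \<eta> (snd p))"
  have G: "hol_at G p" if "snd p \<in> S" for p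
    unfolding G_def
    by (rule hol_at_cscale[OF hol_at_fst[OF hol_at_ident]
          hol_at_compose[OF hol_at_snd[OF hol_at_ident] \<eta>[OF that]]])
  have "isCont G (0, 0)"
    using S by (intro hol_at_imp_continuous G) auto
  moreover have "G (0, 0) \<in> U"
    using U by (simp add: G_def)
  ultimately obtain d where d: "d > 0" "\<And>p. dist p (0, 0) < d \<Longrightarrow> G p \<in> U"
    by (smt (verit) U(1) continuous_at_eps_delta mem_ball open_contains_ball_eq dist_commute subsetD)
  obtain r0 where r0: "r0 > 0" "ball 0 r0 \<subseteq> S"
    using S openE by blast
  define r where "r = min r0 (d / 2)"
  have r: "r > 0" "ball 0 r \<subseteq> S"
    using r0 d by (auto simp: r_def)
  have GU: "G (t, s) \<in> U" if "t \<in> ball 0 r" "s \<in> ball 0 r" for t s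
  proof (rule d(2))
    have "dist (t, s) (0, 0) \<le> norm t + norm s"
      unfolding dist_Pair_Pair using sqrt_sum_squares_le_sum[of "norm t" "norm s"] by simp
    thus "dist (t, s) (0, 0) < d"
      using that by (simp add: r_def)
  qed
  have fG: "hol_at (\<lambda>p. f (G p)) (t, s)" if "t \<in> ball 0 r" "s \<in> ball 0 r" for t s
    by (rule hol_at_compose[OF G f[OF GU[OF that]]]) (use that r in auto)
  hence K: "sep_holomorphic (ball 0 r) (ball 0 r) (\<lambda>t s. f (G (t, s)))"
    by (intro hol_at_imp_sep_holomorphic) (auto simp: case_prod_unfold)
  have van: "vanishes_to_order m (\<lambda>t. f (G (t, s)))" for s
    using m[of _ "\<eta> s"] by (auto simp: vanishes_to_order_def homogeneous_part_def G_def)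
  obtain Q where Q: "sep_holomorphic (ball 0 r) (ball 0 r) Q"
      "\<forall>t\<in>ball 0 r. \<forall>s\<in>ball 0 r. f (G (t, s)) = t ^ m * Q t s"
    using sep_holomorphic_divide_power[OF K _ van] r by auto
  have "hol_at (\<lambda>t. (\<lambda>(t, s). Q t s) (t, t)) t" if "t \<in> ball 0 r" for t
    using sep_holomorphic_imp_hol_at[OF Q(1) that that]
    by (rule hol_at_compose[of "\<lambda>t. (t, t)" t "\<lambda>(t, s). Q t s", OF hol_at_Pair[OF hol_at_ident hol_at_ident]])
  hence "(\<lambda>t. Q t t) holomorphic_on ball 0 r"
    by (intro hol_at_imp_holomorphic_on) auto
  moreover have "f (t *\<^sub>C \<eta> t) = t ^ m * Q t t" if "t \<in> ball 0 r" for t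
    using Q(2) that by (auto simp: G_def)
  moreover have "Q 0 0 = homogeneous_part f m (\<eta> 0)"
    using factored_order(2)[of "\<lambda>t. Q t 0" "ball 0 r" "\<lambda>t. f (G (t, 0))" m] Q r
    by (simp add: sep_holomorphic_def homogeneous_part_def G_def)
  ultimately show ?thesis
    using r by blast
qed

lemma homogeneous_part_holomorphic_on_lines:
  fixes f :: "'a::complex_normed_space \<Rightarrow> complex"
  assumes U: "open U" "0 \<in> U" and f: "\<And>z. z \<in> U \<Longrightarrow> hol_at f z"
  shows "(\<lambda>\<sigma>. homogeneous_part f k (c + \<sigma> *\<^sub>C d)) holomorphic_on UNIV"
proof -
  have "(\<lambda>\<sigma>. homogeneous_part f k (c + \<sigma> *\<^sub>C d)) holomorphic_on ball \<sigma>0 1" for \<sigma>0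
  proof -
    obtain \<rho> where \<rho>: "\<rho> > 0" "ball 0 \<rho> \<subseteq> U"
      using U openE by blast
    define N where "N = norm c + (norm \<sigma>0 + 1) * norm d + 1"
    have N: "N > 0"
      by (simp add: N_def add_nonneg_pos)
    define r where "r = \<rho> / N"
    have r: "r > 0"
      using \<rho> N by (simp add: r_def)
    have inU: "t *\<^sub>C (c + \<sigma> *\<^sub>C d) \<in> U" if "t \<in> ball 0 r" "\<sigma> \<in> ball \<sigma>0 1" for t \<sigma>
    proof -
      have "norm \<sigma> \<le> norm \<sigma>0 + 1"
        using that norm_triangle_sub[of \<sigma> \<sigma>0] by (simp add: dist_norm norm_minus_commute)
      hence "norm (c + \<sigma> *\<^sub>C d) \<le> norm c + (norm \<sigma>0 + 1) * norm d"
        by (intro norm_triangle_mono) (auto simp: norm_cscale mult_right_mono)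
      hence "norm (t *\<^sub>C (c + \<sigma> *\<^sub>C d)) \<le> norm t * N"
        by (simp add: norm_cscale N_def mult_left_mono)
      also have "\<dots> < \<rho>"
        using that N by (simp add: r_def divide_simps)
      finally show ?thesis
        using \<rho> by auto
    qed
    have "hol_at (\<lambda>p. fst p *\<^sub>C (c + snd p *\<^sub>C d)) q" for q :: "complex \<times> complex"
      by (intro hol_at_intros)
    from hol_at_compose[OF this f[OF inU]]
    have "sep_holomorphic (ball 0 r) (ball \<sigma>0 1) (\<lambda>t \<sigma>. f (t *\<^sub>C (c + \<sigma> *\<^sub>C d)))"
      by (intro hol_at_imp_sep_holomorphic) (auto simp: case_prod_unfold)
    from sep_holomorphic_higher_deriv[OF this, of k] r
    have "(\<lambda>\<sigma>. (deriv ^^ k) (\<lambda>t. f (t *\<^sub>C (c + \<sigma> *\<^sub>C d))) 0) holomorphic_on ball \<sigma>0 1"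
      by (auto simp: sep_holomorphic_def)
    thus ?thesis
      unfolding homogeneous_part_def by (intro holomorphic_intros) auto
  qed
  hence "(\<lambda>\<sigma>. homogeneous_part f k (c + \<sigma> *\<^sub>C d)) analytic_on UNIV"
    unfolding analytic_on_def using zero_less_one by blast
  thus ?thesis
    by (rule analytic_imp_holomorphic)
qed

lemma holomorphic_nonzero_near:
  assumes g: "g holomorphic_on S" and S: "open S" "connected S" "a \<in> S" "b \<in> S" "g b \<noteq> 0" and "\<epsilon> > 0"
  shows "\<exists>\<sigma>\<in>S. dist a \<sigma> < \<epsilon> \<and> g \<sigma> \<noteq> 0"
proof (rule ccontr)
  assume neg: "\<not> ?thesis"
  have "g b = (\<lambda>_. 0) b"
  proof (rule analytic_continuation_open[of "S \<inter> ball a \<epsilon>" S g "\<lambda>_. 0"])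
    show "S \<inter> ball a \<epsilon> \<noteq> {}"
      using S \<open>\<epsilon> > 0\<close> by force
  qed (use g S neg in auto)
  thus False
    using S by simp
qed

text \<open>
  On the complex line from \<open>c\<close> to \<open>v\<close> the homogeneous part is holomorphic and does not vanish at \<open>v\<close>,
  hence its zeros on the line do not accumulate at \<open>c\<close>.
\<close>

lemma homogeneous_part_nonzero_near:
  fixes f :: "'a::complex_normed_space \<Rightarrow> complex"
  assumes U: "open U" "0 \<in> U" and f: "\<And>z. z \<in> U \<Longrightarrow> hol_at f z"
    and v: "homogeneous_part f m v \<noteq> 0" and "\<epsilon> > 0"
  shows "\<exists>w. norm w < \<epsilon> \<and> homogeneous_part f m (c + w) \<noteq> 0"
proof -
  define g where "g \<sigma> = homogeneous_part f m (c + \<sigma> *\<^sub>C (v - c))" for \<sigma>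
  have "g holomorphic_on UNIV"
    unfolding g_def by (rule homogeneous_part_holomorphic_on_lines[OF U f])
  moreover have "g 1 \<noteq> 0"
    using v by (simp add: g_def)
  ultimately obtain \<sigma> where \<sigma>: "dist 0 \<sigma> < \<epsilon> / (norm (v - c) + 1)" "g \<sigma> \<noteq> 0"
    using holomorphic_nonzero_near[of g UNIV 0 1 "\<epsilon> / (norm (v - c) + 1)"] \<open>\<epsilon> > 0\<close>
    by (auto simp: add_nonneg_pos)
  have "norm \<sigma> * norm (v - c) \<le> norm \<sigma> * (norm (v - c) + 1)"
    by (intro mult_left_mono) auto
  also have "\<dots> < \<epsilon>"
    using \<sigma>(1) by (simp add: pos_less_divide_eq add_nonneg_pos)
  finally show ?thesis
    using \<sigma>(2) by (intro exI[of _ "\<sigma> *\<^sub>C (v - c)"]) (auto simp: g_def norm_cscale)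
qed

lemma nonzero_in_ball:
  fixes f :: "'a::complex_normed_space \<Rightarrow> complex"
  assumes "\<rho> > 0" and v: "homogeneous_part f m v \<noteq> 0"
  shows "\<exists>z\<in>ball 0 \<rho>. f z \<noteq> 0"
proof (rule ccontr)
  assume neg: "\<not> ?thesis"
  have "norm (s *\<^sub>C v) < \<rho>" if "s \<in> ball 0 (\<rho> / (norm v + 1))" for s
  proof -
    have "norm (s *\<^sub>C v) \<le> norm s * (norm v + 1)"
      by (simp add: norm_cscale mult_left_mono)
    also have "\<dots> < \<rho>"
      using that by (simp add: pos_less_divide_eq add_nonneg_pos)
    finally show ?thesis .
  qed
  hence "(deriv ^^ m) (\<lambda>s. f (s *\<^sub>C v)) 0 = (deriv ^^ m) (\<lambda>_. 0) 0"
    using neg \<open>\<rho> > 0\<close>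
    by (intro higher_deriv_cong_open[of "ball 0 (\<rho> / (norm v + 1))"]) (auto simp: add_nonneg_pos)
  thus False
    using v by (simp add: homogeneous_part_def)
qed

text \<open>
  The same argument as for the homogeneous parts, with the line restricted to its convex intersection with
  the ball on which \<open>f\<close> is defined.
\<close>

lemma nonzero_near:
  fixes f :: "'a::complex_normed_space \<Rightarrow> complex"
  assumes f: "\<And>z. z \<in> ball 0 \<rho> \<Longrightarrow> hol_at f z" and v: "homogeneous_part f m v \<noteq> 0"
    and z: "z \<in> ball 0 \<rho>" and "\<epsilon> > 0"
  shows "\<exists>w. norm w < \<epsilon> \<and> f (z + w) \<noteq> 0"
proof -
  have "\<rho> > 0"
    using z by (metis ball_empty empty_iff not_less)
  obtain y where y: "y \<in> ball 0 \<rho>" "f y \<noteq> 0"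
    using nonzero_in_ball[OF \<open>\<rho> > 0\<close> v] by blast
  define S where "S = (\<lambda>\<sigma>. z + \<sigma> *\<^sub>C (y - z)) -` ball 0 \<rho>"
  define g where "g \<sigma> = f (z + \<sigma> *\<^sub>C (y - z))" for \<sigma>
  have line: "hol_at (\<lambda>\<sigma>. z + \<sigma> *\<^sub>C (y - z)) \<sigma>" for \<sigma>
    by (intro hol_at_intros)
  have "open S"
    unfolding S_def
    by (rule open_vimage[OF open_ball hol_at_imp_continuous_on[of UNIV], OF line])
  have "convex S"
  proof (rule convexI)
    fix a b and u w :: real
    assume ab: "a \<in> S" "b \<in> S" and uw: "0 \<le> u" "0 \<le> w" "u + w = 1"
    have 1: "(u *\<^sub>R x) *\<^sub>C p = u *\<^sub>R (x *\<^sub>C p)" for u x and p :: 'a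
      by (simp add: scaleR_conv_of_real flip: cscale_cscale cscale_of_real)
    have "z + (u *\<^sub>R a + w *\<^sub>R b) *\<^sub>C (y - z) =
        (u + w) *\<^sub>R z + (u *\<^sub>R a + w *\<^sub>R b) *\<^sub>C (y - z)"
      using uw by simp
    also have "\<dots> = u *\<^sub>R (z + a *\<^sub>C (y - z)) + w *\<^sub>R (z + b *\<^sub>C (y - z))"
      by (simp add: cscale_add_left 1 algebra_simps)
    also have "\<dots> \<in> ball 0 \<rho>"
      using ab uw by (intro convexD[OF convex_ball]) (auto simp: S_def)
    finally show "u *\<^sub>R a + w *\<^sub>R b \<in> S"
      by (simp add: S_def)
  qed
  moreover have "g holomorphic_on S"
    unfolding g_def
    by (rule hol_at_imp_holomorphic_on, rule hol_at_compose[OF line f]) (simp add: S_def)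
  moreover have "0 \<in> S" "1 \<in> S" "g 1 \<noteq> 0"
    using y z by (auto simp: S_def g_def)
  moreover have "\<epsilon> / (norm (y - z) + 1) > 0"
    using \<open>\<epsilon> > 0\<close> by (simp add: add_nonneg_pos)
  ultimately obtain \<sigma> where \<sigma>: "dist 0 \<sigma> < \<epsilon> / (norm (y - z) + 1)" "g \<sigma> \<noteq> 0"
    using holomorphic_nonzero_near[of g S 0 1] \<open>open S\<close> convex_connected by blast
  have "norm \<sigma> * norm (y - z) \<le> norm \<sigma> * (norm (y - z) + 1)"
    by (intro mult_left_mono) auto
  also have "\<dots> < \<epsilon>"
    using \<sigma>(1) by (simp add: pos_less_divide_eq add_nonneg_pos)
  finally show ?thesis
    using \<sigma>(2) by (intro exI[of _ "\<sigma> *\<^sub>C (y - z)"]) (auto simp: g_def norm_cscale)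
qed


section \<open>Functions analytic on the closed unit disc\<close>

lemma open_cball_unit_ball:
  fixes V :: "complex set"
  assumes "open V" "cball 0 1 \<subseteq> V"
  shows "\<exists>R>1. ball 0 R \<subseteq> V"
proof -
  obtain e where e: "e > 0" "(\<Union>x\<in>cball 0 1. ball x e) \<subseteq> V"
    using compact_subset_open_imp_ball_epsilon_subset[OF compact_cball assms] by blast
  have "y \<in> V" if y: "norm y < 1 + e" for y
  proof (cases "norm y \<le> 1")
    case False
    have "dist (y /\<^sub>R norm y) y = norm ((inverse (norm y) - 1) *\<^sub>R y)"
      by (simp add: dist_norm scaleR_diff_left)
    also have "\<dots> = \<bar>inverse (norm y) - 1\<bar> * norm y"
      by simp
    also have "\<dots> = \<bar>(inverse (norm y) - 1) * norm y\<bar>"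
      by (simp add: abs_mult)
    also have "(inverse (norm y) - 1) * norm y = 1 - norm y"
      using False by (cases "y = 0") (auto simp: left_diff_distrib)
    finally have "dist (y /\<^sub>R norm y) y < e"
      using y False by simp
    moreover have "norm (y /\<^sub>R norm y) \<le> 1"
      by (cases "y = 0") auto
    ultimately show ?thesis
      using e(2) by (meson UN_I mem_ball mem_cball_0 subsetD)
  qed (use assms in auto)
  thus ?thesis
    using e(1) by (intro exI[of _ "1 + e"]) auto
qed

lemma analytic_on_cball_unit:
  "g analytic_on cball 0 1 \<longleftrightarrow> (\<exists>R>1. g holomorphic_on ball 0 R)"
proof
  assume "g analytic_on cball 0 1"
  then obtain V where V: "open V" "cball 0 1 \<subseteq> V" "g holomorphic_on V"
    by (auto simp: analytic_on_holomorphic)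
  thus "\<exists>R>1. g holomorphic_on ball 0 R"
    using open_cball_unit_ball[OF V(1,2)] holomorphic_on_subset by blast
next
  assume "\<exists>R>1. g holomorphic_on ball 0 R"
  then obtain R where "R > 1" "g holomorphic_on ball 0 R"
    by blast
  thus "g analytic_on cball 0 1"
    unfolding analytic_on_holomorphic by (intro exI[of _ "ball 0 R"]) auto
qed

lemma analytic_on_cball_divide_power:
  assumes "g analytic_on cball 0 1" "vanishes_to_order k g"
  shows "\<exists>h. h analytic_on cball 0 1 \<and> (\<forall>t\<in>cball 0 1. g t = t ^ k * h t)"
proof -
  obtain R where R: "R > 1" "g holomorphic_on ball 0 R"
    using assms(1) analytic_on_cball_unit by blast
  then obtain h where "h holomorphic_on ball 0 R" "\<forall>t\<in>ball 0 R. g t = t ^ k * h t"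
    using vanishes_to_order_divide[of g "ball 0 R" k] assms(2) by auto
  thus ?thesis
    using R by (intro exI[of _ h]) (auto simp: analytic_on_cball_unit)
qed

lemma factored_order_cball:
  assumes "h analytic_on cball 0 1" "\<And>t. t \<in> cball 0 1 \<Longrightarrow> g t = t ^ k * h t"
  shows "vanishes_to_order k g" "(deriv ^^ k) g 0 = fact k * h 0"
proof -
  have "h holomorphic_on ball 0 1"
    using assms(1) analytic_imp_holomorphic holomorphic_on_subset ball_subset_cball by blast
  from factored_order[OF this, of g k]
  show "vanishes_to_order k g" "(deriv ^^ k) g 0 = fact k * h 0"
    using assms(2) by auto
qed

lemma finite_order_cball:
  assumes g: "g analytic_on cball 0 1" and t: "t \<in> cball 0 1" "g t \<noteq> 0"
  shows "\<exists>k h. h analytic_on cball 0 1 \<and> h 0 \<noteq> 0 \<and> (\<forall>t\<in>cball 0 1. g t = t ^ k * h t)"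
proof -
  obtain R where R: "R > 1" "g holomorphic_on ball 0 R"
    using g analytic_on_cball_unit by blast
  have "\<exists>k. (deriv ^^ k) g 0 \<noteq> 0"
  proof (rule ccontr)
    assume "\<not> ?thesis"
    hence "g t = 0"
      using R t by (intro holomorphic_fun_eq_0_on_ball[OF R(2)]) auto
    thus False
      using t by simp
  qed
  then obtain k where k: "(deriv ^^ k) g 0 \<noteq> 0" "\<And>j. j < k \<Longrightarrow> (deriv ^^ j) g 0 = 0"
    using exists_least_iff[of "\<lambda>k. (deriv ^^ k) g 0 \<noteq> 0"] by auto
  then obtain h where h: "h analytic_on cball 0 1" "\<And>t. t \<in> cball 0 1 \<Longrightarrow> g t = t ^ k * h t"
    using analytic_on_cball_divide_power[OF g, of k] by (auto simp: vanishes_to_order_def)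
  moreover have "h 0 \<noteq> 0"
    using factored_order_cball(2)[OF h] k(1) by auto
  ultimately show ?thesis
    by blast
qed

lemma maximum_modulus_cball:
  assumes h: "h analytic_on cball 0 r" and "r > 0" and B: "\<And>t. norm t = r \<Longrightarrow> norm (h t) \<le> B"
    and t: "t \<in> cball 0 r"
  shows "norm (h t) \<le> B"
proof (rule maximum_modulus_frontier[of h "cball 0 r"])
  show "h holomorphic_on interior (cball 0 r)"
    using h analytic_imp_holomorphic holomorphic_on_subset interior_subset by blast
  show "continuous_on (closure (cball 0 r)) h"
    using h by (simp add: analytic_imp_holomorphic holomorphic_on_imp_continuous_on)
qed (use assms in \<open>auto simp: frontier_cball\<close>)

text \<open>
  The quotient is bounded by \<open>C\<close> near the zeros of \<open>g\<close>, which are isolated, and so extends across them.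
\<close>

lemma holomorphic_quotient:
  assumes F: "F holomorphic_on ball 0 R" and g: "g holomorphic_on ball 0 R"
    and C: "\<And>t. t \<in> ball 0 R \<Longrightarrow> norm (F t) \<le> C * norm (g t)"
    and t0: "t0 \<in> ball 0 R" "g t0 \<noteq> 0"
  shows "\<exists>H. H holomorphic_on ball 0 R \<and> (\<forall>t\<in>ball 0 R. F t = g t * H t \<and> norm (H t) \<le> C)"
proof -
  define q where "q t = F t / g t" for t
  define H where "H = remove_sings q"
  have H: "H analytic_on {a} \<and> F a = g a * H a \<and> norm (H a) \<le> C" if a: "a \<in> ball 0 R" for a
  proof -
    have "eventually (\<lambda>z. g z \<noteq> 0 \<and> z \<in> ball 0 R) (at a)"
      using g t0 a by (intro non_zero_neighbour_alt[where \<beta> = t0]) auto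
    then obtain e0 where e0: "e0 > 0" "\<And>z. z \<noteq> a \<Longrightarrow> dist z a < e0 \<Longrightarrow> g z \<noteq> 0 \<and> z \<in> ball 0 R"
      unfolding eventually_at by auto
    define B where "B = ball a e0"
    have B: "open B" "a \<in> B" "B \<subseteq> ball 0 R" "\<And>z. z \<in> B - {a} \<Longrightarrow> g z \<noteq> 0"
      using e0 a unfolding B_def by (auto simp: dist_commute) (metis dist_0_norm dist_commute mem_ball)
    have q: "q holomorphic_on B - {a}"
      unfolding q_def using B
      by (intro holomorphic_intros holomorphic_on_subset[OF F] holomorphic_on_subset[OF g]) auto
    have qC: "norm (q z) \<le> C" if "z \<in> B - {a}" for z
      using C[of z] B that by (auto simp: q_def norm_divide divide_simps)
    have near: "eventually (\<lambda>z. z \<in> B - {a}) (at a)"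
      using B eventually_at_in_open[of B a] by (auto elim: eventually_mono)
    have "\<exists>G. G holomorphic_on B \<and> (\<forall>z\<in>B - {a}. G z = q z)"
      by (subst holomorphic_on_extend_bounded)
        (use q B near qC in \<open>auto simp: interior_open intro!: exI[of _ C] elim!: eventually_mono\<close>)
    then obtain G where G: "G holomorphic_on B" "\<And>z. z \<in> B - {a} \<Longrightarrow> G z = q z"
      by blast
    have G_lim: "G \<midarrow>a\<rightarrow> G a"
      using G(1) B by (metis continuous_on_eq_continuous_at holomorphic_on_imp_continuous_on isContD)
    have GH: "H z = G z" if "z \<in> B" for z
    proof (cases "z = a")
      case True
      have "q \<midarrow>a\<rightarrow> G a"
        using G_lim by (rule Lim_transform_eventually) (use near G in \<open>auto elim!: eventually_mono\<close>)
      thus ?thesis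
        using True by (simp add: H_def remove_sings_eqI)
    next
      case False
      have "q analytic_on {z}"
        using q that False B by (metis DiffI analytic_at open_delete singletonD)
      thus ?thesis
        using G(2) False that by (simp add: H_def)
    qed
    have "H holomorphic_on B"
      using G(1) GH by (metis holomorphic_transform)
    hence "H analytic_on {a}"
      using B analytic_at by blast
    moreover have "norm (G a) \<le> C"
      by (rule Lim_norm_ubound[OF _ G_lim]) (use near G qC in \<open>auto elim!: eventually_mono\<close>)
    moreover have "F a = g a * G a"
    proof (rule LIM_unique)
      show "F \<midarrow>a\<rightarrow> F a"
        using F a by (metis continuous_on_eq_continuous_at holomorphic_on_imp_continuous_on isContD open_ball)
      have "g \<midarrow>a\<rightarrow> g a"
        using g a by (metis continuous_on_eq_continuous_at holomorphic_on_imp_continuous_on isContD open_ball)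
      hence "(\<lambda>z. g z * G z) \<midarrow>a\<rightarrow> g a * G a"
        using G_lim by (rule tendsto_mult)
      thus "F \<midarrow>a\<rightarrow> g a * G a"
        by (rule Lim_transform_eventually)
          (use near G B in \<open>auto elim!: eventually_mono simp: q_def\<close>)
    qed
    ultimately show ?thesis
      using GH B by auto
  qed
  hence "H analytic_on ball 0 R"
    by (metis analytic_on_analytic_at)
  thus ?thesis
    using H analytic_imp_holomorphic by blast
qed

text \<open>
  If \<open>h\<close> had no zero, the maximum principle for \<open>1 / h\<close> would give \<open>|h 0| \<ge> r\<^sup>N - \<delta> > \<delta>\<close>, whereas
  \<open>|h 0| \<le> \<delta>\<close>.
\<close>

lemma zero_near_power:
  assumes h: "h analytic_on cball 0 1" and \<delta>: "\<And>t. t \<in> cball 0 1 \<Longrightarrow> norm (h t - t ^ N) \<le> \<delta>"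
    and N: "N > 0" and r: "0 < r" "r \<le> 1" "2 * \<delta> < r ^ N"
  shows "\<exists>z\<in>cball 0 r. h z = 0"
proof (rule ccontr)
  assume neg: "\<not> ?thesis"
  have sub: "cball 0 r \<subseteq> cball (0::complex) 1"
    using r by auto
  have "h analytic_on cball 0 r"
    using h sub by (rule analytic_on_subset)
  hence "(\<lambda>t. inverse (h t)) analytic_on cball 0 r"
    using neg by (intro analytic_on_inverse) auto
  moreover have "norm (inverse (h t)) \<le> inverse (r ^ N - \<delta>)" if "norm t = r" for t
  proof -
    have "norm (h t - t ^ N) \<le> \<delta>"
      using \<delta>[of t] that r by simp
    hence "r ^ N - \<delta> \<le> norm (h t)"
      using norm_triangle_ineq2[of "t ^ N" "h t"] that by (simp add: norm_power norm_minus_commute)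
    moreover have "r ^ N - \<delta> > 0"
    proof -
      have "norm (h 0) \<le> \<delta>"
        using \<delta>[of 0] N by (simp add: power_0_left)
      hence "0 \<le> \<delta>"
        using norm_ge_zero[of "h 0"] by linarith
      thus ?thesis
        using r by linarith
    qed
    ultimately show ?thesis
      unfolding norm_inverse by (rule le_imp_inverse_le)
  qed
  ultimately have "norm (inverse (h 0)) \<le> inverse (r ^ N - \<delta>)"
    using maximum_modulus_cball[of "\<lambda>t. inverse (h t)" r "inverse (r ^ N - \<delta>)" 0] r by auto
  moreover have h0: "norm (h 0) \<le> \<delta>"
    using \<delta>[of 0] N by (simp add: power_0_left)
  moreover have "h 0 \<noteq> 0"
    using neg r by auto
  ultimately have "r ^ N - \<delta> \<le> norm (h 0)"
    using r norm_ge_zero[of "h 0"] unfolding norm_inverse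
    by (intro inverse_le_imp_le[of "norm (h 0)"]) auto
  thus False
    using h0 r by simp
qed

text \<open>
  A perturbation of \<open>t\<close> to the power \<open>k + l\<close> has a zero near 0. Dividing by the corresponding linear factor
  leaves a perturbation of the next lower power, by the maximum principle. After \<open>k\<close> steps the linear
  factors make up \<open>h1\<close>, and the rest is \<open>h2\<close>.
\<close>

lemma factor_near_power:
  assumes "\<eta> > 0"
  shows "\<exists>\<delta>>0. \<forall>h. h analytic_on cball 0 1 \<and> (\<forall>t\<in>cball 0 1. norm (h t - t ^ (k + l)) \<le> \<delta>) \<longrightarrow>
    (\<exists>h1 h2. h1 analytic_on cball 0 1 \<and> h2 analytic_on cball 0 1 \<and>
       (\<forall>t\<in>cball 0 1. h t = h1 t * h2 t \<and> norm (h1 t - t ^ k) \<le> \<eta> \<and> norm (h2 t - t ^ l) \<le> \<eta>))"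
  using assms
proof (induction k arbitrary: \<eta>)
  case 0
  thus ?case
  proof (intro exI[of _ \<eta>] conjI allI impI)
    fix h assume "h analytic_on cball 0 1 \<and> (\<forall>t\<in>cball 0 1. norm (h t - t ^ (0 + l)) \<le> \<eta>)"
    hence "(\<lambda>_. 1) analytic_on cball 0 (1::real) \<and> h analytic_on cball 0 1 \<and>
       (\<forall>t\<in>cball 0 1. h t = 1 * h t \<and> norm (1 - t ^ 0) \<le> \<eta> \<and> norm (h t - t ^ l) \<le> \<eta>)"
      using 0 by auto
    thus "\<exists>h1 h2. h1 analytic_on cball 0 1 \<and> h2 analytic_on cball 0 1 \<and>
       (\<forall>t\<in>cball 0 1. h t = h1 t * h2 t \<and> norm (h1 t - t ^ 0) \<le> \<eta> \<and> norm (h2 t - t ^ l) \<le> \<eta>)"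
      by (intro exI)
  qed
next
  case (Suc k)
  define \<eta>' where "\<eta>' = min 1 (\<eta> / 2)"
  have "\<eta>' > 0"
    using Suc.prems by (simp add: \<eta>'_def)
  from Suc.IH[OF this] obtain \<delta>' where \<delta>': "\<delta>' > 0" and IH:
    "\<forall>h. h analytic_on cball 0 1 \<and> (\<forall>t\<in>cball 0 1. norm (h t - t ^ (k + l)) \<le> \<delta>') \<longrightarrow>
      (\<exists>h1 h2. h1 analytic_on cball 0 1 \<and> h2 analytic_on cball 0 1 \<and>
       (\<forall>t\<in>cball 0 1. h t = h1 t * h2 t \<and> norm (h1 t - t ^ k) \<le> \<eta>' \<and> norm (h2 t - t ^ l) \<le> \<eta>'))"
    by (elim exE conjE)
  define r where "r = min (1 / 2) (min (\<delta>' / 4) (\<eta> / 4))"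
  have r: "r > 0" "r \<le> 1 / 2" "r \<le> \<delta>' / 4" "r \<le> \<eta> / 4"
    using \<delta>' Suc.prems by (auto simp: r_def)
  define \<delta> where "\<delta> = min (\<delta>' / 4) (r ^ (Suc k + l) / 3)"
  have \<delta>: "\<delta> > 0" "\<delta> \<le> \<delta>' / 4" "2 * \<delta> < r ^ (Suc k + l)"
    using r \<delta>' by (auto simp: \<delta>_def min_def simp del: power_Suc)
  show ?case
  proof (intro exI[of _ \<delta>] conjI allI impI)
    fix h assume "h analytic_on cball 0 1 \<and> (\<forall>t\<in>cball 0 1. norm (h t - t ^ (Suc k + l)) \<le> \<delta>)"
    hence h: "h analytic_on cball 0 1" and h\<delta>: "\<And>t. t \<in> cball 0 1 \<Longrightarrow> norm (h t - t ^ (Suc k + l)) \<le> \<delta>"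
      by auto
    obtain z where z: "norm z \<le> r" "h z = 0"
      using zero_near_power[OF h h\<delta>, of r] r \<delta> by auto
    obtain R where R: "R > 1" "h holomorphic_on ball 0 R"
      using h analytic_on_cball_unit by blast
    define h' where "h' t = (if t = z then deriv h z else (h t - h z) / (t - z))" for t
    have "h' holomorphic_on ball 0 R"
      unfolding h'_def using R z r by (intro difference_quotient_holomorphic) auto
    hence h': "h' analytic_on cball 0 1"
      using R analytic_on_cball_unit by blast
    have hh': "h t = (t - z) * h' t" for t
      using z by (simp add: h'_def)
    have "norm (h' t - t ^ (k + l)) \<le> \<delta>'" if t: "norm t = 1" for t
    proof -
      have "norm (t - z) \<ge> 1 / 2"
        using norm_triangle_ineq2[of t z] t z r by simp
      hence "1 / 2 * norm (h' t - t ^ (k + l)) \<le> norm (t - z) * norm (h' t - t ^ (k + l))"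
        by (intro mult_right_mono) auto
      also have "\<dots> = norm ((h t - t ^ (Suc k + l)) + z * t ^ (k + l))"
        by (simp add: hh' algebra_simps flip: norm_mult)
      also have "\<dots> \<le> \<delta> + r * 1"
        using h\<delta>[of t] z t r
        by (intro norm_triangle_mono) (auto simp: norm_mult norm_power)
      finally show ?thesis
        using \<delta> r by simp
    qed
    hence "\<forall>t\<in>cball 0 1. norm (h' t - t ^ (k + l)) \<le> \<delta>'"
      using h' by (intro ballI)
        (rule maximum_modulus_cball[of "\<lambda>t. h' t - t ^ (k + l)" 1], auto intro!: analytic_intros)
    with h' IH obtain h1 h2 where h12: "h1 analytic_on cball 0 1" "h2 analytic_on cball 0 1"
      "\<And>t. t \<in> cball 0 1 \<Longrightarrow> h' t = h1 t * h2 t \<and> norm (h1 t - t ^ k) \<le> \<eta>' \<and> norm (h2 t - t ^ l) \<le> \<eta>'"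
      by blast
    show "\<exists>h1 h2. h1 analytic_on cball 0 1 \<and> h2 analytic_on cball 0 1 \<and>
       (\<forall>t\<in>cball 0 1. h t = h1 t * h2 t \<and> norm (h1 t - t ^ Suc k) \<le> \<eta> \<and> norm (h2 t - t ^ l) \<le> \<eta>)"
    proof (intro exI conjI ballI)
      show "(\<lambda>t. (t - z) * h1 t) analytic_on cball 0 1" "h2 analytic_on cball 0 1"
        using h12 by (auto intro!: analytic_intros)
      fix t :: complex assume t: "t \<in> cball 0 1"
      show "h t = (t - z) * h1 t * h2 t"
        using h12(3)[OF t] by (simp add: hh')
      show "norm (h2 t - t ^ l) \<le> \<eta>"
        using h12(3)[OF t] Suc.prems by (auto simp: \<eta>'_def)
      have "norm (h1 t) \<le> \<eta>' + norm t ^ k"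
        using h12(3)[OF t] norm_triangle_sub[of "h1 t" "t ^ k"] by (simp add: norm_power)
      moreover have "norm t ^ k \<le> 1"
        using t by (simp add: power_le_one)
      ultimately have h1: "norm (h1 t) \<le> 2"
        by (simp add: \<eta>'_def)
      have "(t - z) * h1 t - t ^ Suc k = t * (h1 t - t ^ k) - z * h1 t"
        by (simp add: algebra_simps)
      also have "norm \<dots> \<le> norm (t * (h1 t - t ^ k)) + norm (z * h1 t)"
        by (rule norm_triangle_ineq4)
      also have "\<dots> \<le> 1 * \<eta>' + r * 2"
        unfolding norm_mult using h12(3)[OF t] t z h1 r by (intro add_mono mult_mono) auto
      also have "\<dots> \<le> \<eta>"
        using r by (simp add: \<eta>'_def min_def)
      finally show "norm ((t - z) * h1 t - t ^ Suc k) \<le> \<eta>" .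
    qed
  qed (use \<delta> in auto)
qed


section \<open>Perturbing short arcs\<close>

lemma holomorphic_map_on_cball_unit:
  "\<phi> holomorphic_map_on cball (0::complex) 1 \<longleftrightarrow> (\<exists>R>1. \<forall>t\<in>ball 0 R. hol_at \<phi> t)"
proof
  assume "\<phi> holomorphic_map_on cball 0 1"
  then obtain V where V: "open V" "cball 0 1 \<subseteq> V" "\<forall>t\<in>V. hol_at \<phi> t"
    by (auto simp: holomorphic_map_on_iff_hol_at)
  thus "\<exists>R>1. \<forall>t\<in>ball 0 R. hol_at \<phi> t"
    using open_cball_unit_ball[OF V(1,2)] by blast
next
  assume "\<exists>R>1. \<forall>t\<in>ball 0 R. hol_at \<phi> t"
  then obtain R where "R > 1" "\<forall>t\<in>ball 0 R. hol_at \<phi> t"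
    by blast
  thus "\<phi> holomorphic_map_on cball 0 1"
    unfolding holomorphic_map_on_iff_hol_at by (intro exI[of _ "ball 0 R"]) auto
qed

lemma holomorphic_map_on_cball_unit_continuous:
  "\<phi> holomorphic_map_on cball (0::complex) 1 \<Longrightarrow> continuous_on (cball 0 1) \<phi>"
  by (auto simp: holomorphic_map_on_iff_hol_at intro!: hol_at_imp_continuous_on)

lemma analytic_on_imp_continuous_on:
  "g analytic_on S \<Longrightarrow> continuous_on S g"
  by (simp add: analytic_imp_holomorphic holomorphic_on_imp_continuous_on)

lemma bounded_on_cball_unit:
  fixes g :: "complex \<Rightarrow> 'a::real_normed_vector"
  assumes "continuous_on (cball 0 1) g"
  shows "\<exists>B>0. \<forall>t\<in>cball 0 1. norm (g t) \<le> B"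
proof -
  have "bounded (g ` cball 0 1)"
    using compact_imp_bounded[OF compact_continuous_image[OF assms compact_cball]] .
  thus ?thesis
    unfolding bounded_pos by auto
qed

text \<open>
  The data of a cA-type hypersurface \<open>xy = f\<close>. The order \<open>m\<close> of \<open>f\<close> at 0 enters through the two
  properties of homogeneous parts that define it.
\<close>

locale cA_equation =
  fixes f :: "complex ^ 'n \<Rightarrow> complex" and U :: "(complex ^ 'n) set" and m :: nat
  assumes open_U: "open U" and zero_U: "0 \<in> U" and hol_f: "z \<in> U \<Longrightarrow> hol_at f z"
    and lower_parts: "j < m \<Longrightarrow> homogeneous_part f j v = 0"
    and leading_part: "\<exists>v. homogeneous_part f m v \<noteq> 0"
    and m_ge_2: "m \<ge> 2"
begin

text \<open>
  The coordinate functions of a short arc on \<open>xy = f\<close>, before they are packed into a single function on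
  the closed disc. Here \<open>x\<close> and \<open>y\<close> can be exchanged by a permutation of arguments.
\<close>

definition arc_coords :: "(complex \<Rightarrow> complex) \<Rightarrow> (complex \<Rightarrow> complex) \<Rightarrow> (complex \<Rightarrow> complex ^ 'n) \<Rightarrow> bool" where
  "arc_coords \<psi>1 \<psi>2 \<phi> \<longleftrightarrow>
     \<psi>1 analytic_on cball 0 1 \<and> \<psi>2 analytic_on cball 0 1 \<and> \<phi> holomorphic_map_on cball 0 1 \<and>
     (\<forall>t\<in>cball 0 1. \<phi> t \<in> U \<and> \<psi>1 t * \<psi>2 t = f (\<phi> t) \<and>
        (\<psi>1 t = 0 \<and> \<psi>2 t = 0 \<and> \<phi> t = 0 \<longleftrightarrow> t = 0))"

lemma arc_coords_commute: "arc_coords \<psi>1 \<psi>2 \<phi> \<longleftrightarrow> arc_coords \<psi>2 \<psi>1 \<phi>"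
  unfolding arc_coords_def by (auto simp: mult.commute)

lemma arc_coords_at_0: "arc_coords \<psi>1 \<psi>2 \<phi> \<Longrightarrow> \<psi>1 0 = 0 \<and> \<psi>2 0 = 0 \<and> \<phi> 0 = 0"
  unfolding arc_coords_def by force

lemma f_0: "f 0 = 0"
  using lower_parts[of 0 0] m_ge_2 by (simp add: homogeneous_part_def)

lemma f_order:
  assumes \<phi>: "\<phi> holomorphic_map_on cball 0 1" and \<phi>0: "\<phi> 0 = 0"
  shows "vanishes_to_order m (\<lambda>t. f (\<phi> t))"
proof -
  obtain R where R: "R > 1" "\<forall>t\<in>ball 0 R. hol_at \<phi> t"
    using \<phi> holomorphic_map_on_cball_unit by blast
  obtain \<eta> where \<eta>: "\<And>t. t \<in> ball 0 R \<Longrightarrow> hol_at \<eta> t" "\<And>t. t \<in> ball 0 R \<Longrightarrow> \<phi> t = t *\<^sub>C \<eta> t"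
    using hol_at_divide_var[of "ball 0 R" \<phi>] R \<phi>0 by auto
  obtain r h where r: "r > 0" "h holomorphic_on ball 0 r" "\<forall>t\<in>ball 0 r. f (t *\<^sub>C \<eta> t) = t ^ m * h t"
    using order_along_arc[OF open_U zero_U hol_f, of "ball 0 R" \<eta> m] \<eta> lower_parts R by auto
  show ?thesis
    by (rule factored_order(1)[of h "ball 0 (min r R)"])
      (use r \<eta> R in \<open>auto intro: holomorphic_on_subset\<close>)
qed

text \<open>
  A bound of \<open>f\<close> on a compact neighbourhood of the arc gives a Lipschitz bound on a smaller one, by Schwarz's
  lemma on complex lines.
\<close>

lemma f_increment_bound:
  fixes \<phi> :: "complex \<Rightarrow> complex ^ 'n"
  assumes \<phi>: "\<phi> holomorphic_map_on cball 0 1" and \<phi>U: "\<And>t. t \<in> cball 0 1 \<Longrightarrow> \<phi> t \<in> U"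
  shows "\<exists>R>1. \<exists>r>0. \<exists>C>0. \<forall>t\<in>ball 0 R. hol_at \<phi> t \<and>
    (\<forall>v. norm v < r \<longrightarrow> \<phi> t + v \<in> U \<and> norm (f (\<phi> t + v) - f (\<phi> t)) \<le> C * norm v)"
proof -
  let ?K = "\<phi> ` cball 0 1"
  have K: "compact ?K"
    by (rule compact_continuous_image[OF holomorphic_map_on_cball_unit_continuous[OF \<phi>] compact_cball])
  have "?K \<subseteq> U"
    using \<phi>U by blast
  then obtain e where e: "e > 0" "(\<Union>x\<in>?K. cball x e) \<subseteq> U"
    using compact_subset_open_imp_cball_epsilon_subset[OF K open_U] by blast
  define L where "L = {x + y |x y. x \<in> ?K \<and> y \<in> cball 0 e}"
  have "compact L"
    unfolding L_def by (intro compact_sums K compact_cball)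
  have inL: "x + v \<in> L" if "x \<in> ?K" "norm v \<le> e" for x v
    unfolding L_def using that by auto
  have "L \<subseteq> U"
  proof
    fix z assume "z \<in> L"
    then obtain x y where "z = x + y" "x \<in> ?K" "y \<in> cball 0 e"
      by (auto simp: L_def)
    hence "z \<in> cball x e" "x \<in> ?K"
      by (auto simp: dist_norm)
    thus "z \<in> U"
      using e by blast
  qed
  hence "continuous_on L f"
    using hol_f by (intro hol_at_imp_continuous_on) auto
  hence "bounded (f ` L)"
    using \<open>compact L\<close> by (intro compact_imp_bounded compact_continuous_image)
  then obtain M where M: "M > 0" "\<And>z. z \<in> L \<Longrightarrow> norm (f z) \<le> M"
    unfolding bounded_pos by auto
  obtain V where V: "open V" "cball 0 1 \<subseteq> V" "\<And>t. t \<in> V \<Longrightarrow> hol_at \<phi> t"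
    using \<phi> by (auto simp: holomorphic_map_on_iff_hol_at)
  define W where "W = V \<inter> \<phi> -` (\<Union>x\<in>?K. ball x (e / 2))"
  have "open W"
    unfolding W_def
    by (rule continuous_open_preimage[OF hol_at_imp_continuous_on[OF V(3)] V(1)]) auto
  moreover have "cball 0 1 \<subseteq> W"
  proof
    fix t :: complex assume t: "t \<in> cball 0 1"
    hence "\<phi> t \<in> (\<Union>x\<in>?K. ball x (e / 2))"
      using e(1) by (intro UN_I[of "\<phi> t"]) auto
    thus "t \<in> W"
      using t V(2) by (auto simp: W_def)
  qed
  ultimately obtain R where R: "R > 1" "ball 0 R \<subseteq> W"
    using open_cball_unit_ball by blast
  have near: "\<phi> t + v \<in> L" if "t \<in> ball 0 R" "norm v < e / 2" for t v
  proof -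
    have "t \<in> W"
      using R that by blast
    then obtain x where x: "x \<in> ?K" "dist x (\<phi> t) < e / 2"
      by (auto simp: W_def)
    have "norm (\<phi> t - x + v) \<le> e"
      using that x by (intro norm_triangle_le) (auto simp: dist_norm norm_minus_commute)
    thus ?thesis
      using inL[OF x(1), of "\<phi> t - x + v"] by simp
  qed
  have incr: "norm (f (\<phi> t + v) - f (\<phi> t)) \<le> 3 * M / (e / 2) * norm v"
    if t: "t \<in> ball 0 R" and v: "norm v < e / 2" for t v
  proof (cases "v = 0")
    case False
    define g where "g \<sigma> = f (\<phi> t + \<sigma> *\<^sub>C v)" for \<sigma>
    define q where "q = e / 2 / norm v"
    have q: "q > 1"
      using v False e by (simp add: q_def divide_simps)
    have inL': "\<phi> t + \<sigma> *\<^sub>C v \<in> L" if "\<sigma> \<in> ball 0 q" for \<sigma>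
      using that False by (intro near t) (simp add: norm_cscale q_def pos_less_divide_eq)
    have "hol_at (\<lambda>\<sigma>. \<phi> t + \<sigma> *\<^sub>C v) \<sigma>" for \<sigma>
      by (intro hol_at_intros)
    hence "hol_at g \<sigma>" if "\<sigma> \<in> ball 0 q" for \<sigma>
      unfolding g_def using inL'[OF that] \<open>L \<subseteq> U\<close> by (intro hol_at_compose[OF _ hol_f]) auto
    hence "g holomorphic_on ball 0 q"
      by (rule hol_at_imp_holomorphic_on)
    moreover have "norm (g z) \<le> M" if "z \<in> ball 0 q" for z
      unfolding g_def by (rule M(2)[OF inL'[OF that]])
    ultimately have "norm (g 1 - g 0) \<le> 3 * M / q * norm (1 - 0 :: complex)"
      using M(1) q by (intro holomorphic_increment_bound) auto
    thus ?thesis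
      using False by (simp add: g_def q_def)
  qed simp
  show ?thesis
  proof (intro exI conjI ballI)
    show "R > 1" "e / 2 > 0" "3 * M / (e / 2) > 0"
      using R e M by auto
    fix t :: complex assume t: "t \<in> ball 0 R"
    show "hol_at \<phi> t"
      using R t by (intro V) (auto simp: W_def)
    show "\<forall>v. norm v < e / 2 \<longrightarrow> \<phi> t + v \<in> U \<and>
        norm (f (\<phi> t + v) - f (\<phi> t)) \<le> 3 * M / (e / 2) * norm v"
      using near[OF t] incr[OF t] \<open>L \<subseteq> U\<close> by blast
  qed
qed

text \<open>
  Moving \<open>\<phi>\<close> by a multiple of \<open>g\<close> changes \<open>f \<circ> \<phi>\<close> by a multiple of \<open>g\<close>: the change is bounded by
  \<open>C |g| |w|\<close>, so it can be divided by \<open>g\<close>. In this way divisibility of \<open>f \<circ> \<phi>\<close> by \<open>g\<close> survives the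
  perturbation.
\<close>

lemma f_perturb:
  fixes \<phi> :: "complex \<Rightarrow> complex ^ 'n"
  assumes \<phi>: "\<phi> holomorphic_map_on cball 0 1" and \<phi>U: "\<forall>t\<in>cball 0 1. \<phi> t \<in> U"
    and g: "g analytic_on cball 0 1" and t0: "t0 \<in> cball 0 1" "g t0 \<noteq> 0"
  shows "\<exists>\<kappa>>0. \<exists>C>0. \<forall>w. norm w < \<kappa> \<longrightarrow>
    (\<lambda>t. \<phi> t + g t *\<^sub>C w) holomorphic_map_on cball 0 1 \<and> (\<forall>t\<in>cball 0 1. \<phi> t + g t *\<^sub>C w \<in> U) \<and>
    (\<exists>H. H analytic_on cball 0 1 \<and>
       (\<forall>t\<in>cball 0 1. f (\<phi> t + g t *\<^sub>C w) = f (\<phi> t) + g t * H t \<and> norm (H t) \<le> C * norm w))"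
proof -
  obtain R r C where R: "R > 1" and r: "r > 0" and C: "C > 0"
    and hol: "\<And>t. t \<in> ball 0 R \<Longrightarrow> hol_at \<phi> t"
    and inU: "\<And>t v. t \<in> ball 0 R \<Longrightarrow> norm v < r \<Longrightarrow> \<phi> t + v \<in> U"
    and incr: "\<And>t v. t \<in> ball 0 R \<Longrightarrow> norm v < r \<Longrightarrow> norm (f (\<phi> t + v) - f (\<phi> t)) \<le> C * norm v"
    using f_increment_bound[OF \<phi> bspec[OF \<phi>U]] by metis
  obtain V where V: "open V" "cball 0 1 \<subseteq> V" "g holomorphic_on V"
    using g by (auto simp: analytic_on_holomorphic)
  obtain B where B: "B > 0" "\<And>t. t \<in> cball 0 1 \<Longrightarrow> norm (g t) \<le> B"
    using bounded_on_cball_unit[OF analytic_on_imp_continuous_on[OF g]] by blast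
  have "open (V \<inter> g -` ball 0 (2 * B))"
    using V by (intro continuous_open_preimage holomorphic_on_imp_continuous_on) auto
  moreover have "cball 0 1 \<subseteq> V \<inter> g -` ball 0 (2 * B)"
    using V(2) B by force
  ultimately obtain R1 where R1: "R1 > 1" "ball 0 R1 \<subseteq> V \<inter> g -` ball 0 (2 * B)"
    using open_cball_unit_ball by blast
  define Q where "Q = min R R1"
  have Q: "Q > 1" "ball 0 Q \<subseteq> ball 0 R" "ball 0 Q \<subseteq> ball 0 R1"
    using R R1 by (auto simp: Q_def)
  have gQ: "g holomorphic_on ball 0 Q"
    using V(3) by (rule holomorphic_on_subset) (use Q R1 in blast)
  have "(\<lambda>t. \<phi> t + g t *\<^sub>C w) holomorphic_map_on cball 0 1 \<and> (\<forall>t\<in>cball 0 1. \<phi> t + g t *\<^sub>C w \<in> U) \<and>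
    (\<exists>H. H analytic_on cball 0 1 \<and>
       (\<forall>t\<in>cball 0 1. f (\<phi> t + g t *\<^sub>C w) = f (\<phi> t) + g t * H t \<and> norm (H t) \<le> C * norm w))"
    if w: "norm w < r / (2 * B)" for w :: "complex ^ 'n"
  proof (intro conjI)
    have small: "norm (g t *\<^sub>C w) < r" if "t \<in> ball 0 Q" for t
    proof -
      have "g t \<in> ball 0 (2 * B)"
        using that Q R1 by blast
      hence "norm (g t *\<^sub>C w) \<le> 2 * B * norm w"
        unfolding norm_cscale by (intro mult_right_mono) auto
      also have "\<dots> < r"
        using w B by (simp add: pos_less_divide_eq mult.commute)
      finally show ?thesis .
    qed
    have tR: "t \<in> ball 0 R" if "t \<in> ball 0 Q" for t :: complex
      using that Q by blast
    have hg: "hol_at g t" if "t \<in> ball 0 Q" for t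
      by (rule holomorphic_on_imp_hol_at[OF gQ _ that]) simp
    have pert: "hol_at (\<lambda>t. \<phi> t + g t *\<^sub>C w) t" if "t \<in> ball 0 Q" for t
      by (intro hol_at_add hol_at_cscale hol_at_const hg hol tR that)
    show "(\<lambda>t. \<phi> t + g t *\<^sub>C w) holomorphic_map_on cball 0 1"
      unfolding holomorphic_map_on_cball_unit using Q pert by blast
    show "\<forall>t\<in>cball 0 1. \<phi> t + g t *\<^sub>C w \<in> U"
    proof
      fix t :: complex assume "t \<in> cball 0 1"
      hence "t \<in> ball 0 Q"
        using Q by auto
      thus "\<phi> t + g t *\<^sub>C w \<in> U"
        by (intro inU tR small)
    qed
    have F: "(\<lambda>t. f (\<phi> t + g t *\<^sub>C w) - f (\<phi> t)) holomorphic_on ball 0 Q"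
    proof (rule hol_at_imp_holomorphic_on)
      fix t :: complex assume t: "t \<in> ball 0 Q"
      have "\<phi> t \<in> U"
        using inU[OF tR[OF t], of 0] r by simp
      thus "hol_at (\<lambda>t. f (\<phi> t + g t *\<^sub>C w) - f (\<phi> t)) t"
        by (rule hol_at_diff[OF hol_at_compose[OF pert[OF t] hol_f[OF inU[OF tR[OF t] small[OF t]]]]
              hol_at_compose[OF hol[OF tR[OF t]] hol_f]])
    qed
    have "norm (f (\<phi> t + g t *\<^sub>C w) - f (\<phi> t)) \<le> C * norm w * norm (g t)" if "t \<in> ball 0 Q" for t
      using incr[OF tR[OF that] small[OF that]] by (simp add: norm_cscale mult_ac)
    moreover have "t0 \<in> ball 0 Q"
      using t0(1) Q(1) by auto
    ultimately obtain H where
      H: "H holomorphic_on ball 0 Q" "\<And>t. t \<in> ball 0 Q \<Longrightarrow>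
         f (\<phi> t + g t *\<^sub>C w) - f (\<phi> t) = g t * H t \<and> norm (H t) \<le> C * norm w"
      using holomorphic_quotient[OF F gQ _ _ t0(2), of "C * norm w"] by blast
    show "\<exists>H. H analytic_on cball 0 1 \<and>
       (\<forall>t\<in>cball 0 1. f (\<phi> t + g t *\<^sub>C w) = f (\<phi> t) + g t * H t \<and> norm (H t) \<le> C * norm w)"
    proof (intro exI[of _ H] conjI ballI)
      show "H analytic_on cball 0 1"
        using H Q analytic_on_cball_unit by blast
      fix t :: complex assume "t \<in> cball 0 1"
      hence "t \<in> ball 0 Q"
        using Q by auto
      from H(2)[OF this] show "f (\<phi> t + g t *\<^sub>C w) = f (\<phi> t) + g t * H t" "norm (H t) \<le> C * norm w"
        by (auto simp: algebra_simps)
    qed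
  qed
  moreover have "r / (2 * B) > 0"
    using r B by simp
  ultimately show ?thesis
    using C by blast
qed

lemma nonzero_second:
  assumes P: "arc_coords \<psi>1 \<psi>2 \<phi>" and z: "\<forall>t\<in>cball 0 1. \<psi>1 t = 0" and b: "vanishes_to_order b \<psi>2" "b > 0"
    and "\<epsilon> > 0"
  shows "\<exists>\<psi>2'. arc_coords \<psi>1 \<psi>2' \<phi> \<and> vanishes_to_order b \<psi>2' \<and> (\<exists>t\<in>cball 0 1. \<psi>2' t \<noteq> 0) \<and>
     (\<forall>t\<in>cball 0 1. norm (\<psi>2' t - \<psi>2 t) \<le> \<epsilon>)"
proof (cases "\<exists>t\<in>cball 0 1. \<psi>2 t \<noteq> 0")
  case True
  thus ?thesis
    using P b \<open>\<epsilon> > 0\<close> by (intro exI[of _ \<psi>2]) auto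
next
  case False
  define \<psi>2' where "\<psi>2' t = t ^ b * complex_of_real \<epsilon>" for t
  have "vanishes_to_order b \<psi>2'"
    by (rule factored_order(1)[of "\<lambda>_. of_real \<epsilon>" UNIV]) (auto simp: \<psi>2'_def)
  moreover have "arc_coords \<psi>1 \<psi>2' \<phi>"
    using P z False b unfolding arc_coords_def \<psi>2'_def
    by (auto intro!: analytic_intros simp: power_0_left)
  moreover have "\<psi>2' 1 \<noteq> 0"
    using \<open>\<epsilon> > 0\<close> by (simp add: \<psi>2'_def)
  moreover have "norm (\<psi>2' t - \<psi>2 t) \<le> \<epsilon>" if "t \<in> cball 0 1" for t
    using that False \<open>\<epsilon> > 0\<close>
    by (simp add: \<psi>2'_def norm_mult norm_power mult_left_le_one_le power_le_one)
  ultimately show ?thesis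
    by (intro exI[of _ \<psi>2']) (auto intro!: bexI[of _ 1])
qed

text \<open>
  If \<open>\<psi>\<^sub>1\<close> is identically zero, so is \<open>f \<circ> \<phi>\<close>. Moving \<open>\<phi>\<close> by \<open>t\<^sup>a \<psi>\<^sub>2 w\<close> makes \<open>f \<circ> \<phi>\<close> a multiple
  \<open>t\<^sup>a \<psi>\<^sub>2 H\<close>, and \<open>t\<^sup>a H\<close> is the new \<open>\<psi>\<^sub>1\<close>. It is not identically zero if \<open>f\<close> does not vanish at the
  new position of \<open>\<phi>(t)\<close> for a suitable \<open>t\<close> near 0. The arc remains short because \<open>\<psi>\<^sub>2\<close> is kept and
  \<open>\<phi>\<close> does not move at the zeros of \<open>\<psi>\<^sub>2\<close>.
\<close>

lemma nonzero_first:
  assumes P: "arc_coords \<psi>1 \<psi>2 \<phi>" and t0: "t0 \<in> cball 0 1" "\<psi>2 t0 \<noteq> 0" and a: "vanishes_to_order a \<psi>1" "a > 0"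
    and "\<epsilon> > 0"
  shows "\<exists>\<psi>1' \<phi>'. arc_coords \<psi>1' \<psi>2 \<phi>' \<and> vanishes_to_order a \<psi>1' \<and> (\<exists>t\<in>cball 0 1. \<psi>1' t \<noteq> 0) \<and>
     (\<forall>t\<in>cball 0 1. norm (\<psi>1' t - \<psi>1 t) \<le> \<epsilon> \<and> norm (\<phi>' t - \<phi> t) \<le> \<epsilon>)"
proof (cases "\<exists>t\<in>cball 0 1. \<psi>1 t \<noteq> 0")
  case True
  thus ?thesis
    using P a \<open>\<epsilon> > 0\<close> by (intro exI[of _ \<psi>1] exI[of _ \<phi>]) auto
next
  case False
  have \<psi>2: "\<psi>2 analytic_on cball 0 1" and \<phi>: "\<phi> holomorphic_map_on cball 0 1"
    and \<phi>U: "\<And>t. t \<in> cball 0 1 \<Longrightarrow> \<phi> t \<in> U" and f\<phi>: "\<And>t. t \<in> cball 0 1 \<Longrightarrow> f (\<phi> t) = 0"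
    using P False by (auto simp: arc_coords_def)
  have \<phi>U_ball: "\<forall>t\<in>cball 0 1. \<phi> t \<in> U"
    using \<phi>U by blast
  define g where "g t = t ^ a * \<psi>2 t" for t
  have g: "g analytic_on cball 0 1"
    unfolding g_def by (intro analytic_intros \<psi>2)
  have t0': "t0 \<noteq> 0"
    using t0 arc_coords_at_0[OF P] by auto
  obtain \<kappa> C where \<kappa>: "\<kappa> > 0" and C: "C > 0" and pert: "\<And>w. norm w < \<kappa> \<Longrightarrow>
    (\<lambda>t. \<phi> t + g t *\<^sub>C w) holomorphic_map_on cball 0 1 \<and> (\<forall>t\<in>cball 0 1. \<phi> t + g t *\<^sub>C w \<in> U) \<and>
    (\<exists>H. H analytic_on cball 0 1 \<and>
       (\<forall>t\<in>cball 0 1. f (\<phi> t + g t *\<^sub>C w) = f (\<phi> t) + g t * H t \<and> norm (H t) \<le> C * norm w))"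
    using f_perturb[OF \<phi> \<phi>U_ball g t0(1)] t0 t0' by (auto simp: g_def)
  obtain B where B: "B > 0" "\<And>t. t \<in> cball 0 1 \<Longrightarrow> norm (g t) \<le> B"
    using bounded_on_cball_unit[OF analytic_on_imp_continuous_on[OF g]] by blast
  obtain \<rho> where \<rho>: "\<rho> > 0" "ball 0 \<rho> \<subseteq> U"
    using open_U zero_U openE by blast
  obtain v where v: "homogeneous_part f m v \<noteq> 0"
    using leading_part by blast
  obtain t1 where t1: "t1 \<in> cball 0 1" "g t1 \<noteq> 0" "\<phi> t1 \<in> ball 0 \<rho>"
  proof -
    obtain R where R: "R > 1" "g holomorphic_on ball 0 R"
      using g analytic_on_cball_unit by blast
    have cont: "isCont \<phi> 0"
      using \<phi> by (intro hol_at_imp_continuous) (force simp: holomorphic_map_on_cball_unit)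
    obtain d where d: "d > 0" "\<And>t. dist t 0 < d \<Longrightarrow> dist (\<phi> t) (\<phi> 0) < \<rho>"
      using cont[unfolded continuous_at_eps_delta, rule_format, OF \<rho>(1)] by blast
    have "min d 1 > 0"
      using d by simp
    then obtain t where "dist 0 t < min d 1" "g t \<noteq> 0"
      using holomorphic_nonzero_near[of g "ball 0 R" 0 t0 "min d 1"] R t0 t0' by (auto simp: g_def)
    thus thesis
      using that[of t] d(2)[of t] arc_coords_at_0[OF P] by (auto simp: dist_commute)
  qed
  define \<epsilon>' where "\<epsilon>' = min \<kappa> (min (\<epsilon> / C) (\<epsilon> / B))"
  have \<epsilon>': "\<epsilon>' > 0" "\<epsilon>' \<le> \<kappa>" "\<epsilon>' \<le> \<epsilon> / C" "\<epsilon>' \<le> \<epsilon> / B"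
    using \<kappa> C B \<open>\<epsilon> > 0\<close> by (auto simp: \<epsilon>'_def)
  have "hol_at f z" if "z \<in> ball 0 \<rho>" for z
    using hol_f \<rho> that by blast
  from nonzero_near[OF this v t1(3), of "norm (g t1) * \<epsilon>'"] t1 \<epsilon>'
  obtain u where u: "norm u < norm (g t1) * \<epsilon>'" "f (\<phi> t1 + u) \<noteq> 0"
    by auto
  define w where "w = inverse (g t1) *\<^sub>C u"
  have "norm w = norm u / norm (g t1)"
    by (simp add: w_def norm_cscale norm_inverse divide_inverse mult.commute)
  hence w: "norm w < \<epsilon>'"
    using u(1) t1 by (simp add: pos_divide_less_eq mult.commute)
  have gw: "g t1 *\<^sub>C w = u"
    using t1 by (simp add: w_def cscale_cscale)
  obtain H where H: "(\<lambda>t. \<phi> t + g t *\<^sub>C w) holomorphic_map_on cball 0 1"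
      "\<And>t. t \<in> cball 0 1 \<Longrightarrow> \<phi> t + g t *\<^sub>C w \<in> U" "H analytic_on cball 0 1"
      "\<And>t. t \<in> cball 0 1 \<Longrightarrow> f (\<phi> t + g t *\<^sub>C w) = g t * H t \<and> norm (H t) \<le> C * norm w"
    using pert[of w] w \<epsilon>' f\<phi> by auto
  define \<psi>1' where "\<psi>1' t = t ^ a * H t" for t
  have \<psi>1': "\<psi>1' analytic_on cball 0 1"
    unfolding \<psi>1'_def by (intro analytic_intros H)
  have "vanishes_to_order a \<psi>1'"
    using H(3) by (rule factored_order_cball) (simp add: \<psi>1'_def)
  moreover have "\<psi>1' t1 \<noteq> 0"
    using H(4)[OF t1(1)] u(2) t1 gw by (auto simp: \<psi>1'_def g_def)
  moreover have "arc_coords \<psi>1' \<psi>2 (\<lambda>t. \<phi> t + g t *\<^sub>C w)"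
    unfolding arc_coords_def
  proof (intro conjI ballI)
    fix t :: complex assume t: "t \<in> cball 0 1"
    show "\<psi>1' t * \<psi>2 t = f (\<phi> t + g t *\<^sub>C w)"
      using H(4)[OF t] by (simp add: \<psi>1'_def g_def)
    show "\<psi>1' t = 0 \<and> \<psi>2 t = 0 \<and> \<phi> t + g t *\<^sub>C w = 0 \<longleftrightarrow> t = 0"
    proof
      assume "\<psi>1' t = 0 \<and> \<psi>2 t = 0 \<and> \<phi> t + g t *\<^sub>C w = 0"
      hence 0: "\<psi>2 t = 0" "\<phi> t + g t *\<^sub>C w = 0"
        by simp_all
      have "\<phi> t = 0"
        using 0(2) unfolding g_def 0(1) by simp
      hence "\<psi>1 t = 0 \<and> \<psi>2 t = 0 \<and> \<phi> t = 0"
        using False t 0(1) by blast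
      thus "t = 0"
        using P t unfolding arc_coords_def by blast
    next
      assume "t = 0"
      thus "\<psi>1' t = 0 \<and> \<psi>2 t = 0 \<and> \<phi> t + g t *\<^sub>C w = 0"
        using arc_coords_at_0[OF P] a(2) by (simp add: \<psi>1'_def g_def)
    qed
  qed (use H \<psi>1' \<psi>2 in auto)
  moreover have "norm (\<psi>1' t - \<psi>1 t) \<le> \<epsilon>" "norm (\<phi> t + g t *\<^sub>C w - \<phi> t) \<le> \<epsilon>" if t: "t \<in> cball 0 1" for t
  proof -
    have "norm (\<psi>1' t) \<le> 1 * (C * norm w)"
      unfolding \<psi>1'_def norm_mult using H(4)[OF t] t C
      by (intro mult_mono) (auto simp: norm_power power_le_one)
    also have "C * norm w \<le> C * (\<epsilon> / C)"
      using w \<epsilon>' C by (intro mult_left_mono) auto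
    finally show "norm (\<psi>1' t - \<psi>1 t) \<le> \<epsilon>"
      using C False t by simp
    have "norm (g t *\<^sub>C w) \<le> B * (\<epsilon> / B)"
      unfolding norm_cscale using w \<epsilon>' B(1) B(2)[OF t] by (intro mult_mono) auto
    thus "norm (\<phi> t + g t *\<^sub>C w - \<phi> t) \<le> \<epsilon>"
      using B by simp
  qed
  ultimately show ?thesis
    using t1 by (intro exI[of _ \<psi>1'] exI[of _ "\<lambda>t. \<phi> t + g t *\<^sub>C w"]) auto
qed

lemma both_nonzero:
  assumes P: "arc_coords \<psi>1 \<psi>2 \<phi>" and a: "vanishes_to_order a \<psi>1" "a > 0"
    and b: "vanishes_to_order b \<psi>2" "b > 0" and "\<epsilon> > 0"
  shows "\<exists>\<psi>1' \<psi>2' \<phi>'. arc_coords \<psi>1' \<psi>2' \<phi>' \<and> vanishes_to_order a \<psi>1' \<and> vanishes_to_order b \<psi>2' \<and>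
     (\<exists>t\<in>cball 0 1. \<psi>1' t \<noteq> 0) \<and> (\<exists>t\<in>cball 0 1. \<psi>2' t \<noteq> 0) \<and>
     (\<forall>t\<in>cball 0 1. norm (\<psi>1' t - \<psi>1 t) \<le> \<epsilon> \<and> norm (\<psi>2' t - \<psi>2 t) \<le> \<epsilon> \<and> norm (\<phi>' t - \<phi> t) \<le> \<epsilon>)"
proof (cases "\<exists>t\<in>cball 0 1. \<psi>1 t \<noteq> 0")
  case True
  then obtain t0 where t0: "t0 \<in> cball 0 1" "\<psi>1 t0 \<noteq> 0"
    by blast
  obtain \<psi>2' \<phi>' where "arc_coords \<psi>2' \<psi>1 \<phi>'" "vanishes_to_order b \<psi>2'" "\<exists>t\<in>cball 0 1. \<psi>2' t \<noteq> 0"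
     "\<forall>t\<in>cball 0 1. norm (\<psi>2' t - \<psi>2 t) \<le> \<epsilon> \<and> norm (\<phi>' t - \<phi> t) \<le> \<epsilon>"
    using nonzero_first[OF iffD1[OF arc_coords_commute P] t0 b \<open>\<epsilon> > 0\<close>] by blast
  thus ?thesis
    using a(1) t0 arc_coords_commute \<open>\<epsilon> > 0\<close>
    by (intro exI[of _ \<psi>1] exI[of _ \<psi>2'] exI[of _ \<phi>']) auto
next
  case False
  then obtain \<psi>2' where \<psi>2': "arc_coords \<psi>1 \<psi>2' \<phi>" "vanishes_to_order b \<psi>2'" "\<exists>t\<in>cball 0 1. \<psi>2' t \<noteq> 0"
     "\<forall>t\<in>cball 0 1. norm (\<psi>2' t - \<psi>2 t) \<le> \<epsilon>"
    using nonzero_second[OF P _ b \<open>\<epsilon> > 0\<close>] by blast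
  then obtain t0 where t0: "t0 \<in> cball 0 1" "\<psi>2' t0 \<noteq> 0"
    by blast
  obtain \<psi>1' \<phi>' where "arc_coords \<psi>1' \<psi>2' \<phi>'" "vanishes_to_order a \<psi>1'" "\<exists>t\<in>cball 0 1. \<psi>1' t \<noteq> 0"
     "\<forall>t\<in>cball 0 1. norm (\<psi>1' t - \<psi>1 t) \<le> \<epsilon> \<and> norm (\<phi>' t - \<phi> t) \<le> \<epsilon>"
    using nonzero_first[OF \<psi>2'(1) t0 a \<open>\<epsilon> > 0\<close>] by blast
  thus ?thesis
    using \<psi>2' by (intro exI[of _ \<psi>1'] exI[of _ \<psi>2'] exI[of _ \<phi>']) auto
qed

end


lemma nonzero_avoiding_finite:
  fixes g :: "complex \<Rightarrow> complex"
  assumes g: "g holomorphic_on UNIV" "g 0 \<noteq> 0" and F: "finite F" and "\<epsilon> > 0"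
  shows "\<exists>\<sigma>. norm \<sigma> < \<epsilon> \<and> \<sigma> \<notin> F \<and> g \<sigma> \<noteq> 0"
proof -
  define A where "A = ball 0 \<epsilon> \<inter> {\<sigma>. g \<sigma> \<noteq> 0}"
  have "open {\<sigma>. g \<sigma> \<noteq> 0}"
    using g(1) by (intro open_Collect_neq holomorphic_on_imp_continuous_on) auto
  hence "open A"
    unfolding A_def by (intro open_Int open_ball)
  moreover have "0 \<in> A"
    using g \<open>\<epsilon> > 0\<close> by (simp add: A_def)
  ultimately have "infinite A"
    by (metis empty_iff finite_imp_not_open)
  hence "\<not> A \<subseteq> F"
    using F finite_subset by blast
  thus ?thesis
    by (auto simp: A_def)
qed

lemma vanishes_to_order_imp_le:
  assumes "vanishes_to_order a g" "(deriv ^^ k) g 0 \<noteq> 0"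
  shows "a \<le> k"
  using assms by (auto simp: vanishes_to_order_def not_less[symmetric])

context cA_equation
begin

text \<open>
  The vector \<open>w\<close> has to avoid the zeros of a nonzero form and the curve \<open>- \<theta>\<close>. A curve can be missed
  because there are two coordinates \<open>p\<close> and \<open>q\<close>: after a change of \<open>w\<^sub>p\<close> the function
  \<open>\<theta>\<^sub>p + w\<^sub>p\<close> has only finitely many zeros \<open>t\<close>, and each of them excludes a single value of \<open>w\<^sub>q\<close>.
\<close>

lemma generic_direction:
  fixes \<theta> :: "complex \<Rightarrow> complex ^ 'n" and p q :: 'n
  assumes pq: "p \<noteq> q" and \<theta>: "\<And>t. t \<in> ball 0 R \<Longrightarrow> hol_at \<theta> t" and r: "0 < r" "r < R" and "\<kappa> > 0"
    and c: "c \<noteq> 0"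
  shows "\<exists>w. norm w < \<kappa> \<and> homogeneous_part f m (e + c *\<^sub>C w) \<noteq> 0 \<and> (\<forall>t\<in>cball 0 r. \<theta> t + w \<noteq> 0)"
proof -
  have hol: "(\<lambda>\<sigma>. homogeneous_part f m (d1 + \<sigma> *\<^sub>C d2)) holomorphic_on UNIV" for d1 d2
    by (rule homogeneous_part_holomorphic_on_lines[OF open_U zero_U hol_f])
  have holk: "(\<lambda>t. vec_nth (\<theta> t) k + b) holomorphic_on ball 0 R" for k b
    by (rule hol_at_imp_holomorphic_on, intro hol_at_intros \<theta>)
  have norm_axis: "norm (\<sigma> *\<^sub>C axis k (1::complex)) = norm \<sigma>" for \<sigma> and k :: 'n
  proof -
    have "(\<Sum>i\<in>UNIV. (norm (vec_nth (axis k (1::complex)) i))\<^sup>2) = (\<Sum>i\<in>UNIV. if i = k then 1 else 0)"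
      by (intro sum.cong) (auto simp: axis_def)
    hence "norm (axis k (1::complex)) = 1"
      by (simp add: norm_vec_def L2_set_def)
    thus ?thesis
      by (simp add: norm_cscale)
  qed
  define \<delta> where "\<delta> = \<kappa> / 3"
  have \<delta>: "\<delta> > 0"
    using \<open>\<kappa> > 0\<close> by (simp add: \<delta>_def)
  obtain v where "homogeneous_part f m v \<noteq> 0"
    using leading_part by blast
  from homogeneous_part_nonzero_near[OF open_U zero_U hol_f this, of "norm c * \<delta>" e]
  obtain u where u: "norm u < norm c * \<delta>" "homogeneous_part f m (e + u) \<noteq> 0"
    using \<delta> c by auto
  define w0 where "w0 = inverse c *\<^sub>C u"
  have cw0: "c *\<^sub>C w0 = u"
    using c by (simp add: w0_def cscale_cscale)
  hence "norm c * norm w0 = norm u"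
    by (metis norm_cscale)
  hence w0: "norm w0 < \<delta>"
    using u(1) c by (metis mult_less_cancel_left_pos zero_less_norm_iff)
  \<comment> \<open>a step along coordinate \<open>p\<close> makes \<open>\<theta>\<^sub>p + w\<^sub>p\<close> not identically zero\<close>
  obtain \<sigma> where \<sigma>: "norm \<sigma> < \<delta>" "\<sigma> \<notin> {- (vec_nth (\<theta> 0) p + vec_nth w0 p)}"
      "homogeneous_part f m ((e + c *\<^sub>C w0) + \<sigma> *\<^sub>C (c *\<^sub>C axis p 1)) \<noteq> 0"
    using nonzero_avoiding_finite[OF hol _ _ \<delta>,
        of "e + c *\<^sub>C w0" "c *\<^sub>C axis p 1" "{- (vec_nth (\<theta> 0) p + vec_nth w0 p)}"] u cw0
    by auto
  define w1 where "w1 = w0 + \<sigma> *\<^sub>C axis p 1"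
  have w1p: "vec_nth w1 p = vec_nth w0 p + \<sigma>"
    by (simp add: w1_def cscale_vec_def axis_def cscale_complex_def)
  have w1: "homogeneous_part f m (e + c *\<^sub>C w1) \<noteq> 0"
    using \<sigma>(3) by (simp add: w1_def cscale_add_right cscale_cscale mult.commute add.assoc)
  define gp where "gp t = vec_nth (\<theta> t) p + vec_nth w1 p" for t
  have gp0: "gp 0 \<noteq> 0"
  proof
    assume "gp 0 = 0"
    hence "\<sigma> = - (vec_nth (\<theta> 0) p + vec_nth w0 p)"
      by (simp only: gp_def w1p eq_neg_iff_add_eq_0 add_ac)
    thus False
      using \<sigma>(2) by blast
  qed
  define Z where "Z = {t \<in> cball 0 r. gp t = 0}"
  have "finite Z"
  proof (cases "gp constant_on ball 0 R")
    case True
    then obtain b where b: "\<And>t. t \<in> ball 0 R \<Longrightarrow> gp t = b"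
      by (auto simp: constant_on_def)
    have "b \<noteq> 0"
      using b[of 0] gp0 r by simp
    hence "Z = {}"
      using b r by (auto simp: Z_def)
    thus ?thesis
      by simp
  next
    case False
    moreover have "gp holomorphic_on ball 0 R"
      using holk[of p "vec_nth w1 p"] unfolding gp_def[abs_def] .
    ultimately show ?thesis
      unfolding Z_def using r by (intro holomorphic_compact_finite_zeros[of gp "ball 0 R"]) auto
  qed
  \<comment> \<open>a step along coordinate \<open>q\<close> avoids the finitely many values that would make coordinate \<open>q\<close> vanish there, too\<close>
  define F where "F = (\<lambda>t. - (vec_nth (\<theta> t) q + vec_nth w1 q)) ` Z"
  have "finite F"
    unfolding F_def using \<open>finite Z\<close> by (rule finite_imageI)
  then obtain \<tau> where \<tau>: "norm \<tau> < \<delta>" "\<tau> \<notin> F"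
      "homogeneous_part f m ((e + c *\<^sub>C w1) + \<tau> *\<^sub>C (c *\<^sub>C axis q 1)) \<noteq> 0"
    using nonzero_avoiding_finite[OF hol _ _ \<delta>, of "e + c *\<^sub>C w1" "c *\<^sub>C axis q 1" F] w1 by auto
  define w where "w = w1 + \<tau> *\<^sub>C axis q 1"
  have wp: "vec_nth w p = vec_nth w1 p" and wq: "vec_nth w q = vec_nth w1 q + \<tau>"
    using pq by (simp_all add: w_def cscale_vec_def axis_def cscale_complex_def)
  have "norm w \<le> norm w0 + norm \<sigma> + norm \<tau>"
    unfolding w_def w1_def
    by (intro order_trans[OF norm_triangle_ineq] add_mono) (simp_all only: norm_axis order_refl)
  hence "norm w < \<kappa>"
    using w0 \<sigma>(1) \<tau>(1) by (simp add: \<delta>_def)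
  moreover have "homogeneous_part f m (e + c *\<^sub>C w) \<noteq> 0"
    using \<tau>(3) by (simp add: w_def cscale_add_right cscale_cscale mult.commute add.assoc)
  moreover have "\<theta> t + w \<noteq> 0" if t: "t \<in> cball 0 r" for t
  proof
    assume "\<theta> t + w = 0"
    hence 0: "vec_nth (\<theta> t) k + vec_nth w k = 0" for k
      by (metis vector_add_component zero_index)
    hence "t \<in> Z"
      using t 0[of p] by (simp add: Z_def gp_def wp)
    hence "- (vec_nth (\<theta> t) q + vec_nth w1 q) \<in> F"
      by (simp add: F_def)
    moreover have "\<tau> = - (vec_nth (\<theta> t) q + vec_nth w1 q)"
      using 0[of q] by (simp only: wq eq_neg_iff_add_eq_0 add_ac)
    ultimately show False
      using \<tau>(2) by simp
  qed
  ultimately show ?thesis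
    by blast
qed

text \<open>
  Transfers the order of \<open>f\<close> along the arc to the cofactor \<open>P\<close>: near 0, \<open>G\<close> is a unit, and a factor \<open>t\<close>
  accounts for the shift from \<open>m\<close> to \<open>m - 1\<close>.
\<close>

lemma perturbed_order:
  assumes \<eta>: "\<And>t. t \<in> ball 0 R \<Longrightarrow> hol_at \<eta> t" and R: "R > 0"
    and G: "G holomorphic_on ball 0 R" "G 0 \<noteq> 0" and P: "P holomorphic_on ball 0 R"
    and eq: "\<And>t. t \<in> ball 0 R \<Longrightarrow> f (t *\<^sub>C \<eta> t) = t * (G t * P t)"
  shows "vanishes_to_order (m - 1) P"
    "(deriv ^^ m) (\<lambda>t. f (t *\<^sub>C \<eta> t)) 0 = fact m * homogeneous_part f m (\<eta> 0)"
proof -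
  obtain r h where r: "r > 0" "h holomorphic_on ball 0 r" "\<And>t. t \<in> ball 0 r \<Longrightarrow> f (t *\<^sub>C \<eta> t) = t ^ m * h t"
     "h 0 = homogeneous_part f m (\<eta> 0)"
    using order_along_arc[OF open_U zero_U hol_f, of "ball 0 R" \<eta> m] \<eta> lower_parts R by auto
  show "(deriv ^^ m) (\<lambda>t. f (t *\<^sub>C \<eta> t)) 0 = fact m * homogeneous_part f m (\<eta> 0)"
    using factored_order(2)[OF r(2) open_ball _ r(3)] r by simp
  define V where "V = ball 0 r \<inter> {t \<in> ball 0 R. G t \<noteq> 0}"
  have "open {t \<in> ball 0 R. G t \<noteq> 0}"
    using continuous_open_preimage[OF holomorphic_on_imp_continuous_on[OF G(1)] open_ball, of "- {0}"]
    by (simp add: vimage_def Int_def open_Compl)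
  hence V: "open V" "0 \<in> V" "V \<subseteq> ball 0 r" "V \<subseteq> ball 0 R" "\<And>t. t \<in> V \<Longrightarrow> G t \<noteq> 0"
    using r R G(2) by (auto simp: V_def)
  have E: "(\<lambda>t. G t * P t) holomorphic_on V"
    using G(1) P V by (intro holomorphic_on_mult) (auto intro: holomorphic_on_subset)
  have "vanishes_to_order m (\<lambda>t. t * (G t * P t))"
  proof (rule factored_order(1)[of h V])
    fix t assume "t \<in> V"
    hence "t \<in> ball 0 r" "t \<in> ball 0 R"
      using V(3,4) by blast+
    thus "t * (G t * P t) = t ^ m * h t"
      using r(3) eq by metis
  qed (use r V in \<open>auto intro: holomorphic_on_subset\<close>)
  hence "vanishes_to_order (m - 1) (\<lambda>t. G t * P t)"
    unfolding vanishes_to_order_def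
  proof (intro allI impI)
    fix j assume van: "\<forall>j<m. (deriv ^^ j) (\<lambda>t. t * (G t * P t)) 0 = 0" and j: "j < m - 1"
    hence "0 = (deriv ^^ Suc j) (\<lambda>t. t * (G t * P t)) 0"
      by (simp del: funpow.simps)
    also have "\<dots> = of_nat (Suc j) * (deriv ^^ (Suc j - 1)) (\<lambda>t. G t * P t) 0"
      by (rule higher_deriv_times_var[OF E V(1,2)])
    finally show "(deriv ^^ j) (\<lambda>t. G t * P t) 0 = 0"
      by (simp del: of_nat_Suc funpow.simps)
  qed
  then obtain k where k: "k holomorphic_on V" "\<forall>t\<in>V. G t * P t = t ^ (m - 1) * k t"
    using vanishes_to_order_divide[OF E V(1,2)] by blast
  show "vanishes_to_order (m - 1) P"
  proof (rule factored_order(1)[of "\<lambda>t. k t / G t" V])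
    show "(\<lambda>t. k t / G t) holomorphic_on V"
      using k(1) G(1) V by (intro holomorphic_on_divide) (auto intro: holomorphic_on_subset)
    fix t assume t: "t \<in> V"
    have "P t = G t * P t / G t"
      using V(5)[OF t] by simp
    thus "P t = t ^ (m - 1) * (k t / G t)"
      using k(2) t by simp
  qed (use V in auto)
qed

text \<open>
  The heart of the density statement. With \<open>\<psi>\<^sub>1\<close> and \<open>\<psi>\<^sub>2\<close> equal to \<open>G\<^sub>1\<close> and \<open>G\<^sub>2\<close> times powers of \<open>t\<close>,
  the map \<open>\<phi>\<close> is moved by \<open>t G\<^sub>1 G\<^sub>2 w\<close>. Then \<open>f\<close> becomes \<open>t\<^sup>m G\<^sub>1 G\<^sub>2 h\<close> with \<open>h(0) \<noteq> 0\<close> and \<open>h\<close>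
  close to \<open>t\<close> to the power \<open>k + l\<close>, where \<open>k\<close> and \<open>l\<close> are the excess orders of \<open>\<psi>\<^sub>1\<close> and \<open>\<psi>\<^sub>2\<close>. Splitting
  \<open>h\<close> accordingly removes exactly this excess.
\<close>

lemma generic_order_dense_nonzero:
  fixes p q :: 'n
  assumes pq: "p \<noteq> q" and Pm: "arc_coords \<psi>1 \<psi>2 \<phi>"
    and a: "vanishes_to_order a \<psi>1" "a > 0" and b: "vanishes_to_order b \<psi>2" "b > 0" and ab: "a + b = m"
    and nz: "\<exists>t\<in>cball 0 1. \<psi>1 t \<noteq> 0" "\<exists>t\<in>cball 0 1. \<psi>2 t \<noteq> 0" and "\<epsilon> > 0"
  shows "\<exists>\<psi>1' \<psi>2' \<phi>'. arc_coords \<psi>1' \<psi>2' \<phi>' \<and> vanishes_to_order a \<psi>1' \<and> vanishes_to_order b \<psi>2' \<and>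
     (deriv ^^ a) \<psi>1' 0 \<noteq> 0 \<and> (deriv ^^ b) \<psi>2' 0 \<noteq> 0 \<and>
     (\<forall>t\<in>cball 0 1. norm (\<psi>1' t - \<psi>1 t) \<le> \<epsilon> \<and> norm (\<psi>2' t - \<psi>2 t) \<le> \<epsilon> \<and> norm (\<phi>' t - \<phi> t) \<le> \<epsilon>)"
proof -
  have \<psi>1: "\<psi>1 analytic_on cball 0 1" and \<psi>2: "\<psi>2 analytic_on cball 0 1"
    and \<phi>: "\<phi> holomorphic_map_on cball 0 1" and \<phi>U: "\<And>t. t \<in> cball 0 1 \<Longrightarrow> \<phi> t \<in> U"
    and f\<phi>: "\<And>t. t \<in> cball 0 1 \<Longrightarrow> \<psi>1 t * \<psi>2 t = f (\<phi> t)"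
    and short: "\<And>t. t \<in> cball 0 1 \<Longrightarrow> \<psi>1 t = 0 \<and> \<psi>2 t = 0 \<and> \<phi> t = 0 \<longleftrightarrow> t = 0"
    using Pm by (auto simp: arc_coords_def)
  have \<phi>U_ball: "\<forall>t\<in>cball 0 1. \<phi> t \<in> U"
    using \<phi>U by blast
  obtain a' G1 where G1: "G1 analytic_on cball 0 1" "G1 0 \<noteq> 0" "\<And>t. t \<in> cball 0 1 \<Longrightarrow> \<psi>1 t = t ^ a' * G1 t"
    using nz(1) finite_order_cball[OF \<psi>1] by blast
  obtain b' G2 where G2: "G2 analytic_on cball 0 1" "G2 0 \<noteq> 0" "\<And>t. t \<in> cball 0 1 \<Longrightarrow> \<psi>2 t = t ^ b' * G2 t"
    using nz(2) finite_order_cball[OF \<psi>2] by blast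
  have aa': "a \<le> a'"
    using vanishes_to_order_imp_le[OF a(1), of a'] factored_order_cball(2)[OF G1(1,3)] G1(2) by simp
  have bb': "b \<le> b'"
    using vanishes_to_order_imp_le[OF b(1), of b'] factored_order_cball(2)[OF G2(1,3)] G2(2) by simp
  define k where "k = a' - a"
  define l where "l = b' - b"
  have a'b': "a' + b' = m + (k + l)"
    using aa' bb' ab by (simp add: k_def l_def)
  define G where "G t = G1 t * G2 t" for t
  have G: "G analytic_on cball 0 1" "G 0 \<noteq> 0"
    unfolding G_def using G1 G2 by (auto intro!: analytic_intros)
  define g where "g t = t * G t" for t
  have g: "g analytic_on cball 0 1"
    unfolding g_def by (intro analytic_intros G)
  have g_nz: "\<exists>t\<in>cball 0 1. g t \<noteq> 0"
  proof -
    obtain R where R: "R > 1" "G holomorphic_on ball 0 R"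
      using G(1) analytic_on_cball_unit by blast
    have "isCont G 0"
      using continuous_on_eq_continuous_at[OF open_ball] holomorphic_on_imp_continuous_on[OF R(2)] R(1)
      by (metis centre_in_ball less_trans zero_less_one)
    hence "eventually (\<lambda>t. G t \<noteq> 0) (at 0)"
      using G(2) isContD tendsto_imp_eventually_ne by blast
    moreover have "eventually (\<lambda>t. t \<in> ball 0 1 \<and> t \<noteq> 0) (at (0::complex))"
      using eventually_at_in_open[of "ball 0 1" "0::complex"] by (auto elim: eventually_mono)
    ultimately have "eventually (\<lambda>t. t \<in> cball 0 1 \<and> g t \<noteq> 0) (at 0)"
      by eventually_elim (auto simp: g_def)
    thus ?thesis
      using eventually_happens by (metis (mono_tags, lifting) trivial_limit_at)
  qed
  then obtain t0 where t0: "t0 \<in> cball 0 1" "g t0 \<noteq> 0"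
    by blast
  obtain \<kappa> C where \<kappa>: "\<kappa> > 0" and C: "C > 0" and pert: "\<forall>w. norm w < \<kappa> \<longrightarrow>
    (\<lambda>t. \<phi> t + g t *\<^sub>C w) holomorphic_map_on cball 0 1 \<and> (\<forall>t\<in>cball 0 1. \<phi> t + g t *\<^sub>C w \<in> U) \<and>
    (\<exists>H. H analytic_on cball 0 1 \<and>
       (\<forall>t\<in>cball 0 1. f (\<phi> t + g t *\<^sub>C w) = f (\<phi> t) + g t * H t \<and> norm (H t) \<le> C * norm w))"
    using f_perturb[OF \<phi> \<phi>U_ball g t0] by (elim exE conjE)
  obtain R1 where R1: "R1 > 1" "\<forall>t\<in>ball 0 R1. hol_at \<phi> t"
    using \<phi> holomorphic_map_on_cball_unit by blast
  obtain \<eta> where \<eta>: "\<And>t. t \<in> ball 0 R1 \<Longrightarrow> hol_at \<eta> t" "\<And>t. t \<in> ball 0 R1 \<Longrightarrow> \<phi> t = t *\<^sub>C \<eta> t"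
    using hol_at_divide_var[of "ball 0 R1" \<phi>] R1 arc_coords_at_0[OF Pm] by auto
  have Ghol: "G holomorphic_on ball 0 1"
    using G(1) analytic_imp_holomorphic ball_subset_cball holomorphic_on_subset by blast
  have "open {t \<in> ball 0 1. G t \<noteq> 0}"
    using continuous_open_preimage[OF holomorphic_on_imp_continuous_on[OF Ghol] open_ball, of "- {0}"]
    by (simp add: vimage_def Int_def open_Compl)
  moreover have "0 \<in> {t \<in> ball 0 1. G t \<noteq> 0}"
    using G(2) by simp
  ultimately obtain R where R: "R > 0" "ball 0 R \<subseteq> {t \<in> ball 0 1. G t \<noteq> 0}"
    by (meson open_contains_ball)
  define r where "r = R / 2"
  have r: "0 < r" "r < R"
    using R by (auto simp: r_def)
  have R_le: "ball 0 R \<subseteq> ball (0::complex) 1"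
    using R by blast
  have Ghol_R: "G holomorphic_on ball 0 R"
    using Ghol R_le by (rule holomorphic_on_subset)
  have \<eta>R: "hol_at \<eta> t" if "t \<in> ball 0 R" for t
  proof -
    have "t \<in> ball 0 1"
      using R_le that by blast
    thus ?thesis
      using R1 by (intro \<eta>(1)) auto
  qed
  obtain B1 where B1: "B1 > 0" "\<And>t. t \<in> cball 0 1 \<Longrightarrow> norm (G1 t) \<le> B1"
    using bounded_on_cball_unit[OF analytic_on_imp_continuous_on[OF G1(1)]] by blast
  obtain B2 where B2: "B2 > 0" "\<And>t. t \<in> cball 0 1 \<Longrightarrow> norm (G2 t) \<le> B2"
    using bounded_on_cball_unit[OF analytic_on_imp_continuous_on[OF G2(1)]] by blast
  obtain B where B: "B > 0" "\<And>t. t \<in> cball 0 1 \<Longrightarrow> norm (g t) \<le> B"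
    using bounded_on_cball_unit[OF analytic_on_imp_continuous_on[OF g]] by blast
  \<comment> \<open>away from 0 the arc keeps a positive distance from the origin, so small changes cannot make it return there\<close>
  obtain \<mu> where \<mu>: "\<mu> > 0"
    "\<And>t. t \<in> cball 0 1 - ball 0 r \<Longrightarrow> \<mu> \<le> norm (\<psi>1 t) + norm (\<psi>2 t) + norm (\<phi> t)"
  proof -
    let ?K = "cball 0 1 - ball 0 r :: complex set"
    let ?n = "\<lambda>t. norm (\<psi>1 t) + norm (\<psi>2 t) + norm (\<phi> t)"
    have "compact ?K"
      by (intro compact_diff compact_cball open_ball)
    moreover have "continuous_on ?K ?n"
      by (intro continuous_intros; rule continuous_on_subset[OF _ Diff_subset])
        (auto intro: analytic_on_imp_continuous_on \<psi>1 \<psi>2 holomorphic_map_on_cball_unit_continuous \<phi>)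
    moreover have "1 \<in> ?K"
      using R_le r by (simp add: ball_subset_ball_iff)
    ultimately obtain t where t: "t \<in> ?K" "\<forall>s\<in>?K. ?n t \<le> ?n s"
      using continuous_attains_inf[of ?K ?n] by blast
    have "?n t > 0"
    proof -
      have "t \<noteq> 0" "t \<in> cball 0 1"
        using t(1) r by auto
      hence "\<not> (\<psi>1 t = 0 \<and> \<psi>2 t = 0 \<and> \<phi> t = 0)"
        using short[of t] by simp
      thus ?thesis
        by (auto simp: add_pos_nonneg add_nonneg_pos)
    qed
    thus thesis
      using that t(2) by blast
  qed
  define \<epsilon>' where "\<epsilon>' = min \<epsilon> (\<mu> / 4)"
  have \<epsilon>': "\<epsilon>' > 0" "\<epsilon>' \<le> \<epsilon>" "4 * \<epsilon>' \<le> \<mu>"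
    using \<open>\<epsilon> > 0\<close> \<mu>(1) by (auto simp: \<epsilon>'_def)
  define \<beta> where "\<beta> = min (\<epsilon>' / B1) (\<epsilon>' / B2)"
  have \<beta>: "\<beta> > 0" "B1 * \<beta> \<le> \<epsilon>'" "B2 * \<beta> \<le> \<epsilon>'"
    using \<epsilon>' B1 B2 by (auto simp: \<beta>_def min_def field_simps)
  obtain \<delta> where \<delta>: "\<delta> > 0" "\<forall>h. h analytic_on cball 0 1 \<and> (\<forall>t\<in>cball 0 1. norm (h t - t ^ (k + l)) \<le> \<delta>) \<longrightarrow>
    (\<exists>h1 h2. h1 analytic_on cball 0 1 \<and> h2 analytic_on cball 0 1 \<and>
       (\<forall>t\<in>cball 0 1. h t = h1 t * h2 t \<and> norm (h1 t - t ^ k) \<le> \<beta> \<and> norm (h2 t - t ^ l) \<le> \<beta>))"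
    using factor_near_power[OF \<beta>(1), of k l] by (elim exE conjE)
  define \<kappa>' where "\<kappa>' = min \<kappa> (min (\<delta> / C) (\<epsilon>' / B))"
  have \<kappa>': "\<kappa>' > 0" "\<kappa>' \<le> \<kappa>" "\<kappa>' \<le> \<delta> / C" "\<kappa>' \<le> \<epsilon>' / B"
    using \<kappa> \<delta>(1) C \<epsilon>' B(1) by (auto simp: \<kappa>'_def)
  \<comment> \<open>near 0, where \<open>G\<close> is a unit, the moved map \<open>\<phi>\<close> is \<open>t G\<close> times the vector \<open>\<eta> / G + w\<close>\<close>
  have "hol_at (\<lambda>t. inverse (G t) *\<^sub>C \<eta> t) t" if "t \<in> ball 0 R" for t
  proof (intro hol_at_cscale hol_at_inverse \<eta>R that)
    show "hol_at G t"
      by (rule holomorphic_on_imp_hol_at[OF Ghol_R _ that]) simp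
    show "G t \<noteq> 0"
      using R that by blast
  qed
  from generic_direction[OF pq this r \<kappa>'(1) G(2), of "\<eta> 0"]
  obtain w where w: "norm w < \<kappa>'" "homogeneous_part f m (\<eta> 0 + G 0 *\<^sub>C w) \<noteq> 0"
    "\<And>t. t \<in> cball 0 r \<Longrightarrow> inverse (G t) *\<^sub>C \<eta> t + w \<noteq> 0"
    by blast
  define \<phi>' where "\<phi>' t = \<phi> t + g t *\<^sub>C w" for t
  have "norm w < \<kappa>"
    using w \<kappa>' by linarith
  from pert[THEN spec, THEN mp, OF this] obtain H where \<phi>': "\<phi>' holomorphic_map_on cball 0 1"
      "\<And>t. t \<in> cball 0 1 \<Longrightarrow> \<phi>' t \<in> U" and H: "H analytic_on cball 0 1"
      "\<And>t. t \<in> cball 0 1 \<Longrightarrow> f (\<phi>' t) = f (\<phi> t) + g t * H t \<and> norm (H t) \<le> C * norm w"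
    unfolding \<phi>'_def by blast
  define P where "P t = t ^ (m - 1 + (k + l)) + H t" for t
  have P: "P analytic_on cball 0 1"
    unfolding P_def by (intro analytic_intros H)
  have f\<phi>': "f (\<phi>' t) = t * (G t * P t)" if t: "t \<in> cball 0 1" for t
  proof -
    have "f (\<phi> t) = t ^ (a' + b') * G t"
      using f\<phi>[OF t, symmetric] unfolding G1(3)[OF t] G2(3)[OF t]
      by (simp add: G_def power_add mult_ac)
    also have "a' + b' = Suc (m - 1 + (k + l))"
      using a'b' m_ge_2 by simp
    finally show ?thesis
      using H(2)[OF t] by (simp add: P_def g_def algebra_simps)
  qed
  define \<eta>' where "\<eta>' t = \<eta> t + G t *\<^sub>C w" for t
  have \<phi>'\<eta>': "\<phi>' t = t *\<^sub>C \<eta>' t" if "t \<in> cball 0 1" for t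
    using \<eta>(2)[of t] that R1 by (simp add: \<phi>'_def \<eta>'_def g_def cscale_add_right cscale_cscale)
  have \<eta>': "hol_at \<eta>' t" if "t \<in> ball 0 R" for t
    unfolding \<eta>'_def
    by (intro hol_at_add hol_at_cscale hol_at_const \<eta>R that holomorphic_on_imp_hol_at[OF Ghol_R]) auto
  have in1: "t \<in> cball 0 1" if "t \<in> ball 0 R" for t :: complex
    using that R_le by auto
  have P_R: "P holomorphic_on ball 0 R"
    using P in1 by (meson analytic_imp_holomorphic holomorphic_on_subset subsetI)
  have eq: "f (t *\<^sub>C \<eta>' t) = t * (G t * P t)" if "t \<in> ball 0 R" for t
    using f\<phi>'[OF in1[OF that]] \<phi>'\<eta>'[OF in1[OF that]] by simp
  have "vanishes_to_order (m - 1) P"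
    by (rule perturbed_order(1)[OF \<eta>' R(1) Ghol_R G(2) P_R eq])
  then obtain h where h: "h analytic_on cball 0 1" "\<And>t. t \<in> cball 0 1 \<Longrightarrow> P t = t ^ (m - 1) * h t"
    using analytic_on_cball_divide_power[OF P] by blast
  have f\<phi>'h: "f (\<phi>' t) = t ^ m * (G t * h t)" if t: "t \<in> cball 0 1" for t
  proof -
    have "t ^ m = t * t ^ (m - 1)"
      using m_ge_2 by (metis power_minus_mult mult.commute less_le_trans pos2)
    thus ?thesis
      using f\<phi>'[OF t] h(2)[OF t] by simp
  qed
  have h0: "h 0 \<noteq> 0"
  proof -
    have "(deriv ^^ m) (\<lambda>t. f (t *\<^sub>C \<eta>' t)) 0 = fact m * (G 0 * h 0)"
    proof (rule factored_order(2)[of "\<lambda>t. G t * h t" "ball 0 R"])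
      show "(\<lambda>t. G t * h t) holomorphic_on ball 0 R"
        using Ghol_R h(1) in1
        by (intro holomorphic_on_mult) (meson analytic_imp_holomorphic holomorphic_on_subset subsetI)+
      show "f (t *\<^sub>C \<eta>' t) = t ^ m * (G t * h t)" if "t \<in> ball 0 R" for t
        using f\<phi>'h[OF in1[OF that]] \<phi>'\<eta>'[OF in1[OF that]] by simp
    qed (use R in auto)
    moreover have "(deriv ^^ m) (\<lambda>t. f (t *\<^sub>C \<eta>' t)) 0 = fact m * homogeneous_part f m (\<eta>' 0)"
      by (rule perturbed_order(2)[OF \<eta>' R(1) Ghol_R G(2) P_R eq])
    ultimately show ?thesis
      using w(2) by (auto simp: \<eta>'_def)
  qed
  \<comment> \<open>the closeness of \<open>h\<close> to the power is checked on the unit circle, where powers of \<open>t\<close> have modulus 1\<close>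
  have h_bd: "norm (h t - t ^ (k + l)) \<le> C * norm w" if t: "norm t = 1" for t
  proof -
    have tc: "t \<in> cball 0 1"
      using t by simp
    have "t ^ (m - 1) * (h t - t ^ (k + l)) = P t - t ^ (m - 1 + (k + l))"
      by (simp add: h(2)[OF tc] power_add algebra_simps)
    also have "\<dots> = H t"
      by (simp add: P_def)
    finally have "norm (t ^ (m - 1) * (h t - t ^ (k + l))) \<le> C * norm w"
      using H(2)[OF tc] by simp
    thus ?thesis
      using t by (simp add: norm_mult norm_power)
  qed
  have "(\<lambda>t. h t - t ^ (k + l)) analytic_on cball 0 1"
    by (intro analytic_intros h(1))
  from maximum_modulus_cball[OF this zero_less_one h_bd]
  have "norm (h t - t ^ (k + l)) \<le> C * norm w" if "t \<in> cball 0 1" for t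
    using that by blast
  moreover have "C * norm w \<le> \<delta>"
  proof -
    have "C * norm w \<le> C * (\<delta> / C)"
      using w \<kappa>' C by (intro mult_left_mono) auto
    thus ?thesis
      using C by simp
  qed
  ultimately have "\<forall>t\<in>cball 0 1. norm (h t - t ^ (k + l)) \<le> \<delta>"
    using order_trans by blast
  with h(1) \<delta>(2) obtain h1 h2 where h12: "h1 analytic_on cball 0 1" "h2 analytic_on cball 0 1"
    "\<And>t. t \<in> cball 0 1 \<Longrightarrow> h t = h1 t * h2 t \<and> norm (h1 t - t ^ k) \<le> \<beta> \<and> norm (h2 t - t ^ l) \<le> \<beta>"
    by blast
  define \<psi>1' where "\<psi>1' t = t ^ a * (G1 t * h1 t)" for t
  define \<psi>2' where "\<psi>2' t = t ^ b * (G2 t * h2 t)" for t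
  have A1: "(\<lambda>t. G1 t * h1 t) analytic_on cball 0 1" and A2: "(\<lambda>t. G2 t * h2 t) analytic_on cball 0 1"
    using G1 G2 h12 by (auto intro!: analytic_intros)
  have h12_0: "h1 0 \<noteq> 0" "h2 0 \<noteq> 0"
    using h0 h12(3)[of 0] by auto
  have ord1: "vanishes_to_order a \<psi>1'" "(deriv ^^ a) \<psi>1' 0 \<noteq> 0"
    using factored_order_cball[OF A1, of \<psi>1' a] G1(2) h12_0 by (auto simp: \<psi>1'_def)
  have ord2: "vanishes_to_order b \<psi>2'" "(deriv ^^ b) \<psi>2' 0 \<noteq> 0"
    using factored_order_cball[OF A2, of \<psi>2' b] G2(2) h12_0 by (auto simp: \<psi>2'_def)
  have close: "norm (\<psi>1' t - \<psi>1 t) \<le> \<epsilon>' \<and> norm (\<psi>2' t - \<psi>2 t) \<le> \<epsilon>' \<and> norm (\<phi>' t - \<phi> t) \<le> \<epsilon>'"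
    if t: "t \<in> cball 0 1" for t
  proof (intro conjI)
    have pow: "norm (t ^ j) \<le> 1" for j
      using t by (simp add: norm_power power_le_one)
    have "\<psi>1' t - \<psi>1 t = t ^ a * (G1 t * (h1 t - t ^ k))"
      using aa' by (simp add: \<psi>1'_def G1(3)[OF t] k_def algebra_simps flip: power_add)
    also have "norm \<dots> \<le> 1 * (B1 * \<beta>)"
      unfolding norm_mult using pow B1(1) B1(2)[OF t] h12(3)[OF t] by (intro mult_mono) auto
    finally show "norm (\<psi>1' t - \<psi>1 t) \<le> \<epsilon>'"
      using \<beta> by simp
    have "\<psi>2' t - \<psi>2 t = t ^ b * (G2 t * (h2 t - t ^ l))"
      using bb' by (simp add: \<psi>2'_def G2(3)[OF t] l_def algebra_simps flip: power_add)
    also have "norm \<dots> \<le> 1 * (B2 * \<beta>)"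
      unfolding norm_mult using pow B2(1) B2(2)[OF t] h12(3)[OF t] by (intro mult_mono) auto
    finally show "norm (\<psi>2' t - \<psi>2 t) \<le> \<epsilon>'"
      using \<beta> by simp
    have "norm (g t *\<^sub>C w) \<le> B * (\<epsilon>' / B)"
      unfolding norm_cscale using w \<kappa>' B(1) B(2)[OF t] by (intro mult_mono) auto
    thus "norm (\<phi>' t - \<phi> t) \<le> \<epsilon>'"
      using B by (simp add: \<phi>'_def)
  qed
  have "arc_coords \<psi>1' \<psi>2' \<phi>'"
    unfolding arc_coords_def
  proof (intro conjI ballI)
    show "\<psi>1' analytic_on cball 0 1" "\<psi>2' analytic_on cball 0 1"
      unfolding \<psi>1'_def \<psi>2'_def by (intro analytic_intros A1 A2)+
    fix t :: complex assume t: "t \<in> cball 0 1"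
    show "\<psi>1' t * \<psi>2' t = f (\<phi>' t)"
      using f\<phi>'h[OF t] h12(3)[OF t] ab by (simp add: \<psi>1'_def \<psi>2'_def G_def algebra_simps flip: power_add)
    show "\<psi>1' t = 0 \<and> \<psi>2' t = 0 \<and> \<phi>' t = 0 \<longleftrightarrow> t = 0"
    proof
      assume 0: "\<psi>1' t = 0 \<and> \<psi>2' t = 0 \<and> \<phi>' t = 0"
      have "t \<in> ball 0 r"
      proof (rule ccontr)
        assume "t \<notin> ball 0 r"
        hence "\<mu> \<le> norm (\<psi>1 t) + norm (\<psi>2 t) + norm (\<phi> t)"
          using t by (intro \<mu>) auto
        thus False
          using close[OF t] 0 \<epsilon>' by simp
      qed
      show "t = 0"
      proof (rule ccontr)
        assume "t \<noteq> 0"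
        have "t \<in> ball 0 R"
          using \<open>t \<in> ball 0 r\<close> r by simp
        hence "G t \<noteq> 0"
          using R(2) by blast
        have "t *\<^sub>C \<eta>' t = 0"
          using 0 \<phi>'\<eta>'[OF t] by simp
        hence "norm t * norm (\<eta>' t) = 0"
          by (metis norm_cscale norm_zero)
        hence "\<eta>' t = 0"
          using \<open>t \<noteq> 0\<close> by simp
        hence "inverse (G t) *\<^sub>C \<eta>' t = 0"
          by simp
        hence "inverse (G t) *\<^sub>C \<eta> t + w = 0"
          using \<open>G t \<noteq> 0\<close> by (simp add: \<eta>'_def cscale_add_right cscale_cscale)
        thus False
          using w(3)[of t] \<open>t \<in> ball 0 r\<close> by simp
      qed
    next
      assume "t = 0"
      thus "\<psi>1' t = 0 \<and> \<psi>2' t = 0 \<and> \<phi>' t = 0"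
        using a(2) b(2) arc_coords_at_0[OF Pm] by (simp add: \<psi>1'_def \<psi>2'_def \<phi>'_def g_def)
    qed
  qed (use \<phi>' in auto)
  moreover have "\<forall>t\<in>cball 0 1. norm (\<psi>1' t - \<psi>1 t) \<le> \<epsilon> \<and> norm (\<psi>2' t - \<psi>2 t) \<le> \<epsilon> \<and> norm (\<phi>' t - \<phi> t) \<le> \<epsilon>"
    using close \<epsilon>'(2) order_trans by blast
  ultimately show ?thesis
    using ord1 ord2 by blast
qed

lemma generic_order_dense:
  fixes p q :: 'n
  assumes pq: "p \<noteq> q" and Pm: "arc_coords \<psi>1 \<psi>2 \<phi>"
    and a: "vanishes_to_order a \<psi>1" "a > 0" and b: "vanishes_to_order b \<psi>2" "b > 0" and ab: "a + b = m"
    and "\<epsilon> > 0"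
  shows "\<exists>\<psi>1' \<psi>2' \<phi>'. arc_coords \<psi>1' \<psi>2' \<phi>' \<and> vanishes_to_order a \<psi>1' \<and> vanishes_to_order b \<psi>2' \<and>
     (deriv ^^ a) \<psi>1' 0 \<noteq> 0 \<and> (deriv ^^ b) \<psi>2' 0 \<noteq> 0 \<and>
     (\<forall>t\<in>cball 0 1. norm (\<psi>1' t - \<psi>1 t) \<le> \<epsilon> \<and> norm (\<psi>2' t - \<psi>2 t) \<le> \<epsilon> \<and> norm (\<phi>' t - \<phi> t) \<le> \<epsilon>)"
proof -
  have e2: "\<epsilon> / 2 > 0"
    using \<open>\<epsilon> > 0\<close> by simp
  obtain \<psi>1' \<psi>2' \<phi>' where 1: "arc_coords \<psi>1' \<psi>2' \<phi>'" "vanishes_to_order a \<psi>1'" "vanishes_to_order b \<psi>2'"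
     "\<exists>t\<in>cball 0 1. \<psi>1' t \<noteq> 0" "\<exists>t\<in>cball 0 1. \<psi>2' t \<noteq> 0"
     "\<forall>t\<in>cball 0 1. norm (\<psi>1' t - \<psi>1 t) \<le> \<epsilon> / 2 \<and> norm (\<psi>2' t - \<psi>2 t) \<le> \<epsilon> / 2 \<and> norm (\<phi>' t - \<phi> t) \<le> \<epsilon> / 2"
    using both_nonzero[OF Pm a b e2] by (elim exE conjE)
  obtain \<psi>1'' \<psi>2'' \<phi>'' where 2: "arc_coords \<psi>1'' \<psi>2'' \<phi>''" "vanishes_to_order a \<psi>1''" "vanishes_to_order b \<psi>2''"
     "(deriv ^^ a) \<psi>1'' 0 \<noteq> 0" "(deriv ^^ b) \<psi>2'' 0 \<noteq> 0"
     "\<forall>t\<in>cball 0 1. norm (\<psi>1'' t - \<psi>1' t) \<le> \<epsilon> / 2 \<and> norm (\<psi>2'' t - \<psi>2' t) \<le> \<epsilon> / 2 \<and> norm (\<phi>'' t - \<phi>' t) \<le> \<epsilon> / 2"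
    using generic_order_dense_nonzero[OF pq 1(1,2) a(2) 1(3) b(2) ab 1(4,5) e2] by (elim exE conjE)
  have "\<forall>t\<in>cball 0 1. norm (\<psi>1'' t - \<psi>1 t) \<le> \<epsilon> \<and> norm (\<psi>2'' t - \<psi>2 t) \<le> \<epsilon> \<and> norm (\<phi>'' t - \<phi> t) \<le> \<epsilon>"
  proof
    fix t :: complex assume t: "t \<in> cball 0 1"
    show "norm (\<psi>1'' t - \<psi>1 t) \<le> \<epsilon> \<and> norm (\<psi>2'' t - \<psi>2 t) \<le> \<epsilon> \<and> norm (\<phi>'' t - \<phi> t) \<le> \<epsilon>"
      using bspec[OF 1(6) t] bspec[OF 2(6) t]
        norm_diff_triangle_le[of "\<psi>1'' t" "\<psi>1' t" "\<epsilon> / 2" "\<psi>1 t" "\<epsilon> / 2"]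
        norm_diff_triangle_le[of "\<psi>2'' t" "\<psi>2' t" "\<epsilon> / 2" "\<psi>2 t" "\<epsilon> / 2"]
        norm_diff_triangle_le[of "\<phi>'' t" "\<phi>' t" "\<epsilon> / 2" "\<phi> t" "\<epsilon> / 2"]
      by simp
  qed
  thus ?thesis
    using 2 by blast
qed

end


section \<open>The space of short arcs\<close>

lemma short_arcE:
  assumes "\<gamma> \<in> short_arcs X p"
  obtains h where "h holomorphic_map_on cball 0 1" "\<gamma> = restrict h (cball 0 1)"
  using assms unfolding short_arcs_def by blast

lemma short_arc_continuous:
  assumes "\<gamma> \<in> short_arcs X p"
  shows "continuous_on (cball 0 1) \<gamma>"
proof -
  obtain h where h: "h holomorphic_map_on cball 0 1" "\<gamma> = restrict h (cball 0 1)"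
    using assms by (rule short_arcE)
  have "continuous_on (cball 0 1) h"
    using h(1) by (rule holomorphic_map_on_cball_unit_continuous)
  thus ?thesis
    by (rule continuous_on_eq) (simp add: h(2))
qed

lemma short_arcs_subset_funspace:
  "short_arcs X p \<subseteq> mspace (funspace (cball 0 1) euclidean_metric)"
proof
  fix \<gamma> :: "complex \<Rightarrow> 'a"
  assume \<gamma>: "\<gamma> \<in> short_arcs X p"
  have "bounded (\<gamma> ` cball 0 1)"
    using compact_imp_bounded[OF compact_continuous_image[OF short_arc_continuous[OF \<gamma>] compact_cball]] .
  hence "Metric_space.mbounded UNIV dist (\<gamma> ` cball 0 1)"
    by simp
  moreover have "\<gamma> \<in> extensional (cball 0 1)"
    using \<gamma> by (auto elim!: short_arcE)
  ultimately show "\<gamma> \<in> mspace (funspace (cball 0 1) euclidean_metric)"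
    by (simp add: Met_TC.fspace_def)
qed

lemma topspace_short_arc_topology [simp]:
  "topspace (short_arc_topology X p) = short_arcs X p"
  unfolding short_arc_topology_def topspace_subtopology topspace_mtopology_of
  using short_arcs_subset_funspace by blast

text \<open>
  The uniform distance is a supremum, so that a distance of at most \<open>\<epsilon>\<close> (not less than \<open>\<epsilon>\<close>) is what can
  be tested pointwise.
\<close>

definition arc_close :: "real \<Rightarrow> (complex \<Rightarrow> 'a::metric_space) \<Rightarrow> (complex \<Rightarrow> 'a) \<Rightarrow> bool" where
  "arc_close \<epsilon> \<gamma> \<delta> \<longleftrightarrow> (\<forall>t\<in>cball 0 1. dist (\<gamma> t) (\<delta> t) \<le> \<epsilon>)"

lemma openin_short_arc_topology_iff:
  "openin (short_arc_topology X p) W \<longleftrightarrow>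
     W \<subseteq> short_arcs X p \<and>
     (\<forall>\<gamma>\<in>W. \<exists>\<epsilon>>0. \<forall>\<delta>\<in>short_arcs X p. arc_close \<epsilon> \<gamma> \<delta> \<longrightarrow> \<delta> \<in> W)"
proof -
  let ?m = "funspace (cball (0::complex) 1) (euclidean_metric :: 'a metric)"
  interpret F: Metric_space "mspace ?m" "mdist ?m"
    by (rule Metric_space_mspace_mdist)
  have top: "short_arc_topology X p = subtopology F.mtopology (short_arcs X p)"
    by (simp only: short_arc_topology_def mtopology_of_def)
  have le: "mdist ?m \<gamma> \<delta> \<le> e \<longleftrightarrow> arc_close e \<gamma> \<delta>"
    if "\<gamma> \<in> short_arcs X p" "\<delta> \<in> short_arcs X p" for \<gamma> \<delta> e
  proof -
    have "\<gamma> \<in> mspace ?m" "\<delta> \<in> mspace ?m" "cball (0::complex) 1 \<noteq> {}"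
      using short_arcs_subset_funspace that by auto
    from funspace_mdist_le[OF this, of e] show ?thesis
      by (simp only: arc_close_def mdist_euclidean_metric)
  qed
  show ?thesis
  proof
    assume "openin (short_arc_topology X p) W"
    then obtain T where T: "openin F.mtopology T" "W = T \<inter> short_arcs X p"
      unfolding top openin_subtopology by blast
    show "W \<subseteq> short_arcs X p \<and>
      (\<forall>\<gamma>\<in>W. \<exists>\<epsilon>>0. \<forall>\<delta>\<in>short_arcs X p. arc_close \<epsilon> \<gamma> \<delta> \<longrightarrow> \<delta> \<in> W)"
    proof (intro conjI ballI)
      fix \<gamma> assume "\<gamma> \<in> W"
      hence \<gamma>: "\<gamma> \<in> T" "\<gamma> \<in> short_arcs X p"
        using T by auto
      obtain r where r: "r > 0" "F.mball \<gamma> r \<subseteq> T"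
        using T(1) \<gamma>(1) F.openin_mtopology by blast
      have "\<delta> \<in> W" if \<delta>: "\<delta> \<in> short_arcs X p" "arc_close (r / 2) \<gamma> \<delta>" for \<delta>
      proof -
        have "mdist ?m \<gamma> \<delta> \<le> r / 2"
          using le[OF \<gamma>(2) \<delta>(1)] \<delta>(2) by blast
        hence "mdist ?m \<gamma> \<delta> < r"
          using r(1) by linarith
        moreover have "\<gamma> \<in> mspace ?m" "\<delta> \<in> mspace ?m"
          using \<gamma>(2) \<delta>(1) short_arcs_subset_funspace by blast+
        ultimately have "\<delta> \<in> F.mball \<gamma> r"
          by (simp only: F.in_mball simp_thms)
        thus ?thesis
          using r(2) T(2) \<delta>(1) by blast
      qed
      thus "\<exists>\<epsilon>>0. \<forall>\<delta>\<in>short_arcs X p. arc_close \<epsilon> \<gamma> \<delta> \<longrightarrow> \<delta> \<in> W"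
        using r(1) by (intro exI[of _ "r / 2"]) simp
    qed (use T in blast)
  next
    assume W: "W \<subseteq> short_arcs X p \<and>
      (\<forall>\<gamma>\<in>W. \<exists>\<epsilon>>0. \<forall>\<delta>\<in>short_arcs X p. arc_close \<epsilon> \<gamma> \<delta> \<longrightarrow> \<delta> \<in> W)"
    define \<T> where "\<T> = {F.mball \<gamma> e |\<gamma> e. \<gamma> \<in> W \<and> e > 0 \<and>
        (\<forall>\<delta>\<in>short_arcs X p. arc_close e \<gamma> \<delta> \<longrightarrow> \<delta> \<in> W)}"
    have "openin F.mtopology (\<Union>\<T>)"
      unfolding \<T>_def by (intro openin_Union) (use F.openin_mball in blast)
    moreover have "W = \<Union>\<T> \<inter> short_arcs X p"
    proof
      show "W \<subseteq> \<Union>\<T> \<inter> short_arcs X p"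
      proof
        fix \<gamma> assume \<gamma>: "\<gamma> \<in> W"
        then obtain e where e: "e > 0" "\<forall>\<delta>\<in>short_arcs X p. arc_close e \<gamma> \<delta> \<longrightarrow> \<delta> \<in> W"
          using W by blast
        have "\<gamma> \<in> mspace ?m"
          using \<gamma> W short_arcs_subset_funspace by blast
        hence "\<gamma> \<in> F.mball \<gamma> e"
          using e(1) by (simp only: F.centre_in_mball_iff simp_thms)
        moreover have "F.mball \<gamma> e \<in> \<T>"
          unfolding \<T>_def using \<gamma> e by blast
        ultimately show "\<gamma> \<in> \<Union>\<T> \<inter> short_arcs X p"
          using \<gamma> W by blast
      qed
      show "\<Union>\<T> \<inter> short_arcs X p \<subseteq> W"
      proof
        fix \<delta> assume "\<delta> \<in> \<Union>\<T> \<inter> short_arcs X p"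
        then obtain \<gamma> e where \<gamma>: "\<delta> \<in> F.mball \<gamma> e" "\<gamma> \<in> W"
          "\<forall>\<delta>\<in>short_arcs X p. arc_close e \<gamma> \<delta> \<longrightarrow> \<delta> \<in> W" "\<delta> \<in> short_arcs X p"
          unfolding \<T>_def by blast
        have "mdist ?m \<gamma> \<delta> \<le> e"
          using \<gamma>(1) unfolding F.in_mball by linarith
        moreover have "\<gamma> \<in> short_arcs X p"
          using \<gamma>(2) W by blast
        ultimately show "\<delta> \<in> W"
          using le \<gamma>(3,4) by blast
      qed
    qed
    ultimately show "openin (short_arc_topology X p) W"
      unfolding top openin_subtopology by blast
  qed
qed

lemma in_closure_of_short_arcs:
  assumes "\<gamma> \<in> short_arcs X p"
    and "\<And>\<epsilon>. \<epsilon> > 0 \<Longrightarrow> \<exists>\<delta>\<in>S. \<delta> \<in> short_arcs X p \<and> arc_close \<epsilon> \<gamma> \<delta>"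
  shows "\<gamma> \<in> short_arc_topology X p closure_of S"
  unfolding in_closure_of topspace_short_arc_topology
proof (intro conjI allI impI)
  fix T assume T: "\<gamma> \<in> T \<and> openin (short_arc_topology X p) T"
  then obtain \<epsilon> where \<epsilon>: "\<epsilon> > 0" "\<forall>\<delta>\<in>short_arcs X p. arc_close \<epsilon> \<gamma> \<delta> \<longrightarrow> \<delta> \<in> T"
    unfolding openin_short_arc_topology_iff by blast
  obtain \<delta> where "\<delta> \<in> S" "\<delta> \<in> short_arcs X p" "arc_close \<epsilon> \<gamma> \<delta>"
    using assms(2)[OF \<epsilon>(1)] by blast
  thus "\<exists>y. y \<in> S \<and> y \<in> T"
    using \<epsilon>(2) by blast
qed (fact assms(1))

lemma continuous_map_short_arcs:
  assumes "\<And>\<gamma> e. \<gamma> \<in> short_arcs X p \<Longrightarrow> e > 0 \<Longrightarrow>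
      \<exists>\<epsilon>>0. \<forall>\<delta>\<in>short_arcs X p. arc_close \<epsilon> \<gamma> \<delta> \<longrightarrow> dist (G \<gamma>) (G \<delta>) < e"
  shows "continuous_map (short_arc_topology X p) euclidean (G :: _ \<Rightarrow> complex)"
  unfolding continuous_map_def topspace_short_arc_topology openin_short_arc_topology_iff
proof (intro conjI allI impI ballI)
  fix V and \<gamma> assume V: "openin euclidean V" and \<gamma>: "\<gamma> \<in> {x \<in> short_arcs X p. G x \<in> V}"
  then obtain e where e: "e > 0" "ball (G \<gamma>) e \<subseteq> V"
    by (metis (mono_tags, lifting) mem_Collect_eq open_contains_ball open_openin)
  obtain \<epsilon> where \<epsilon>: "\<epsilon> > 0" "\<forall>\<delta>\<in>short_arcs X p. arc_close \<epsilon> \<gamma> \<delta> \<longrightarrow> dist (G \<gamma>) (G \<delta>) < e"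
    using assms[of \<gamma> e] \<gamma> e(1) by blast
  have "\<forall>\<delta>\<in>short_arcs X p. arc_close \<epsilon> \<gamma> \<delta> \<longrightarrow> \<delta> \<in> {x \<in> short_arcs X p. G x \<in> V}"
    using \<epsilon>(2) e(2) by auto
  thus "\<exists>\<epsilon>>0. \<forall>\<delta>\<in>short_arcs X p. arc_close \<epsilon> \<gamma> \<delta> \<longrightarrow> \<delta> \<in> {x \<in> short_arcs X p. G x \<in> V}"
    using \<epsilon>(1) by blast
qed auto

lemma analytic_arc_setE:
  assumes "analytic_arc_set X p A" "\<gamma> \<in> short_arcs X p"
  obtains W Gs where "openin (short_arc_topology X p) W" "\<gamma> \<in> W"
    "\<forall>G\<in>Gs. holomorphic_on_arcs X p W G" "A \<inter> W = {\<psi> \<in> W. \<forall>G\<in>Gs. G \<psi> = 0}"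
proof -
  have "\<exists>W Gs. openin (short_arc_topology X p) W \<and> \<gamma> \<in> W \<and>
      (\<forall>G\<in>Gs. holomorphic_on_arcs X p W G) \<and> A \<inter> W = {\<psi> \<in> W. \<forall>G\<in>Gs. G \<psi> = 0}"
    by (rule bspec[OF conjunct2[OF assms(1)[unfolded analytic_arc_set_def]] assms(2)])
  thus thesis
    by (elim exE conjE) (rule that)
qed

text \<open>
  Analytic sets are closed, as zero sets of continuous functions.
\<close>

lemma analytic_arc_set_separated:
  assumes A: "analytic_arc_set X p A" and \<gamma>: "\<gamma> \<in> short_arcs X p" "\<gamma> \<notin> A"
  shows "\<exists>\<epsilon>>0. \<forall>\<delta>\<in>short_arcs X p. arc_close \<epsilon> \<gamma> \<delta> \<longrightarrow> \<delta> \<notin> A"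
proof -
  let ?T = "short_arc_topology X p"
  obtain W Gs where W: "openin ?T W" "\<gamma> \<in> W" "\<forall>G\<in>Gs. holomorphic_on_arcs X p W G"
      "A \<inter> W = {\<psi> \<in> W. \<forall>G\<in>Gs. G \<psi> = 0}"
    by (rule analytic_arc_setE[OF A \<gamma>(1)])
  obtain G where G: "G \<in> Gs" "G \<gamma> \<noteq> 0"
    using W(2,4) \<gamma>(2) by blast
  have "continuous_map (subtopology ?T W) euclidean G"
    using W(3) G(1) unfolding holomorphic_on_arcs_def by blast
  hence "openin (subtopology ?T W) {x \<in> topspace (subtopology ?T W). G x \<in> - {0}}"
    by (rule openin_continuous_map_preimage) (simp add: open_Compl)
  hence "openin ?T {x \<in> topspace (subtopology ?T W). G x \<in> - {0}}"
    using W(1) openin_trans_full by blast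
  moreover have "\<gamma> \<in> {x \<in> topspace (subtopology ?T W). G x \<in> - {0}}"
    using \<gamma>(1) W(2) G(2) by simp
  ultimately obtain \<epsilon> where \<epsilon>: "\<epsilon> > 0" "\<forall>\<delta>\<in>short_arcs X p. arc_close \<epsilon> \<gamma> \<delta> \<longrightarrow>
      \<delta> \<in> {x \<in> topspace (subtopology ?T W). G x \<in> - {0}}"
    unfolding openin_short_arc_topology_iff by blast
  have "\<delta> \<notin> A" if "\<delta> \<in> {x \<in> topspace (subtopology ?T W). G x \<in> - {0}}" for \<delta>
    using that W(4) G(1) by auto
  thus ?thesis
    using \<epsilon> by blast
qed

lemma analytic_arc_set_Int:
  assumes A: "analytic_arc_set X p A" and B: "analytic_arc_set X p B"
  shows "analytic_arc_set X p (A \<inter> B)"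
  unfolding analytic_arc_set_def
proof (intro conjI ballI)
  show "A \<inter> B \<subseteq> short_arcs X p"
    using A unfolding analytic_arc_set_def by blast
  fix \<gamma> assume \<gamma>: "\<gamma> \<in> short_arcs X p"
  let ?T = "short_arc_topology X p"
  obtain W1 Gs1 where W1: "openin ?T W1" "\<gamma> \<in> W1" "\<forall>G\<in>Gs1. holomorphic_on_arcs X p W1 G"
      "A \<inter> W1 = {\<psi> \<in> W1. \<forall>G\<in>Gs1. G \<psi> = 0}"
    by (rule analytic_arc_setE[OF A \<gamma>])
  obtain W2 Gs2 where W2: "openin ?T W2" "\<gamma> \<in> W2" "\<forall>G\<in>Gs2. holomorphic_on_arcs X p W2 G"
      "B \<inter> W2 = {\<psi> \<in> W2. \<forall>G\<in>Gs2. G \<psi> = 0}"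
    by (rule analytic_arc_setE[OF B \<gamma>])
  have mono: "holomorphic_on_arcs X p W' G" if "holomorphic_on_arcs X p W G" "W' \<subseteq> W" for W W' G
    using that unfolding holomorphic_on_arcs_def
    by (meson continuous_map_from_subtopology_mono subsetD)
  show "\<exists>W Gs. openin ?T W \<and> \<gamma> \<in> W \<and> (\<forall>G\<in>Gs. holomorphic_on_arcs X p W G) \<and>
      A \<inter> B \<inter> W = {\<psi> \<in> W. \<forall>G\<in>Gs. G \<psi> = 0}"
  proof (intro exI[of _ "W1 \<inter> W2"] exI[of _ "Gs1 \<union> Gs2"] conjI)
    show "openin ?T (W1 \<inter> W2)" "\<gamma> \<in> W1 \<inter> W2"
      using W1 W2 by auto
    show "\<forall>G\<in>Gs1 \<union> Gs2. holomorphic_on_arcs X p (W1 \<inter> W2) G"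
      using W1(3) W2(3) mono by (meson Int_lower1 Int_lower2 UnE)
    have "A \<inter> B \<inter> (W1 \<inter> W2) = (A \<inter> W1) \<inter> (B \<inter> W2)"
      by blast
    also have "\<dots> = {\<psi> \<in> W1 \<inter> W2. \<forall>G\<in>Gs1 \<union> Gs2. G \<psi> = 0}"
      unfolding W1(4) W2(4) by blast
    finally show "A \<inter> B \<inter> (W1 \<inter> W2) = {\<psi> \<in> W1 \<inter> W2. \<forall>G\<in>Gs1 \<union> Gs2. G \<psi> = 0}" .
  qed
qed

lemma analytic_arc_set_zeros:
  assumes "\<And>G. G \<in> Gs \<Longrightarrow> holomorphic_on_arcs X p (short_arcs X p) G"
  shows "analytic_arc_set X p {\<gamma> \<in> short_arcs X p. \<forall>G\<in>Gs. G \<gamma> = 0}"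
  unfolding analytic_arc_set_def
proof (intro conjI ballI)
  fix \<gamma> assume \<gamma>: "\<gamma> \<in> short_arcs X p"
  have "openin (short_arc_topology X p) (short_arcs X p)"
    by (metis openin_topspace topspace_short_arc_topology)
  thus "\<exists>W Gs'. openin (short_arc_topology X p) W \<and> \<gamma> \<in> W \<and> (\<forall>G\<in>Gs'. holomorphic_on_arcs X p W G) \<and>
      {\<gamma> \<in> short_arcs X p. \<forall>G\<in>Gs. G \<gamma> = 0} \<inter> W = {\<psi> \<in> W. \<forall>G\<in>Gs'. G \<psi> = 0}"
    using assms \<gamma> by (intro exI[of _ "short_arcs X p"] exI[of _ Gs]) auto
qed auto

section \<open>Deformations and the identity theorem\<close>

lemma arc_at_continuous:
  fixes \<Phi> :: "complex \<times> complex \<Rightarrow> 'a::complex_normed_space"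
  assumes \<Phi>: "\<Phi> holomorphic_map_on cball 0 1 \<times> ball 0 1" and s0: "s0 \<in> ball 0 1" and "\<epsilon> > 0"
  shows "\<exists>r>0. ball s0 r \<subseteq> ball 0 1 \<and> (\<forall>s\<in>ball s0 r. arc_close \<epsilon> (arc_at \<Phi> s0) (arc_at \<Phi> s))"
proof -
  obtain r0 where r0: "r0 > 0" "cball s0 r0 \<subseteq> ball 0 1"
    using s0 open_contains_cball[of "ball (0::complex) 1"] open_ball by blast
  let ?K = "cball (0::complex) 1 \<times> cball s0 r0"
  have "compact ?K"
    by (intro compact_Times compact_cball)
  moreover have "continuous_on ?K \<Phi>"
    using \<Phi> r0(2) unfolding holomorphic_map_on_iff_hol_at
    by (intro hol_at_imp_continuous_on) blast
  ultimately have unif: "uniformly_continuous_on ?K \<Phi>"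
    by (intro compact_uniformly_continuous)
  obtain d where d: "d > 0" "\<forall>x\<in>?K. \<forall>y\<in>?K. dist y x < d \<longrightarrow> dist (\<Phi> y) (\<Phi> x) < \<epsilon>"
    using unif[unfolded uniformly_continuous_on_def, THEN spec, THEN mp, OF \<open>\<epsilon> > 0\<close>]
    by (elim exE conjE)
  define r where "r = min d r0"
  have "arc_close \<epsilon> (arc_at \<Phi> s0) (arc_at \<Phi> s)" if s: "s \<in> ball s0 r" for s
    unfolding arc_close_def
  proof
    fix t :: complex assume t: "t \<in> cball 0 1"
    have "dist (\<Phi> (t, s0)) (\<Phi> (t, s)) < \<epsilon>"
      using s t r0
      by (intro d(2)[THEN bspec, THEN bspec, THEN mp]) (auto simp: r_def dist_Pair_Pair dist_commute)
    thus "dist (arc_at \<Phi> s0 t) (arc_at \<Phi> s t) \<le> \<epsilon>"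
      using t by (simp add: arc_at_def)
  qed
  moreover have "ball s0 r \<subseteq> ball 0 1"
    using r0(2) by (auto simp: r_def)
  moreover have "r > 0"
    using d r0 by (simp add: r_def)
  ultimately show ?thesis
    by blast
qed

lemma deformation_rescale:
  fixes \<Phi> :: "complex \<times> complex \<Rightarrow> 'a::complex_normed_space"
  assumes \<Phi>: "short_arc_deformation X p \<Phi>" and r: "r > 0" "ball s0 r \<subseteq> ball 0 1"
  shows "\<exists>\<Phi>'. short_arc_deformation X p \<Phi>' \<and> (\<forall>s. arc_at \<Phi>' s = arc_at \<Phi> (s0 + of_real r * s))"
proof -
  define \<Phi>' where "\<Phi>' = (\<lambda>x. \<Phi> (fst x, s0 + of_real r * snd x))"
  have eq: "arc_at \<Phi>' s = arc_at \<Phi> (s0 + of_real r * s)" for s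
    by (simp add: arc_at_def \<Phi>'_def)
  have mem: "s0 + of_real r * s \<in> ball 0 1" if "s \<in> ball 0 1" for s
  proof -
    have "s0 + of_real r * s \<in> ball s0 r"
      using that r(1) by (simp add: dist_norm norm_mult)
    thus ?thesis
      using r(2) by blast
  qed
  obtain V where V: "open V" "cball 0 1 \<times> ball 0 1 \<subseteq> V" "\<And>x. x \<in> V \<Longrightarrow> hol_at \<Phi> x"
    using \<Phi> unfolding short_arc_deformation_def holomorphic_map_on_iff_hol_at by blast
  let ?j = "\<lambda>x :: complex \<times> complex. (fst x, s0 + of_real r * snd x)"
  have j: "hol_at ?j x" for x
    by (intro hol_at_intros)
  have "open (?j -` V)"
    using V(1) hol_at_imp_continuous_on[of UNIV ?j] j by (intro open_vimage) auto
  moreover have "cball 0 1 \<times> ball 0 1 \<subseteq> ?j -` V"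
  proof
    fix x :: "complex \<times> complex" assume "x \<in> cball 0 1 \<times> ball 0 1"
    hence "?j x \<in> cball 0 1 \<times> ball 0 1"
      using mem by (simp only: mem_Times_iff fst_conv snd_conv)
    thus "x \<in> ?j -` V"
      using V(2) by blast
  qed
  moreover have "hol_at \<Phi>' x" if "x \<in> ?j -` V" for x
    unfolding \<Phi>'_def by (rule hol_at_compose[OF j V(3)]) (use that in simp)
  ultimately have "\<Phi>' holomorphic_map_on cball 0 1 \<times> ball 0 1"
    unfolding holomorphic_map_on_iff_hol_at by blast
  moreover have "\<forall>s\<in>ball 0 1. arc_at \<Phi>' s \<in> short_arcs X p"
    using \<Phi> mem unfolding eq short_arc_deformation_def by blast
  ultimately show ?thesis
    using eq unfolding short_arc_deformation_def by blast
qed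

text \<open>
  Near \<open>s\<^sub>0\<close> the deformation stays in an open set \<open>W\<close> on which \<open>A\<close> is cut out by holomorphic functions.
  Along the deformation, rescaled so that its parameters fill the unit disc, they become holomorphic
  functions of one variable.
\<close>

lemma deformation_identity_local:
  fixes \<Phi> :: "complex \<times> complex \<Rightarrow> 'a::complex_normed_space"
  assumes \<Phi>: "short_arc_deformation X p \<Phi>" and A: "analytic_arc_set X p A" and s0: "s0 \<in> ball 0 1"
  shows "\<exists>r>0. ball s0 r \<subseteq> ball 0 1 \<and>
    (\<forall>V. open V \<and> V \<noteq> {} \<and> V \<subseteq> ball s0 r \<and> (\<forall>s\<in>V. arc_at \<Phi> s \<in> A) \<longrightarrow>
       (\<forall>s\<in>ball s0 r. arc_at \<Phi> s \<in> A))"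
proof -
  let ?T = "short_arc_topology X p"
  have arcs: "\<And>s. s \<in> ball 0 1 \<Longrightarrow> arc_at \<Phi> s \<in> short_arcs X p"
    and hol: "\<Phi> holomorphic_map_on cball 0 1 \<times> ball 0 1"
    using \<Phi> unfolding short_arc_deformation_def by auto
  obtain W Gs where W: "openin ?T W" "arc_at \<Phi> s0 \<in> W" "\<forall>G\<in>Gs. holomorphic_on_arcs X p W G"
      "A \<inter> W = {\<psi> \<in> W. \<forall>G\<in>Gs. G \<psi> = 0}"
    by (rule analytic_arc_setE[OF A arcs[OF s0]])
  obtain \<epsilon> where \<epsilon>: "\<epsilon> > 0" "\<forall>\<delta>\<in>short_arcs X p. arc_close \<epsilon> (arc_at \<Phi> s0) \<delta> \<longrightarrow> \<delta> \<in> W"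
    using W(1,2) unfolding openin_short_arc_topology_iff by blast
  obtain r where r: "r > 0" "ball s0 r \<subseteq> ball 0 1"
    "\<forall>s\<in>ball s0 r. arc_close \<epsilon> (arc_at \<Phi> s0) (arc_at \<Phi> s)"
    using arc_at_continuous[OF hol s0 \<epsilon>(1)] by blast
  have inW: "arc_at \<Phi> s \<in> W" if "s \<in> ball s0 r" for s
    using that r(2,3) \<epsilon>(2) arcs by blast
  obtain \<Phi>' where \<Phi>': "short_arc_deformation X p \<Phi>'" "\<And>s. arc_at \<Phi>' s = arc_at \<Phi> (s0 + of_real r * s)"
    using deformation_rescale[OF \<Phi> r(1,2)] by blast
  let ?j = "\<lambda>s. s0 + of_real r * s"
  have j: "?j s \<in> ball s0 r \<longleftrightarrow> s \<in> ball 0 1" for s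
    using r(1) by (simp add: dist_norm norm_mult)
  have "arc_at \<Phi> s \<in> A"
    if V: "open V" "V \<noteq> {}" "V \<subseteq> ball s0 r" "\<forall>s\<in>V. arc_at \<Phi> s \<in> A" and s: "s \<in> ball s0 r" for V s
  proof -
    have "G (arc_at \<Phi> s) = 0" if G: "G \<in> Gs" for G
    proof -
      have "\<forall>s\<in>ball 0 1. arc_at \<Phi>' s \<in> W"
        unfolding \<Phi>'(2) using inW j by blast
      with \<Phi>'(1) have hol_G: "(\<lambda>s. G (arc_at \<Phi>' s)) holomorphic_on ball 0 1"
        by (intro mp[OF spec[OF conjunct2[OF bspec[OF W(3) G, unfolded holomorphic_on_arcs_def]]]] conjI)
      have 1: "open (?j -` V)"
        by (intro open_vimage V(1) continuous_intros)
      have 2: "?j -` V \<subseteq> ball 0 1"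
        using V(3) j by blast
      have 3: "?j -` V \<noteq> {}"
      proof -
        obtain v where "v \<in> V"
          using V(2) by blast
        hence "(v - s0) / of_real r \<in> ?j -` V"
          using r(1) by simp
        thus ?thesis
          by blast
      qed
      have 4: "G (arc_at \<Phi>' s) = 0" if "s \<in> ?j -` V" for s
      proof -
        have "?j s \<in> V"
          using that by simp
        hence "arc_at \<Phi> (?j s) \<in> A \<inter> W"
          using V(3,4) inW by blast
        thus ?thesis
          using W(4) G unfolding \<Phi>'(2) by blast
      qed
      have 5: "(s - s0) / of_real r \<in> ball 0 1"
        using s r(1) by (simp add: dist_norm norm_divide norm_minus_commute)
      have "G (arc_at \<Phi>' ((s - s0) / of_real r)) = 0"
        by (rule analytic_continuation_open[OF 1 open_ball 3 connected_ball 2 hol_G holomorphic_on_const 4 5])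
      thus ?thesis
        using r(1) by (simp add: \<Phi>'(2))
    qed
    hence "arc_at \<Phi> s \<in> {\<psi> \<in> W. \<forall>G\<in>Gs. G \<psi> = 0}"
      using inW[OF s] by blast
    thus ?thesis
      using W(4) by blast
  qed
  thus ?thesis
    using r(1,2) by blast
qed

text \<open>
  The identity theorem: the parameters near which the deformation runs in \<open>A\<close> form an open set whose
  complement is open by the local version, and the disc is connected.
\<close>

lemma deformation_identity:
  fixes \<Phi> :: "complex \<times> complex \<Rightarrow> 'a::complex_normed_space"
  assumes \<Phi>: "short_arc_deformation X p \<Phi>" and A: "analytic_arc_set X p A"
    and V: "open V" "V \<noteq> {}" "V \<subseteq> ball 0 1" "\<And>s. s \<in> V \<Longrightarrow> arc_at \<Phi> s \<in> A"
    and s: "s \<in> ball 0 1"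
  shows "arc_at \<Phi> s \<in> A"
proof -
  define E where "E = \<Union>{B. open B \<and> (\<forall>s\<in>B. arc_at \<Phi> s \<in> A)}"
  define F where "F = \<Union>{B. open B \<and> B \<inter> E = {}}"
  have "open E" "open F"
    unfolding E_def F_def by (intro open_Union; blast)+
  have EF: "E \<inter> F = {}"
    unfolding F_def by blast
  have E: "arc_at \<Phi> s \<in> A" if "s \<in> E" for s
    using that unfolding E_def by blast
  have "ball 0 1 \<subseteq> E \<union> F"
  proof
    fix s0 :: complex assume s0: "s0 \<in> ball 0 1"
    obtain r where r: "r > 0" "ball s0 r \<subseteq> ball 0 1"
      "\<forall>V. open V \<and> V \<noteq> {} \<and> V \<subseteq> ball s0 r \<and> (\<forall>s\<in>V. arc_at \<Phi> s \<in> A) \<longrightarrow>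
         (\<forall>s\<in>ball s0 r. arc_at \<Phi> s \<in> A)"
      using deformation_identity_local[OF \<Phi> A s0] by (elim exE conjE)
    show "s0 \<in> E \<union> F"
    proof (cases "ball s0 r \<inter> E = {}")
      case True
      hence "ball s0 r \<subseteq> F"
        unfolding F_def by (intro Union_upper) simp
      thus ?thesis
        using r(1) by (meson UnI1 UnI2 centre_in_ball subsetD)
    next
      case False
      have "\<forall>s\<in>ball s0 r. arc_at \<Phi> s \<in> A"
        by (rule r(3)[THEN spec, of "ball s0 r \<inter> E", THEN mp]) (use False \<open>open E\<close> E in auto)
      hence "ball s0 r \<subseteq> E"
        unfolding E_def by (intro Union_upper) simp
      thus ?thesis
        using r(1) by (meson UnI1 UnI2 centre_in_ball subsetD)
    qed
  qed
  moreover have "V \<subseteq> E"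
    unfolding E_def using V(1,4) by (intro Union_upper) simp
  hence "E \<inter> ball 0 1 \<noteq> {}"
    using V(2,3) by blast
  moreover have "E \<inter> F \<inter> ball 0 1 = {}"
    using EF by blast
  ultimately have "F \<inter> ball 0 1 = {}"
    using connectedD[OF connected_ball \<open>open E\<close> \<open>open F\<close>, of 0 1] by blast
  hence "s \<in> E"
    using \<open>ball 0 1 \<subseteq> E \<union> F\<close> s by blast
  thus ?thesis
    by (rule E)
qed

section \<open>Taylor coefficients as holomorphic functions on the space of arcs\<close>

definition taylor_deriv :: "('a \<Rightarrow> complex) \<Rightarrow> nat \<Rightarrow> (complex \<Rightarrow> 'a) \<Rightarrow> complex" where
  "taylor_deriv \<pi> k \<gamma> = (deriv ^^ k) (\<lambda>t. \<pi> (\<gamma> t)) 0"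

text \<open>
  Continuity is Cauchy's inequality on the unit circle. Along a deformation \<open>\<pi> \<circ> \<Phi>\<close> is a holomorphic
  function of two variables, whose Taylor coefficients in one variable are holomorphic in the other.
\<close>

lemma taylor_deriv_holomorphic:
  fixes \<pi> :: "'a::complex_normed_space \<Rightarrow> complex"
  assumes \<pi>: "\<And>z. hol_at \<pi> z" and lip: "\<And>z w. norm (\<pi> z - \<pi> w) \<le> dist z w"
  shows "holomorphic_on_arcs X p (short_arcs X p) (taylor_deriv \<pi> k)"
  unfolding holomorphic_on_arcs_def
proof (intro conjI allI impI)
  have hol: "(\<lambda>t. \<pi> (\<gamma> t)) holomorphic_on ball 0 1" if \<gamma>: "\<gamma> \<in> short_arcs X p" for \<gamma>
  proof -
    obtain h where h: "h holomorphic_map_on cball 0 1" "\<gamma> = restrict h (cball 0 1)"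
      using \<gamma> by (rule short_arcE)
    have "hol_at h t" if "t \<in> ball 0 1" for t
    proof -
      have "t \<in> cball 0 1"
        using that by simp
      thus ?thesis
        using h(1) unfolding holomorphic_map_on_iff_hol_at by blast
    qed
    hence "(\<lambda>t. \<pi> (h t)) holomorphic_on ball 0 1"
      by (intro hol_at_imp_holomorphic_on hol_at_compose[OF _ \<pi>])
    thus ?thesis
      by (rule holomorphic_transform) (simp add: h(2))
  qed
  have "continuous_map (short_arc_topology X p) euclidean (taylor_deriv \<pi> k)"
  proof (rule continuous_map_short_arcs)
    fix \<gamma> and e :: real assume \<gamma>: "\<gamma> \<in> short_arcs X p" and "e > 0"
    have "dist (taylor_deriv \<pi> k \<gamma>) (taylor_deriv \<pi> k \<delta>) < e"
      if \<delta>: "\<delta> \<in> short_arcs X p" "arc_close (e / (2 * fact k)) \<gamma> \<delta>" for \<delta>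
    proof -
      have "continuous_on (cball 0 1) (\<lambda>t. \<pi> (\<gamma> t) - \<pi> (\<delta> t))"
        using continuous_on_compose2[OF hol_at_imp_continuous_on[of UNIV \<pi>] short_arc_continuous[OF \<gamma>]]
          continuous_on_compose2[OF hol_at_imp_continuous_on[of UNIV \<pi>] short_arc_continuous[OF \<delta>(1)]] \<pi>
        by (intro continuous_intros) auto
      moreover have "norm (\<pi> (\<gamma> t) - \<pi> (\<delta> t)) \<le> e / (2 * fact k)" if "norm (0 - t) = 1" for t
        using lip[of "\<gamma> t" "\<delta> t"] \<delta>(2) that unfolding arc_close_def
        by (intro order_trans[OF lip]) simp
      ultimately have "norm ((deriv ^^ k) (\<lambda>t. \<pi> (\<gamma> t) - \<pi> (\<delta> t)) 0) \<le>
          fact k * (e / (2 * fact k)) / 1 ^ k"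
        using hol[OF \<gamma>] hol[OF \<delta>(1)]
        by (intro Cauchy_inequality) (auto intro!: holomorphic_intros)
      also have "\<dots> = e / 2"
        by simp
      also have "(deriv ^^ k) (\<lambda>t. \<pi> (\<gamma> t) - \<pi> (\<delta> t)) 0 = taylor_deriv \<pi> k \<gamma> - taylor_deriv \<pi> k \<delta>"
        unfolding taylor_deriv_def
        by (rule higher_deriv_diff[OF hol[OF \<gamma>] hol[OF \<delta>(1)]]) auto
      finally show ?thesis
        using \<open>e > 0\<close> by (simp add: dist_norm)
    qed
    thus "\<exists>\<epsilon>>0. \<forall>\<delta>\<in>short_arcs X p. arc_close \<epsilon> \<gamma> \<delta> \<longrightarrow>
        dist (taylor_deriv \<pi> k \<gamma>) (taylor_deriv \<pi> k \<delta>) < e"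
      using \<open>e > 0\<close> by (intro exI[of _ "e / (2 * fact k)"]) simp
  qed
  thus "continuous_map (subtopology (short_arc_topology X p) (short_arcs X p)) euclidean (taylor_deriv \<pi> k)"
    by (rule continuous_map_from_subtopology)
next
  fix \<Phi> :: "complex \<times> complex \<Rightarrow> 'a"
  assume "short_arc_deformation X p \<Phi> \<and> (\<forall>s\<in>ball 0 1. arc_at \<Phi> s \<in> short_arcs X p)"
  then obtain V where V: "cball 0 1 \<times> ball 0 1 \<subseteq> V" "\<And>x. x \<in> V \<Longrightarrow> hol_at \<Phi> x"
    unfolding short_arc_deformation_def holomorphic_map_on_iff_hol_at by blast
  have "hol_at (\<lambda>x. \<pi> (\<Phi> x)) (t, s)" if "t \<in> ball 0 1" "s \<in> ball 0 1" for t s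
  proof -
    have "(t, s) \<in> cball 0 1 \<times> ball 0 1"
      using that by simp
    thus ?thesis
      using V by (intro hol_at_compose[OF _ \<pi>]) blast
  qed
  hence "sep_holomorphic (ball 0 1) (ball 0 1) (\<lambda>t s. \<pi> (\<Phi> (t, s)))"
    by (intro hol_at_imp_sep_holomorphic) (auto simp: case_prod_unfold)
  from sep_holomorphic_higher_deriv[OF this, of k]
  have "(\<lambda>s. (deriv ^^ k) (\<lambda>t. \<pi> (\<Phi> (t, s))) 0) holomorphic_on ball 0 1"
    by (auto simp: sep_holomorphic_def)
  moreover have "(deriv ^^ k) (\<lambda>t. \<pi> (\<Phi> (t, s))) 0 = taylor_deriv \<pi> k (arc_at \<Phi> s)" for s
    unfolding taylor_deriv_def
    by (rule higher_deriv_cong_open[of "ball 0 1"]) (auto simp: arc_at_def)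
  ultimately show "(\<lambda>s. taylor_deriv \<pi> k (arc_at \<Phi> s)) holomorphic_on ball 0 1"
    by simp
qed


section \<open>Short arcs on a cA-type hypersurface\<close>

lemma vanishes_to_order_mono: "vanishes_to_order k g \<Longrightarrow> j \<le> k \<Longrightarrow> vanishes_to_order j g"
  by (simp add: vanishes_to_order_def)

context cA_equation
begin

abbreviation X :: "(complex \<times> complex \<times> (complex ^ 'n)) set" where
  "X \<equiv> cA_hypersurface U f"

definition arc_of ::
    "(complex \<Rightarrow> complex) \<Rightarrow> (complex \<Rightarrow> complex) \<Rightarrow> (complex \<Rightarrow> complex ^ 'n) \<Rightarrow>
     complex \<Rightarrow> complex \<times> complex \<times> (complex ^ 'n)" where
  "arc_of \<psi>1 \<psi>2 \<phi> = restrict (\<lambda>t. (\<psi>1 t, \<psi>2 t, \<phi> t)) (cball 0 1)"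

lemma hol_at_triple:
  assumes "\<psi>1 analytic_on cball 0 1" "\<psi>2 analytic_on cball 0 1" "\<phi> holomorphic_map_on cball (0::complex) 1"
  shows "\<exists>R>1. \<forall>t\<in>ball 0 R. hol_at (\<lambda>t. (\<psi>1 t, \<psi>2 t, \<phi> t :: complex ^ 'n)) t"
proof -
  obtain R1 R2 R3 where R: "R1 > 1" "\<psi>1 holomorphic_on ball 0 R1" "R2 > 1" "\<psi>2 holomorphic_on ball 0 R2"
    "R3 > 1" "\<forall>t\<in>ball 0 R3. hol_at \<phi> t"
    using assms unfolding analytic_on_cball_unit holomorphic_map_on_cball_unit by blast
  have "hol_at (\<lambda>t. (\<psi>1 t, \<psi>2 t, \<phi> t)) t" if "t \<in> ball 0 (min R1 (min R2 R3))" for t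
    using that R(6)
    by (intro hol_at_Pair holomorphic_on_imp_hol_at[OF R(2)] holomorphic_on_imp_hol_at[OF R(4)]) auto
  thus ?thesis
    using R by (intro exI[of _ "min R1 (min R2 R3)"]) auto
qed

lemma arc_of_short:
  assumes P: "arc_coords \<psi>1 \<psi>2 \<phi>"
  shows "arc_of \<psi>1 \<psi>2 \<phi> \<in> short_arcs X 0"
proof -
  have "(\<lambda>t. (\<psi>1 t, \<psi>2 t, \<phi> t)) holomorphic_map_on cball 0 1"
    using P hol_at_triple unfolding holomorphic_map_on_cball_unit[of "\<lambda>t. (\<psi>1 t, \<psi>2 t, \<phi> t)"]
    by (simp add: arc_coords_def)
  moreover have "arc_of \<psi>1 \<psi>2 \<phi> ` cball 0 1 \<subseteq> X"
    using P by (auto simp: arc_of_def arc_coords_def cA_hypersurface_def)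
  moreover have "{t \<in> cball 0 1. arc_of \<psi>1 \<psi>2 \<phi> t = 0} = {0}"
  proof -
    have "arc_of \<psi>1 \<psi>2 \<phi> t = 0 \<longleftrightarrow> t = 0" if t: "t \<in> cball 0 1" for t
    proof -
      have "arc_of \<psi>1 \<psi>2 \<phi> t = 0 \<longleftrightarrow> \<psi>1 t = 0 \<and> \<psi>2 t = 0 \<and> \<phi> t = 0"
        using t by (simp add: arc_of_def zero_prod_def)
      thus ?thesis
        using P t by (simp add: arc_coords_def)
    qed
    thus ?thesis
      by auto
  qed
  ultimately show ?thesis
    unfolding short_arcs_def arc_of_def by blast
qed

lemma short_arc_coords:
  assumes \<gamma>: "\<gamma> \<in> short_arcs X 0"
  obtains \<psi>1 \<psi>2 \<phi> where "arc_coords \<psi>1 \<psi>2 \<phi>" "\<gamma> = arc_of \<psi>1 \<psi>2 \<phi>"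
proof -
  obtain h where h: "h holomorphic_map_on cball 0 1" "\<gamma> = restrict h (cball 0 1)"
    using \<gamma> by (rule short_arcE)
  have X: "\<gamma> ` cball 0 1 \<subseteq> X" and zero: "{t \<in> cball 0 1. \<gamma> t = 0} = {0}"
    using \<gamma> unfolding short_arcs_def by auto
  obtain R where R: "R > 1" "\<forall>t\<in>ball 0 R. hol_at h t"
    using h(1) holomorphic_map_on_cball_unit by blast
  define \<psi>1 where "\<psi>1 t = fst (h t)" for t
  define \<psi>2 where "\<psi>2 t = fst (snd (h t))" for t
  define \<phi> where "\<phi> t = snd (snd (h t))" for t
  have "\<psi>1 holomorphic_on ball 0 R" "\<psi>2 holomorphic_on ball 0 R"
    unfolding \<psi>1_def \<psi>2_def using R(2)
    by (intro hol_at_imp_holomorphic_on hol_at_fst hol_at_snd; blast)+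
  moreover have "\<forall>t\<in>ball 0 R. hol_at \<phi> t"
    unfolding \<phi>_def using R(2) by (intro ballI hol_at_snd) blast
  moreover have "\<phi> t \<in> U \<and> \<psi>1 t * \<psi>2 t = f (\<phi> t) \<and> (\<psi>1 t = 0 \<and> \<psi>2 t = 0 \<and> \<phi> t = 0 \<longleftrightarrow> t = 0)"
    if t: "t \<in> cball 0 1" for t
  proof -
    have \<gamma>t: "\<gamma> t = (\<psi>1 t, \<psi>2 t, \<phi> t)"
      using t by (simp add: h(2) \<psi>1_def \<psi>2_def \<phi>_def)
    have "\<gamma> t \<in> X"
      using X t by blast
    moreover have "\<gamma> t = 0 \<longleftrightarrow> t = 0"
      using zero t by blast
    ultimately show ?thesis
      by (simp add: \<gamma>t cA_hypersurface_def zero_prod_def)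
  qed
  ultimately have "arc_coords \<psi>1 \<psi>2 \<phi>"
    unfolding arc_coords_def analytic_on_cball_unit holomorphic_map_on_cball_unit using R(1) by blast
  moreover have "\<gamma> = arc_of \<psi>1 \<psi>2 \<phi>"
    by (simp add: h(2) arc_of_def \<psi>1_def \<psi>2_def \<phi>_def)
  ultimately show thesis
    by (rule that)
qed

lemma higher_deriv_arc_of:
  "(deriv ^^ k) (\<lambda>t. fst (arc_of \<psi>1 \<psi>2 \<phi> t)) 0 = (deriv ^^ k) \<psi>1 0"
  "(deriv ^^ k) (\<lambda>t. fst (snd (arc_of \<psi>1 \<psi>2 \<phi> t))) 0 = (deriv ^^ k) \<psi>2 0"
  "(deriv ^^ k) (\<lambda>t. f (snd (snd (arc_of \<psi>1 \<psi>2 \<phi> t)))) 0 = (deriv ^^ k) (\<lambda>t. f (\<phi> t)) 0"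
  by (rule higher_deriv_cong_open[of "ball 0 1"]; simp add: arc_of_def)+

definition x_order_locus :: "nat \<Rightarrow> (complex \<Rightarrow> complex \<times> complex \<times> (complex ^ 'n)) set" where
  "x_order_locus k = {\<gamma> \<in> short_arcs X 0. vanishes_to_order k (\<lambda>t. fst (\<gamma> t))}"

definition y_order_locus :: "nat \<Rightarrow> (complex \<Rightarrow> complex \<times> complex \<times> (complex ^ 'n)) set" where
  "y_order_locus k = {\<gamma> \<in> short_arcs X 0. vanishes_to_order k (\<lambda>t. fst (snd (\<gamma> t)))}"

definition component :: "nat \<Rightarrow> (complex \<Rightarrow> complex \<times> complex \<times> (complex ^ 'n)) set" where
  "component i = x_order_locus i \<inter> y_order_locus (m - i)"

definition generic_part :: "nat \<Rightarrow> (complex \<Rightarrow> complex \<times> complex \<times> (complex ^ 'n)) set" where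
  "generic_part i = {\<gamma> \<in> short_arcs X 0.
     vanishing_order (\<lambda>t. fst (\<gamma> t)) = enat i \<and>
     vanishing_order (\<lambda>t. fst (snd (\<gamma> t))) = enat (m - i) \<and>
     vanishing_order (\<lambda>t. f (snd (snd (\<gamma> t)))) = enat m}"

lemma x_order_locus_analytic: "analytic_arc_set X 0 (x_order_locus k)"
proof -
  have "holomorphic_on_arcs X 0 (short_arcs X 0) (taylor_deriv fst j)" for j
    by (rule taylor_deriv_holomorphic) (auto intro!: hol_at_intros simp: dist_fst_le simp flip: dist_norm)
  hence "analytic_arc_set X 0 {\<gamma> \<in> short_arcs X 0. \<forall>G\<in>taylor_deriv fst ` {..<k}. G \<gamma> = 0}"
    by (intro analytic_arc_set_zeros) blast
  moreover have "{\<gamma> \<in> short_arcs X 0. \<forall>G\<in>taylor_deriv fst ` {..<k}. G \<gamma> = 0} = x_order_locus k"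
    by (auto simp: x_order_locus_def taylor_deriv_def vanishes_to_order_def)
  ultimately show ?thesis
    by (simp only:)
qed

lemma y_order_locus_analytic: "analytic_arc_set X 0 (y_order_locus k)"
proof -
  have lip: "norm (fst (snd z) - fst (snd w)) \<le> dist z w" for z w :: "complex \<times> complex \<times> (complex ^ 'n)"
    unfolding dist_norm[symmetric] by (rule order_trans[OF dist_fst_le dist_snd_le])
  have "holomorphic_on_arcs X 0 (short_arcs X 0) (taylor_deriv (\<lambda>z. fst (snd z)) j)" for j
    by (rule taylor_deriv_holomorphic[OF _ lip]) (intro hol_at_intros)
  hence "analytic_arc_set X 0 {\<gamma> \<in> short_arcs X 0. \<forall>G\<in>taylor_deriv (\<lambda>z. fst (snd z)) ` {..<k}. G \<gamma> = 0}"
    by (intro analytic_arc_set_zeros) blast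
  moreover have "{\<gamma> \<in> short_arcs X 0. \<forall>G\<in>taylor_deriv (\<lambda>z. fst (snd z)) ` {..<k}. G \<gamma> = 0} = y_order_locus k"
    by (auto simp: y_order_locus_def taylor_deriv_def vanishes_to_order_def)
  ultimately show ?thesis
    by (simp only:)
qed

lemma component_analytic: "analytic_arc_set X 0 (component i)"
  unfolding component_def by (intro analytic_arc_set_Int x_order_locus_analytic y_order_locus_analytic)

lemma component_iff:
  assumes "arc_coords \<psi>1 \<psi>2 \<phi>"
  shows "arc_of \<psi>1 \<psi>2 \<phi> \<in> component i \<longleftrightarrow> vanishes_to_order i \<psi>1 \<and> vanishes_to_order (m - i) \<psi>2"
  using arc_of_short[OF assms]
  by (simp add: component_def x_order_locus_def y_order_locus_def vanishes_to_order_def higher_deriv_arc_of)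

text \<open>
  Orders add up in \<open>f \<circ> \<phi> = \<psi>\<^sub>1 \<psi>\<^sub>2\<close>, which gives the order \<open>m = i + (m - i)\<close> of \<open>f \<circ> \<phi>\<close>.
\<close>

lemma generic_part_iff:
  assumes P: "arc_coords \<psi>1 \<psi>2 \<phi>" and i: "i \<le> m"
  shows "arc_of \<psi>1 \<psi>2 \<phi> \<in> generic_part i \<longleftrightarrow>
    vanishes_to_order i \<psi>1 \<and> vanishes_to_order (m - i) \<psi>2 \<and>
    (deriv ^^ i) \<psi>1 0 \<noteq> 0 \<and> (deriv ^^ (m - i)) \<psi>2 0 \<noteq> 0"
proof -
  have \<psi>: "\<psi>1 analytic_on cball 0 1" "\<psi>2 analytic_on cball 0 1"
    and f\<phi>: "\<And>t. t \<in> cball 0 1 \<Longrightarrow> \<psi>1 t * \<psi>2 t = f (\<phi> t)"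
    using P by (auto simp: arc_coords_def)
  have "vanishes_to_order m (\<lambda>t. f (\<phi> t)) \<and> (deriv ^^ m) (\<lambda>t. f (\<phi> t)) 0 \<noteq> 0"
    if van: "vanishes_to_order i \<psi>1" "vanishes_to_order (m - i) \<psi>2"
      "(deriv ^^ i) \<psi>1 0 \<noteq> 0" "(deriv ^^ (m - i)) \<psi>2 0 \<noteq> 0"
  proof -
    obtain G1 where G1: "G1 analytic_on cball 0 1" "\<And>t. t \<in> cball 0 1 \<Longrightarrow> \<psi>1 t = t ^ i * G1 t"
      using analytic_on_cball_divide_power[OF \<psi>(1) van(1)] by blast
    obtain G2 where G2: "G2 analytic_on cball 0 1" "\<And>t. t \<in> cball 0 1 \<Longrightarrow> \<psi>2 t = t ^ (m - i) * G2 t"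
      using analytic_on_cball_divide_power[OF \<psi>(2) van(2)] by blast
    have G12: "(\<lambda>t. G1 t * G2 t) analytic_on cball 0 1"
      by (intro analytic_intros G1 G2)
    have eq: "f (\<phi> t) = t ^ m * (G1 t * G2 t)" if t: "t \<in> cball 0 1" for t
    proof -
      have "t ^ i * t ^ (m - i) = t ^ m"
        using i by (simp flip: power_add)
      thus ?thesis
        using f\<phi>[OF t, symmetric] unfolding G1(2)[OF t] G2(2)[OF t] by (simp add: algebra_simps)
    qed
    have "G1 0 \<noteq> 0"
      using factored_order_cball(2)[OF G1] van(3) by auto
    moreover have "G2 0 \<noteq> 0"
      using factored_order_cball(2)[OF G2] van(4) by auto
    ultimately show ?thesis
      using factored_order_cball[OF G12 eq] by simp
  qed
  thus ?thesis
    using arc_of_short[OF P]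
    by (auto simp: generic_part_def vanishing_order_eq_iff vanishes_to_order_def higher_deriv_arc_of)
qed

lemma arc_close_arc_of:
  assumes "\<And>t. t \<in> cball 0 1 \<Longrightarrow>
    norm (\<psi>1' t - \<psi>1 t) \<le> \<epsilon> / 3 \<and> norm (\<psi>2' t - \<psi>2 t) \<le> \<epsilon> / 3 \<and> norm (\<phi>' t - \<phi> t) \<le> \<epsilon> / 3"
  shows "arc_close \<epsilon> (arc_of \<psi>1 \<psi>2 \<phi>) (arc_of \<psi>1' \<psi>2' \<phi>')"
  unfolding arc_close_def
proof
  fix t :: complex assume t: "t \<in> cball 0 1"
  have "dist (arc_of \<psi>1 \<psi>2 \<phi> t) (arc_of \<psi>1' \<psi>2' \<phi>' t) =
      norm (\<psi>1' t - \<psi>1 t, \<psi>2' t - \<psi>2 t, \<phi>' t - \<phi> t)"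
    using t by (subst dist_commute) (simp add: arc_of_def dist_norm)
  also have "\<dots> \<le> norm (\<psi>1' t - \<psi>1 t) + (norm (\<psi>2' t - \<psi>2 t) + norm (\<phi>' t - \<phi> t))"
    by (rule order_trans[OF norm_Pair_le add_left_mono[OF norm_Pair_le]])
  also have "\<dots> \<le> \<epsilon>"
    using assms[OF t] by linarith
  finally show "dist (arc_of \<psi>1 \<psi>2 \<phi> t) (arc_of \<psi>1' \<psi>2' \<phi>' t) \<le> \<epsilon>" .
qed

lemma generic_part_dense:
  fixes p q :: 'n
  assumes pq: "p \<noteq> q" and i: "0 < i" "i < m" and \<gamma>: "\<gamma> \<in> component i" and "\<epsilon> > 0"
  shows "\<exists>\<delta>\<in>generic_part i. arc_close \<epsilon> \<gamma> \<delta>"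
proof -
  have "\<gamma> \<in> short_arcs X 0"
    using \<gamma> by (simp add: component_def x_order_locus_def)
  then obtain \<psi>1 \<psi>2 \<phi> where P: "arc_coords \<psi>1 \<psi>2 \<phi>" "\<gamma> = arc_of \<psi>1 \<psi>2 \<phi>"
    by (rule short_arc_coords)
  have van: "vanishes_to_order i \<psi>1" "vanishes_to_order (m - i) \<psi>2"
    using \<gamma> component_iff[OF P(1)] P(2) by auto
  have "m - i > 0" "i + (m - i) = m" "\<epsilon> / 3 > 0" "i \<le> m"
    using i \<open>\<epsilon> > 0\<close> by auto
  then obtain \<psi>1' \<psi>2' \<phi>' where P': "arc_coords \<psi>1' \<psi>2' \<phi>'" "vanishes_to_order i \<psi>1'"
    "vanishes_to_order (m - i) \<psi>2'" "(deriv ^^ i) \<psi>1' 0 \<noteq> 0" "(deriv ^^ (m - i)) \<psi>2' 0 \<noteq> 0"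
    "\<forall>t\<in>cball 0 1. norm (\<psi>1' t - \<psi>1 t) \<le> \<epsilon> / 3 \<and> norm (\<psi>2' t - \<psi>2 t) \<le> \<epsilon> / 3 \<and> norm (\<phi>' t - \<phi> t) \<le> \<epsilon> / 3"
    using generic_order_dense[OF pq P(1) van(1) i(1) van(2)] by metis
  have "arc_of \<psi>1' \<psi>2' \<phi>' \<in> generic_part i"
    using generic_part_iff[OF P'(1) \<open>i \<le> m\<close>] P'(2-5) by blast
  moreover have "arc_close \<epsilon> \<gamma> (arc_of \<psi>1' \<psi>2' \<phi>')"
    unfolding P(2) by (rule arc_close_arc_of) (use P'(6) in blast)
  ultimately show ?thesis
    by blast
qed

lemma generic_part_subset: "i \<le> m \<Longrightarrow> generic_part i \<subseteq> component i"
  by (auto simp: generic_part_def component_def x_order_locus_def y_order_locus_def vanishing_order_eq_iff)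

lemma component_nonempty:
  assumes i: "0 < i" "i < m"
  shows "component i \<noteq> {}"
proof -
  have P: "arc_coords (\<lambda>_. 0) (\<lambda>t. t ^ (m - i)) (\<lambda>_. 0)"
    unfolding arc_coords_def
  proof (intro conjI ballI)
    show "(\<lambda>_. 0 :: complex ^ 'n) holomorphic_map_on cball (0::complex) 1"
      unfolding holomorphic_map_on_cball_unit by (intro exI[of _ 2]) (simp add: hol_at_const)
  qed (use zero_U f_0 i in \<open>auto intro!: analytic_intros simp: power_0_left\<close>)
  have "vanishes_to_order i (\<lambda>_. 0)"
    by (rule factored_order(1)[of "\<lambda>_. 0" UNIV]) auto
  moreover have "vanishes_to_order (m - i) (\<lambda>t. t ^ (m - i))"
    by (rule factored_order(1)[of "\<lambda>_. 1" UNIV]) auto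
  ultimately show ?thesis
    using component_iff[OF P] by blast
qed

text \<open>
  The orders of \<open>\<psi>\<^sub>1\<close> and \<open>\<psi>\<^sub>2\<close> add up to at least \<open>m\<close>. The alternative is stated for one \<open>k\<close> at a
  time, since it is applied to an irreducible set, which then has to choose one side as a whole.
\<close>

lemma order_alternative:
  assumes \<gamma>: "\<gamma> \<in> short_arcs X 0" and k: "k \<le> m"
  shows "\<gamma> \<in> x_order_locus (Suc k) \<or> \<gamma> \<in> y_order_locus (m - k)"
proof -
  obtain \<psi>1 \<psi>2 \<phi> where P: "arc_coords \<psi>1 \<psi>2 \<phi>" "\<gamma> = arc_of \<psi>1 \<psi>2 \<phi>"
    using \<gamma> by (rule short_arc_coords)
  have \<psi>: "\<psi>1 analytic_on cball 0 1" "\<psi>2 analytic_on cball 0 1" "\<phi> holomorphic_map_on cball 0 1"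
    and f\<phi>: "\<And>t. t \<in> cball 0 1 \<Longrightarrow> \<psi>1 t * \<psi>2 t = f (\<phi> t)"
    using P by (auto simp: arc_coords_def)
  have "vanishes_to_order (m - k) \<psi>2" if n: "\<not> vanishes_to_order (Suc k) \<psi>1"
  proof (cases "\<exists>t\<in>cball 0 1. \<psi>2 t \<noteq> 0")
    case False
    thus ?thesis
      by (intro factored_order_cball(1)[of "\<lambda>_. 0"]) auto
  next
    case True
    then obtain b G2 where G2: "G2 analytic_on cball 0 1" "G2 0 \<noteq> 0" "\<And>t. t \<in> cball 0 1 \<Longrightarrow> \<psi>2 t = t ^ b * G2 t"
      using finite_order_cball[OF \<psi>(2)] by blast
    have "\<exists>t\<in>cball 0 1. \<psi>1 t \<noteq> 0"
    proof (rule ccontr)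
      assume "\<not> ?thesis"
      hence "vanishes_to_order (Suc k) \<psi>1"
        by (intro factored_order_cball(1)[of "\<lambda>_. 0"]) auto
      thus False
        using n by simp
    qed
    then obtain a G1 where G1: "G1 analytic_on cball 0 1" "G1 0 \<noteq> 0" "\<And>t. t \<in> cball 0 1 \<Longrightarrow> \<psi>1 t = t ^ a * G1 t"
      using finite_order_cball[OF \<psi>(1)] by blast
    have "a \<le> k"
    proof (rule ccontr)
      assume "\<not> a \<le> k"
      hence "vanishes_to_order (Suc k) \<psi>1"
        using factored_order_cball(1)[OF G1(1,3)] vanishes_to_order_mono[of a \<psi>1 "Suc k"] by simp
      thus False
        using n by simp
    qed
    have G12: "(\<lambda>t. G1 t * G2 t) analytic_on cball 0 1"
      by (intro analytic_intros G1 G2)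
    have eq: "f (\<phi> t) = t ^ (a + b) * (G1 t * G2 t)" if t: "t \<in> cball 0 1" for t
      using f\<phi>[OF t, symmetric] unfolding G1(3)[OF t] G2(3)[OF t] by (simp add: power_add algebra_simps)
    have "(deriv ^^ (a + b)) (\<lambda>t. f (\<phi> t)) 0 \<noteq> 0"
      using factored_order_cball(2)[OF G12 eq] G1(2) G2(2) by simp
    moreover have "vanishes_to_order m (\<lambda>t. f (\<phi> t))"
      using \<psi>(3) arc_coords_at_0[OF P(1)] by (intro f_order) auto
    ultimately have "m \<le> a + b"
      by (metis vanishes_to_order_imp_le)
    hence "m - k \<le> b"
      using \<open>a \<le> k\<close> by simp
    thus ?thesis
      using factored_order_cball(1)[OF G2(1,3)] by (rule vanishes_to_order_mono[rotated])
  qed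
  thus ?thesis
    using \<gamma> unfolding P(2)
    by (auto simp: x_order_locus_def y_order_locus_def vanishes_to_order_def higher_deriv_arc_of)
qed

lemma order_at_least_1:
  assumes \<gamma>: "\<gamma> \<in> short_arcs X 0"
  shows "\<gamma> \<in> x_order_locus 1" "\<gamma> \<in> y_order_locus 1"
proof -
  have "\<gamma> 0 = 0"
    using \<gamma> unfolding short_arcs_def by blast
  thus "\<gamma> \<in> x_order_locus 1" "\<gamma> \<in> y_order_locus 1"
    using \<gamma> by (simp_all add: x_order_locus_def y_order_locus_def vanishes_to_order_def)
qed

text \<open>
  With \<open>k\<close> the largest number below \<open>m\<close> such that \<open>\<psi>\<^sub>1\<close> has order at least \<open>k\<close> on all of \<open>Z\<close>, the
  alternative for \<open>k\<close> forces \<open>\<psi>\<^sub>2\<close> to have order at least \<open>m - k\<close> on all of \<open>Z\<close>.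
\<close>

lemma irreducible_subset_component:
  assumes Z: "irreducible_arc_set X 0 Z"
  shows "\<exists>i. 0 < i \<and> i < m \<and> Z \<subseteq> component i"
proof -
  have Z_an: "analytic_arc_set X 0 Z"
    and irr: "\<And>A B. analytic_arc_set X 0 A \<Longrightarrow> analytic_arc_set X 0 B \<Longrightarrow> Z = A \<union> B \<Longrightarrow> Z = A \<or> Z = B"
    using Z unfolding irreducible_arc_set_def by blast+
  have arcs: "Z \<subseteq> short_arcs X 0"
    using Z_an unfolding analytic_arc_set_def by blast
  have split: "Z \<subseteq> x_order_locus (Suc k) \<or> Z \<subseteq> y_order_locus (m - k)" if "k \<le> m" for k
  proof -
    have "Z = (Z \<inter> x_order_locus (Suc k)) \<union> (Z \<inter> y_order_locus (m - k))"
      using order_alternative[OF _ that] arcs by blast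
    thus ?thesis
      using irr[OF analytic_arc_set_Int[OF Z_an x_order_locus_analytic]
          analytic_arc_set_Int[OF Z_an y_order_locus_analytic]] by blast
  qed
  define S where "S = {k. 0 < k \<and> k < m \<and> Z \<subseteq> x_order_locus k}"
  have S_iff: "k \<in> S \<longleftrightarrow> 0 < k \<and> k < m \<and> Z \<subseteq> x_order_locus k" for k
    by (simp add: S_def)
  have "finite S"
    unfolding S_def by (rule finite_subset[of _ "{..<m}"]) auto
  have "1 \<in> S"
    unfolding S_iff using m_ge_2 order_at_least_1(1) arcs by auto
  hence k: "Max S \<in> S"
    using \<open>finite S\<close> Max_in by blast
  have "Z \<subseteq> y_order_locus (m - Max S)"
  proof (cases "Suc (Max S) < m")
    case True
    have "Suc (Max S) \<notin> S"
      using Max_ge[OF \<open>finite S\<close>, of "Suc (Max S)"] by (meson Suc_n_not_le_n)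
    hence "\<not> Z \<subseteq> x_order_locus (Suc (Max S))"
      using True by (simp add: S_iff)
    thus ?thesis
      using split[of "Max S"] True by simp
  next
    case False
    moreover have "Max S < m"
      using k unfolding S_iff by blast
    ultimately have "m - Max S = 1"
      by linarith
    thus ?thesis
      using order_at_least_1(2) arcs by auto
  qed
  thus ?thesis
    using k unfolding S_iff component_def by blast
qed

text \<open>
  The orders \<open>i\<close> and \<open>m - i\<close> of a generic arc of \<open>component i\<close> must satisfy the inequalities with \<open>j\<close>.
\<close>

lemma component_subset_imp_eq:
  fixes p q :: 'n
  assumes pq: "p \<noteq> q" and i: "0 < i" "i < m" and j: "0 < j" "j < m" and sub: "component i \<subseteq> component j"
  shows "i = j"
proof -
  obtain \<gamma> where "\<gamma> \<in> component i"
    using component_nonempty[OF i] by blast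
  from generic_part_dense[OF pq i this, of 1] obtain \<delta> where \<delta>: "\<delta> \<in> generic_part i"
    by auto
  hence "\<delta> \<in> component j"
    using generic_part_subset[of i] i sub by auto
  hence "vanishes_to_order j (\<lambda>t. fst (\<delta> t))" "vanishes_to_order (m - j) (\<lambda>t. fst (snd (\<delta> t)))"
    by (auto simp: component_def x_order_locus_def y_order_locus_def)
  moreover have "(deriv ^^ i) (\<lambda>t. fst (\<delta> t)) 0 \<noteq> 0" "(deriv ^^ (m - i)) (\<lambda>t. fst (snd (\<delta> t))) 0 \<noteq> 0"
    using \<delta> by (auto simp: generic_part_def vanishing_order_eq_iff)
  ultimately have "j \<le> i" "m - j \<le> m - i"
    by (metis vanishes_to_order_imp_le)+
  thus ?thesis
    using i j by simp
qed

lemma generic_part_open: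
  assumes i: "i \<le> m"
  shows "openin (subtopology (short_arc_topology X 0) (component i)) (generic_part i)"
proof -
  let ?T = "short_arc_topology X 0"
  have cont: "continuous_map ?T euclidean (taylor_deriv fst i)"
    "continuous_map ?T euclidean (taylor_deriv (\<lambda>z. fst (snd z)) (m - i))"
  proof -
    have lip: "norm (fst (snd z) - fst (snd w)) \<le> dist z w" for z w :: "complex \<times> complex \<times> (complex ^ 'n)"
      unfolding dist_norm[symmetric] by (rule order_trans[OF dist_fst_le dist_snd_le])
    have "holomorphic_on_arcs X 0 (short_arcs X 0) (taylor_deriv fst i)"
      by (rule taylor_deriv_holomorphic) (auto intro!: hol_at_intros simp: dist_fst_le simp flip: dist_norm)
    moreover have "holomorphic_on_arcs X 0 (short_arcs X 0) (taylor_deriv (\<lambda>z. fst (snd z)) (m - i))"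
      by (rule taylor_deriv_holomorphic[OF _ lip]) (intro hol_at_intros)
    moreover have "subtopology ?T (short_arcs X 0) = ?T"
      by (metis subtopology_topspace topspace_short_arc_topology)
    ultimately show "continuous_map ?T euclidean (taylor_deriv fst i)"
      "continuous_map ?T euclidean (taylor_deriv (\<lambda>z. fst (snd z)) (m - i))"
      unfolding holomorphic_on_arcs_def by simp_all
  qed
  have nz: "openin euclidean (- {0 :: complex})"
    using open_Compl[OF closed_singleton] by (simp only: open_openin)
  note o = openin_continuous_map_preimage[OF cont(1) nz] openin_continuous_map_preimage[OF cont(2) nz]
  have "generic_part i = ({x \<in> topspace ?T. taylor_deriv fst i x \<in> - {0}} \<inter>
       {x \<in> topspace ?T. taylor_deriv (\<lambda>z. fst (snd z)) (m - i) x \<in> - {0}}) \<inter> component i" (is "_ = ?R")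
  proof (intro set_eqI)
    fix \<gamma>
    show "\<gamma> \<in> generic_part i \<longleftrightarrow> \<gamma> \<in> ?R"
    proof (cases "\<gamma> \<in> short_arcs X 0")
      case True
      then obtain \<psi>1 \<psi>2 \<phi> where P: "arc_coords \<psi>1 \<psi>2 \<phi>" "\<gamma> = arc_of \<psi>1 \<psi>2 \<phi>"
        by (rule short_arc_coords)
      show ?thesis
        using True generic_part_iff[OF P(1) i] component_iff[OF P(1), of i]
        by (auto simp: P(2) taylor_deriv_def higher_deriv_arc_of)
    next
      case False
      thus ?thesis
        by (simp add: generic_part_def component_def x_order_locus_def)
    qed
  qed
  thus ?thesis
    using openin_subtopology_Int[OF openin_Int[OF o]] by (simp only:)
qed

end


section \<open>Irreducibility\<close>

lemma cball_unit_mult: "norm c \<le> 1 \<Longrightarrow> t \<in> cball 0 1 \<Longrightarrow> c * t \<in> cball (0::complex) 1"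
  by (simp add: norm_mult mult_le_one)

lemma analytic_on_cball_unit_scale:
  assumes "g analytic_on cball 0 1" "norm c \<le> 1"
  shows "(\<lambda>t. g (c * t)) analytic_on cball 0 1"
proof -
  have "(\<lambda>t. c * t) analytic_on cball 0 1"
    by (intro analytic_intros)
  from analytic_on_compose_gen[OF this assms(1)] show ?thesis
    using cball_unit_mult[OF assms(2)] by (simp add: o_def)
qed

lemma holomorphic_map_on_cball_unit_scale:
  assumes "\<phi> holomorphic_map_on cball (0::complex) 1" "norm c \<le> 1"
  shows "(\<lambda>t. \<phi> (c * t)) holomorphic_map_on cball 0 1"
proof -
  obtain R where R: "R > 1" "\<forall>t\<in>ball 0 R. hol_at \<phi> t"
    using assms(1) holomorphic_map_on_cball_unit by blast
  have "hol_at (\<lambda>t. \<phi> (c * t)) t" if t: "t \<in> ball 0 R" for t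
  proof (rule hol_at_compose[of "\<lambda>t. c * t"])
    show "hol_at (\<lambda>t. c * t) t"
      by (intro hol_at_intros)
    have "norm c * norm t \<le> 1 * norm t"
      using assms(2) by (intro mult_right_mono) auto
    hence "c * t \<in> ball 0 R"
      using t by (simp add: norm_mult)
    thus "hol_at \<phi> (c * t)"
      using R(2) by blast
  qed
  thus ?thesis
    unfolding holomorphic_map_on_cball_unit using R(1) by blast
qed

context cA_equation
begin

lemma arc_coords_scale:
  assumes P: "arc_coords \<psi>1 \<psi>2 \<phi>" and c: "norm c \<le> 1" "c \<noteq> 0"
  shows "arc_coords (\<lambda>t. \<psi>1 (c * t)) (\<lambda>t. \<psi>2 (c * t)) (\<lambda>t. \<phi> (c * t))"
  unfolding arc_coords_def
proof (intro conjI ballI)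
  show "(\<lambda>t. \<psi>1 (c * t)) analytic_on cball 0 1" "(\<lambda>t. \<psi>2 (c * t)) analytic_on cball 0 1"
    "(\<lambda>t. \<phi> (c * t)) holomorphic_map_on cball 0 1"
    using P c(1) unfolding arc_coords_def
    by (auto intro: analytic_on_cball_unit_scale holomorphic_map_on_cball_unit_scale)
  fix t :: complex assume "t \<in> cball 0 1"
  hence ct: "c * t \<in> cball 0 1"
    by (rule cball_unit_mult[OF c(1)])
  show "\<phi> (c * t) \<in> U" "\<psi>1 (c * t) * \<psi>2 (c * t) = f (\<phi> (c * t))"
    using P ct unfolding arc_coords_def by blast+
  have "\<psi>1 (c * t) = 0 \<and> \<psi>2 (c * t) = 0 \<and> \<phi> (c * t) = 0 \<longleftrightarrow> c * t = 0"
    using P ct unfolding arc_coords_def by blast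
  thus "\<psi>1 (c * t) = 0 \<and> \<psi>2 (c * t) = 0 \<and> \<phi> (c * t) = 0 \<longleftrightarrow> t = 0"
    using c(2) by simp
qed

definition rescaled ::
    "(complex \<Rightarrow> complex) \<Rightarrow> (complex \<Rightarrow> complex) \<Rightarrow> (complex \<Rightarrow> complex ^ 'n) \<Rightarrow> complex \<Rightarrow>
     complex \<Rightarrow> complex \<times> complex \<times> (complex ^ 'n)" where
  "rescaled \<psi>1 \<psi>2 \<phi> c = arc_of (\<lambda>t. \<psi>1 (c * t)) (\<lambda>t. \<psi>2 (c * t)) (\<lambda>t. \<phi> (c * t))"

text \<open>
  The factor \<open>(1 + s) / 2\<close> is never 0 and has modulus less than 1 on the disc, it takes every value
  between 0 and 1, and it tends to 0 as \<open>s\<close> tends to \<open>-1\<close>.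
\<close>

lemma rescaling_deformation:
  assumes P: "arc_coords \<psi>1 \<psi>2 \<phi>"
  shows "\<exists>\<Phi>. short_arc_deformation X 0 \<Phi> \<and> (\<forall>s. arc_at \<Phi> s = rescaled \<psi>1 \<psi>2 \<phi> ((1 + s) / 2))"
proof -
  obtain R where R: "R > 1" "\<forall>t\<in>ball 0 R. hol_at (\<lambda>t. (\<psi>1 t, \<psi>2 t, \<phi> t)) t"
    using P hol_at_triple unfolding arc_coords_def by blast
  define j where "j = (\<lambda>x :: complex \<times> complex. (1 + snd x) * (1 / 2) * fst x)"
  define \<Phi> where "\<Phi> = (\<lambda>x. (\<psi>1 (j x), \<psi>2 (j x), \<phi> (j x)))"
  have j: "hol_at j x" for x
    unfolding j_def by (intro hol_at_intros)
  have "open (j -` ball 0 R)"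
    using hol_at_imp_continuous_on[of UNIV j] j by (intro open_vimage) auto
  moreover have half: "norm ((1 + s) / 2) < 1 \<and> (1 + s) / 2 \<noteq> 0" if s: "s \<in> ball 0 1" for s :: complex
  proof
    show "norm ((1 + s) / 2) < 1"
      using norm_triangle_ineq[of 1 s] s by (simp add: norm_divide)
    have "s \<noteq> -1"
      using s by auto
    thus "(1 + s) / 2 \<noteq> 0"
      by (metis add_eq_0_iff divide_eq_0_iff zero_neq_numeral)
  qed
  moreover have "cball 0 1 \<times> ball 0 1 \<subseteq> j -` ball 0 R"
  proof
    fix x :: "complex \<times> complex" assume "x \<in> cball 0 1 \<times> ball 0 1"
    hence x: "fst x \<in> cball 0 1" "snd x \<in> ball 0 1"
      by (auto simp: mem_Times_iff)
    have "norm ((1 + snd x) / 2) \<le> 1"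
      using half[OF x(2)] by linarith
    from cball_unit_mult[OF this x(1)] have "j x \<in> cball 0 1"
      by (simp add: j_def)
    thus "x \<in> j -` ball 0 R"
      using R(1) by simp
  qed
  moreover have "hol_at \<Phi> x" if "x \<in> j -` ball 0 R" for x
  proof -
    have "hol_at (\<lambda>t. (\<psi>1 t, \<psi>2 t, \<phi> t)) (j x)"
      using R(2) that by blast
    from hol_at_compose[OF j this] show ?thesis
      by (simp add: \<Phi>_def)
  qed
  ultimately have "\<Phi> holomorphic_map_on cball 0 1 \<times> ball 0 1"
    unfolding holomorphic_map_on_iff_hol_at by blast
  moreover have eq: "arc_at \<Phi> s = rescaled \<psi>1 \<psi>2 \<phi> ((1 + s) / 2)" for s
    by (simp add: arc_at_def rescaled_def arc_of_def \<Phi>_def j_def)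
  moreover have "rescaled \<psi>1 \<psi>2 \<phi> ((1 + s) / 2) \<in> short_arcs X 0" if "s \<in> ball 0 1" for s
    unfolding rescaled_def
    using half[OF that] by (intro arc_of_short arc_coords_scale P) auto
  ultimately show ?thesis
    unfolding short_arc_deformation_def by auto
qed

lemma rescaled_near_1:
  assumes P: "arc_coords \<psi>1 \<psi>2 \<phi>" and "\<epsilon> > 0"
  shows "\<exists>c::real. 0 < c \<and> c < 1 \<and> arc_close \<epsilon> (arc_of \<psi>1 \<psi>2 \<phi>) (rescaled \<psi>1 \<psi>2 \<phi> (of_real c))"
proof -
  let ?h = "\<lambda>t. (\<psi>1 t, \<psi>2 t, \<phi> t)"
  have "continuous_on (cball 0 1) ?h"
    using P unfolding arc_coords_def
    by (intro continuous_on_Pair analytic_on_imp_continuous_on holomorphic_map_on_cball_unit_continuous) auto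
  hence unif: "uniformly_continuous_on (cball 0 1) ?h"
    by (intro compact_uniformly_continuous compact_cball)
  obtain d where d: "d > 0" "\<forall>x\<in>cball 0 1. \<forall>y\<in>cball 0 1. dist y x < d \<longrightarrow> dist (?h y) (?h x) < \<epsilon>"
    using unif[unfolded uniformly_continuous_on_def, THEN spec, THEN mp, OF \<open>\<epsilon> > 0\<close>]
    by (elim exE conjE)
  define c where "c = 1 - min d 1 / 2"
  have c: "0 < c" "c < 1" "1 - c < d"
    using d(1) by (auto simp: c_def)
  have "arc_close \<epsilon> (arc_of \<psi>1 \<psi>2 \<phi>) (rescaled \<psi>1 \<psi>2 \<phi> (of_real c))"
    unfolding arc_close_def
  proof
    fix t :: complex assume t: "t \<in> cball 0 1"
    have ct: "of_real c * t \<in> cball 0 1"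
      using c t by (intro cball_unit_mult) auto
    have "dist t (of_real c * t) = norm (of_real (1 - c) * t)"
      by (simp add: dist_norm algebra_simps)
    also have "\<dots> = (1 - c) * norm t"
      unfolding norm_mult norm_of_real using c by simp
    also have "\<dots> \<le> (1 - c) * 1"
      using c t by (intro mult_left_mono) auto
    finally have "dist t (of_real c * t) < d"
      using c by simp
    hence "dist (?h t) (?h (of_real c * t)) < \<epsilon>"
      using d(2) t ct by blast
    thus "dist (arc_of \<psi>1 \<psi>2 \<phi> t) (rescaled \<psi>1 \<psi>2 \<phi> (of_real c) t) \<le> \<epsilon>"
      using t by (simp add: arc_of_def rescaled_def)
  qed
  thus ?thesis
    using c by blast
qed

text \<open>
  An arc close to the given one, and therefore outside \<open>A\<close>, belongs to the rescaling deformation. By the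
  identity theorem the deformation leaves \<open>A\<close> also for parameters near \<open>-1\<close>, where the argument of \<open>\<psi>\<^sub>1\<close>
  stays so close to 0 that 0 is its only zero.
\<close>

lemma small_arc_outside:
  assumes P: "arc_coords \<psi>1 \<psi>2 \<phi>" and ord: "vanishes_to_order i \<psi>1" "(deriv ^^ i) \<psi>1 0 \<noteq> 0"
    and A: "analytic_arc_set X 0 A" "arc_of \<psi>1 \<psi>2 \<phi> \<notin> A" and "\<rho> > 0"
  shows "\<exists>u \<psi>2' \<phi>'. arc_coords (\<lambda>t. t ^ i * u t) \<psi>2' \<phi>' \<and> arc_of (\<lambda>t. t ^ i * u t) \<psi>2' \<phi>' \<notin> A \<and>
    u analytic_on cball 0 1 \<and> (\<forall>t\<in>cball 0 1. u t \<noteq> 0 \<and> norm (\<phi>' t) < \<rho>)"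
proof -
  have \<psi>1: "\<psi>1 analytic_on cball 0 1" and \<phi>: "\<phi> holomorphic_map_on cball 0 1"
    using P by (auto simp: arc_coords_def)
  obtain G where G: "G analytic_on cball 0 1" "\<And>t. t \<in> cball 0 1 \<Longrightarrow> \<psi>1 t = t ^ i * G t"
    using analytic_on_cball_divide_power[OF \<psi>1 ord(1)] by blast
  have G0: "G 0 \<noteq> 0"
    using factored_order_cball(2)[OF G] ord(2) by auto
  have "isCont G 0"
    using G(1) unfolding analytic_on_def
    by (metis analytic_at_imp_isCont analytic_on_analytic_at centre_in_cball G(1) zero_le_one)
  hence "eventually (\<lambda>t. G t \<noteq> 0) (nhds 0)"
    using G0 by (simp add: isCont_def tendsto_imp_eventually_ne eventually_nhds_conv_at)
  moreover have "isCont \<phi> 0"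
    using \<phi> by (intro hol_at_imp_continuous) (force simp: holomorphic_map_on_cball_unit)
  hence "(\<phi> \<longlongrightarrow> \<phi> 0) (nhds 0)"
    by (simp add: isCont_def tendsto_at_iff_tendsto_nhds)
  hence "eventually (\<lambda>t. norm (\<phi> t) < \<rho>) (nhds 0)"
    using arc_coords_at_0[OF P] \<open>\<rho> > 0\<close> by (auto dest!: tendstoD[of _ _ _ \<rho>])
  ultimately have "eventually (\<lambda>t. G t \<noteq> 0 \<and> norm (\<phi> t) < \<rho>) (nhds 0)"
    by (rule eventually_conj)
  then obtain d where d: "d > 0" "\<And>t. dist t 0 < d \<Longrightarrow> G t \<noteq> 0 \<and> norm (\<phi> t) < \<rho>"
    unfolding eventually_nhds_metric by blast
  obtain \<Phi> where \<Phi>: "short_arc_deformation X 0 \<Phi>" "\<And>s. arc_at \<Phi> s = rescaled \<psi>1 \<psi>2 \<phi> ((1 + s) / 2)"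
    using rescaling_deformation[OF P] by blast
  obtain \<epsilon> where \<epsilon>: "\<epsilon> > 0" "\<forall>\<delta>\<in>short_arcs X 0. arc_close \<epsilon> (arc_of \<psi>1 \<psi>2 \<phi>) \<delta> \<longrightarrow> \<delta> \<notin> A"
    using analytic_arc_set_separated[OF A(1) arc_of_short[OF P] A(2)] by blast
  obtain c :: real where c: "0 < c" "c < 1" "arc_close \<epsilon> (arc_of \<psi>1 \<psi>2 \<phi>) (rescaled \<psi>1 \<psi>2 \<phi> (of_real c))"
    using rescaled_near_1[OF P \<epsilon>(1)] by blast
  have "rescaled \<psi>1 \<psi>2 \<phi> (of_real c) \<in> short_arcs X 0"
    unfolding rescaled_def using c by (intro arc_of_short arc_coords_scale P) auto
  hence notA: "rescaled \<psi>1 \<psi>2 \<phi> (of_real c) \<notin> A"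
    using \<epsilon>(2) c(3) by blast
  define V where "V = ball (0::complex) 1 \<inter> ball (-1) (2 * min d (1 / 2))"
  have V: "open V" "V \<subseteq> ball 0 1"
    by (auto simp: V_def)
  have "V \<noteq> {}"
  proof -
    define e where "e = min d (1 / 2)"
    have e: "0 < e" "e < 1"
      using d(1) by (auto simp: e_def)
    have "-1 - complex_of_real (e - 1) = - complex_of_real e"
      by simp
    hence "dist (-1) (complex_of_real (e - 1)) = e"
      unfolding dist_norm using e by (simp only: norm_minus_cancel norm_of_real abs_of_pos)
    moreover have "norm (complex_of_real (e - 1)) = 1 - e"
      unfolding norm_of_real using e by simp
    ultimately have "complex_of_real (e - 1) \<in> V"
      using e unfolding V_def e_def[symmetric] by (simp del: of_real_diff)
    thus ?thesis
      by blast
  qed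
  have "\<exists>s\<in>V. arc_at \<Phi> s \<notin> A"
  proof (rule ccontr)
    assume "\<not> ?thesis"
    hence "\<And>s. s \<in> V \<Longrightarrow> arc_at \<Phi> s \<in> A"
      by blast
    moreover have "\<bar>2 * c - 1\<bar> < 1"
      using c by (simp add: abs_less_iff)
    hence "complex_of_real (2 * c - 1) \<in> ball 0 1"
      by (simp only: mem_ball_0 norm_of_real)
    ultimately have "arc_at \<Phi> (complex_of_real (2 * c - 1)) \<in> A"
      using deformation_identity[OF \<Phi>(1) A(1) V(1) \<open>V \<noteq> {}\<close> V(2)] by blast
    thus False
      using notA by (simp add: \<Phi>(2))
  qed
  then obtain s where s: "s \<in> V" "arc_at \<Phi> s \<notin> A"
    by blast
  define b where "b = (1 + s) / 2"
  have "norm (1 + s) < 2 * d"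
    using s(1) by (auto simp: V_def dist_norm norm_minus_commute add.commute)
  hence b: "norm b < d" "norm b \<le> 1" "b \<noteq> 0"
  proof -
    show "norm b < d"
      using \<open>norm (1 + s) < 2 * d\<close> by (simp add: b_def norm_divide)
    have s1: "norm s < 1"
      using s(1) by (simp add: V_def)
    thus "norm b \<le> 1"
      using norm_triangle_ineq[of 1 s] by (simp add: b_def norm_divide)
    have "s \<noteq> -1"
      using s1 by auto
    thus "b \<noteq> 0"
      by (simp add: b_def add_eq_0_iff)
  qed
  have bt: "norm (b * t) < d" if "t \<in> cball 0 1" for t
  proof -
    have "norm b * norm t \<le> norm b * 1"
      using that by (intro mult_left_mono) auto
    thus ?thesis
      using b(1) by (simp add: norm_mult)
  qed
  define u where "u t = b ^ i * G (b * t)" for t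
  have u_eq: "\<psi>1 (b * t) = t ^ i * u t" if "t \<in> cball 0 1" for t
    using G(2)[OF cball_unit_mult[OF b(2) that]] by (simp add: u_def power_mult_distrib)
  have u: "u analytic_on cball 0 1"
    unfolding u_def by (intro analytic_intros analytic_on_cball_unit_scale G(1) b(2))
  have "arc_coords (\<lambda>t. \<psi>1 (b * t)) (\<lambda>t. \<psi>2 (b * t)) (\<lambda>t. \<phi> (b * t))"
    by (rule arc_coords_scale[OF P b(2,3)])
  moreover have "(\<lambda>t. t ^ i * u t) analytic_on cball 0 1"
    by (intro analytic_intros u)
  ultimately have "arc_coords (\<lambda>t. t ^ i * u t) (\<lambda>t. \<psi>2 (b * t)) (\<lambda>t. \<phi> (b * t))"
    using u_eq by (simp add: arc_coords_def)
  moreover have "arc_of (\<lambda>t. t ^ i * u t) (\<lambda>t. \<psi>2 (b * t)) (\<lambda>t. \<phi> (b * t)) = arc_at \<Phi> s"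
    unfolding \<Phi>(2) rescaled_def arc_of_def b_def[symmetric]
    by (rule restrict_ext) (simp add: u_eq)
  moreover have "u t \<noteq> 0 \<and> norm (\<phi> (b * t)) < \<rho>" if "t \<in> cball 0 1" for t
    using d(2)[of "b * t"] bt[OF that] b(3) by (simp add: u_def)
  ultimately show ?thesis
    using u s(2) by (intro exI[of _ u] exI[of _ "\<lambda>t. \<psi>2 (b * t)"] exI[of _ "\<lambda>t. \<phi> (b * t)"]) auto
qed

lemma common_disc:
  assumes u: "u analytic_on cball 0 1" "\<forall>t\<in>cball 0 1. u t \<noteq> 0 \<and> norm (\<phi> t :: complex ^ 'n) < \<rho>"
    and \<phi>: "\<phi> holomorphic_map_on cball 0 1"
  shows "\<exists>R>1. u holomorphic_on ball 0 R \<and> (\<forall>t\<in>ball 0 R. u t \<noteq> 0 \<and> hol_at \<phi> t \<and> norm (\<phi> t) < \<rho>)"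
proof -
  obtain R1 where R1: "R1 > 1" "u holomorphic_on ball 0 R1"
    using u(1) analytic_on_cball_unit by blast
  obtain R2 where R2: "R2 > 1" "\<forall>t\<in>ball 0 R2. hol_at \<phi> t"
    using \<phi> holomorphic_map_on_cball_unit by blast
  have "open (ball 0 R1 \<inter> u -` (- {0}))"
    by (intro continuous_open_preimage holomorphic_on_imp_continuous_on R1(2) open_ball open_Compl closed_singleton)
  moreover have "open (ball 0 R2 \<inter> \<phi> -` ball 0 \<rho>)"
    using R2(2) by (intro continuous_open_preimage hol_at_imp_continuous_on open_ball) blast
  ultimately have "open ((ball 0 R1 \<inter> u -` (- {0})) \<inter> (ball 0 R2 \<inter> \<phi> -` ball 0 \<rho>))"
    by (rule open_Int)
  moreover have "cball 0 1 \<subseteq> (ball 0 R1 \<inter> u -` (- {0})) \<inter> (ball 0 R2 \<inter> \<phi> -` ball 0 \<rho>)"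
    using u(2) R1(1) R2(1) by auto
  ultimately obtain R where R: "R > 1" "ball 0 R \<subseteq> (ball 0 R1 \<inter> u -` (- {0})) \<inter> (ball 0 R2 \<inter> \<phi> -` ball 0 \<rho>)"
    using open_cball_unit_ball by blast
  have "u holomorphic_on ball 0 R"
    using R1(2) by (rule holomorphic_on_subset) (use R(2) in blast)
  moreover have "u t \<noteq> 0 \<and> hol_at \<phi> t \<and> norm (\<phi> t) < \<rho>" if "t \<in> ball 0 R" for t
  proof -
    have "t \<in> ball 0 R2" "u t \<in> - {0}" "\<phi> t \<in> ball 0 \<rho>"
      using that R(2) by blast+
    thus ?thesis
      using R2(2) by auto
  qed
  ultimately show ?thesis
    using R(1) by blast
qed

lemma holomorphic_log_on_ball:
  fixes u :: "complex \<Rightarrow> complex"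
  assumes "u holomorphic_on ball a r" "\<And>t. t \<in> ball a r \<Longrightarrow> u t \<noteq> 0"
  shows "\<exists>l. l holomorphic_on ball a r \<and> (\<forall>t\<in>ball a r. u t = exp (l t))"
proof (rule contractible_imp_holomorphic_log[OF assms(1) convex_imp_contractible[OF convex_ball] assms(2)])
  fix g assume "g holomorphic_on ball a r" "\<And>z. z \<in> ball a r \<Longrightarrow> u z = exp (g z)"
  thus ?thesis
    by (intro exI[of _ g]) simp
qed

text \<open>
  The logarithms of \<open>u\<close> and \<open>u'\<close> and the maps \<open>\<phi>\<close> and \<open>\<phi>'\<close> are interpolated with the weights
  \<open>1 - 2 s\<close> and \<open>2 s\<close>, which give the two arcs at \<open>s = 0\<close> and \<open>s = 1 / 2\<close>. Their moduli are at
  most 3 and 2 on the disc; therefore the bound \<open>\<rho> / 6\<close> keeps \<open>\<phi>\<close> inside the ball of radius \<open>\<rho>\<close>. The second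
  coordinate is determined by the others, and the arcs are short because the first coordinate is \<open>t\<^sup>i\<close>
  times a unit.
\<close>

lemma linking_deformation:
  assumes i: "0 < i" "i < m" and \<rho>: "\<rho> > 0" "ball 0 \<rho> \<subseteq> U"
    and P1: "arc_coords (\<lambda>t. t ^ i * u t) \<psi> \<phi>" and u: "u analytic_on cball 0 1"
      "\<forall>t\<in>cball 0 1. u t \<noteq> 0 \<and> norm (\<phi> t) < \<rho> / 6"
    and P2: "arc_coords (\<lambda>t. t ^ i * u' t) \<psi>' \<phi>'" and u': "u' analytic_on cball 0 1"
      "\<forall>t\<in>cball 0 1. u' t \<noteq> 0 \<and> norm (\<phi>' t) < \<rho> / 6"
  shows "\<exists>\<Phi>. short_arc_deformation X 0 \<Phi> \<and> (\<forall>s\<in>ball 0 1. arc_at \<Phi> s \<in> component i) \<and>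
    arc_at \<Phi> 0 = arc_of (\<lambda>t. t ^ i * u t) \<psi> \<phi> \<and> arc_at \<Phi> (1 / 2) = arc_of (\<lambda>t. t ^ i * u' t) \<psi>' \<phi>'"
proof -
  have \<phi>hol: "\<phi> holomorphic_map_on cball 0 1" "\<phi>' holomorphic_map_on cball 0 1"
    using P1 P2 by (auto simp: arc_coords_def)
  obtain R1 where R1: "R1 > 1" "u holomorphic_on ball 0 R1"
      "\<forall>t\<in>ball 0 R1. u t \<noteq> 0 \<and> hol_at \<phi> t \<and> norm (\<phi> t) < \<rho> / 6"
    using common_disc[OF u \<phi>hol(1)] by blast
  obtain R2 where R2: "R2 > 1" "u' holomorphic_on ball 0 R2"
      "\<forall>t\<in>ball 0 R2. u' t \<noteq> 0 \<and> hol_at \<phi>' t \<and> norm (\<phi>' t) < \<rho> / 6"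
    using common_disc[OF u' \<phi>hol(2)] by blast
  define R where "R = min R1 R2"
  have R: "R > 1" "ball 0 R \<subseteq> ball (0::complex) R1" "ball 0 R \<subseteq> ball (0::complex) R2"
    using R1 R2 by (auto simp: R_def)
  have D1: "t \<in> ball 0 R" if "t \<in> cball 0 1" for t :: complex
    using that R(1) by simp
  have nz: "\<And>t. t \<in> ball 0 R \<Longrightarrow> u t \<noteq> 0" and nz': "\<And>t. t \<in> ball 0 R \<Longrightarrow> u' t \<noteq> 0"
    using R1(3) R2(3) R(2,3) by blast+
  obtain l where l: "l holomorphic_on ball 0 R" "\<And>t. t \<in> ball 0 R \<Longrightarrow> u t = exp (l t)"
    using holomorphic_log_on_ball[OF holomorphic_on_subset[OF R1(2) R(2)] nz] by blast
  obtain l' where l': "l' holomorphic_on ball 0 R" "\<And>t. t \<in> ball 0 R \<Longrightarrow> u' t = exp (l' t)"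
    using holomorphic_log_on_ball[OF holomorphic_on_subset[OF R2(2) R(3)] nz'] by blast
  define E where "E = (\<lambda>x. exp ((1 - 2 * snd x) * l (fst x) + 2 * snd x * l' (fst x)))"
  define F where "F = (\<lambda>x. (1 - 2 * snd x) *\<^sub>C \<phi> (fst x) + (2 * snd x) *\<^sub>C \<phi>' (fst x))"
  have holE: "hol_at E x" if "fst x \<in> ball 0 R" for x
    unfolding E_def
    by (intro hol_at_intros hol_at_compose[OF hol_at_fst[OF hol_at_ident]]
        holomorphic_on_imp_hol_at[OF l(1) open_ball that] holomorphic_on_imp_hol_at[OF l'(1) open_ball that])
  have holF: "hol_at F x" if x: "fst x \<in> ball 0 R" for x
  proof -
    have "hol_at \<phi> (fst x)" "hol_at \<phi>' (fst x)"
      using R1(3) R2(3) R(2,3) x by blast+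
    hence "hol_at (\<lambda>x. \<phi> (fst x)) x" "hol_at (\<lambda>x. \<phi>' (fst x)) x"
      using hol_at_compose[OF hol_at_fst[OF hol_at_ident]] by blast+
    thus ?thesis
      unfolding F_def by (intro hol_at_add hol_at_cscale hol_at_diff hol_at_mult hol_at_const
          hol_at_snd[OF hol_at_ident])
  qed
  have FU: "F (t, s) \<in> U" if ts: "t \<in> ball 0 R" "s \<in> ball 0 1" for t s
  proof -
    have n: "norm (\<phi> t) < \<rho> / 6" "norm (\<phi>' t) < \<rho> / 6"
      using R1(3) R2(3) R(2,3) ts(1) by blast+
    have "norm (1 - 2 * s) \<le> 3" "norm (2 * s) \<le> 2"
      using norm_triangle_ineq4[of 1 "2 * s"] ts(2) by (simp_all add: norm_mult)
    hence "norm ((1 - 2 * s) *\<^sub>C \<phi> t) \<le> 3 * (\<rho> / 6)" "norm ((2 * s) *\<^sub>C \<phi>' t) \<le> 2 * (\<rho> / 6)"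
      unfolding norm_cscale using n by (intro mult_mono; simp)+
    hence "norm (F (t, s)) \<le> 3 * (\<rho> / 6) + 2 * (\<rho> / 6)"
      unfolding F_def by (simp only: fst_conv snd_conv norm_triangle_mono)
    hence "F (t, s) \<in> ball 0 \<rho>"
      using \<rho>(1) by simp
    thus ?thesis
      using \<rho>(2) by blast
  qed
  have F0: "F (0, s) = 0" for s
    using arc_coords_at_0[OF P1] arc_coords_at_0[OF P2] by (simp add: F_def)
  have Fs: "(\<lambda>t. F (t, s)) holomorphic_map_on cball 0 1" for s
  proof -
    have "hol_at (\<lambda>t. F (t, s)) t" if "t \<in> ball 0 R" for t
    proof -
      have "hol_at F (t, s)"
        using that by (intro holF) simp
      thus ?thesis
        by (intro hol_at_compose[of "\<lambda>t. (t, s)" t F] hol_at_Pair hol_at_ident hol_at_const)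
    qed
    thus ?thesis
      unfolding holomorphic_map_on_cball_unit using R(1) by blast
  qed
  have fF: "hol_at (\<lambda>x. f (F x)) (t, s)" if "t \<in> ball 0 R" "s \<in> ball 0 1" for t s
    using that by (intro hol_at_compose[OF holF hol_f[OF FU[OF that]]]) simp
  hence "sep_holomorphic (ball 0 R) (ball 0 1) (\<lambda>t s. f (F (t, s)))"
    by (intro hol_at_imp_sep_holomorphic) (auto simp: case_prod_unfold)
  moreover have "vanishes_to_order m (\<lambda>t. f (F (t, s)))" for s
    by (rule f_order[OF Fs F0])
  ultimately obtain Q where Q: "sep_holomorphic (ball 0 R) (ball 0 1) Q"
      "\<forall>t\<in>ball 0 R. \<forall>s\<in>ball 0 1. f (F (t, s)) = t ^ m * Q t s"
    using sep_holomorphic_divide_power[of "ball 0 R" "ball 0 1" "\<lambda>t s. f (F (t, s))" m] R(1) by auto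
  define \<Phi> where "\<Phi> = (\<lambda>x. (fst x ^ i * E x, fst x ^ (m - i) * (Q (fst x) (snd x) / E x), F x))"
  have E_nz: "E x \<noteq> 0" for x
    by (simp add: E_def)
  have hol\<Phi>: "hol_at \<Phi> x" if x: "x \<in> ball 0 R \<times> ball 0 1" for x
  proof -
    have 1: "fst x \<in> ball 0 R" "snd x \<in> ball 0 1"
      using x by (auto simp: mem_Times_iff)
    have "hol_at (\<lambda>x. Q (fst x) (snd x)) x"
      using sep_holomorphic_imp_hol_at[OF Q(1) 1] by (simp add: case_prod_unfold)
    thus ?thesis
      unfolding \<Phi>_def
      by (intro hol_at_Pair hol_at_mult hol_at_power hol_at_divide holE holF 1 E_nz hol_at_fst hol_at_ident)
  qed
  have \<Phi>_arc: "arc_at \<Phi> s = arc_of (\<lambda>t. t ^ i * E (t, s)) (\<lambda>t. t ^ (m - i) * (Q t s / E (t, s))) (\<lambda>t. F (t, s))" for s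
    by (simp add: arc_at_def arc_of_def \<Phi>_def)
  have E_an: "(\<lambda>t. E (t, s)) analytic_on cball 0 1" for s
  proof -
    have "hol_at (\<lambda>t. E (t, s)) t" if "t \<in> ball 0 R" for t
    proof -
      have "hol_at E (t, s)"
        using that by (intro holE) simp
      thus ?thesis
        by (intro hol_at_compose[of "\<lambda>t. (t, s)" t E] hol_at_Pair hol_at_ident hol_at_const)
    qed
    hence "(\<lambda>t. E (t, s)) holomorphic_on ball 0 R"
      by (rule hol_at_imp_holomorphic_on)
    thus ?thesis
      unfolding analytic_on_cball_unit using R(1) by blast
  qed
  have Q_an: "(\<lambda>t. Q t s) analytic_on cball 0 1" if "s \<in> ball 0 1" for s
    unfolding analytic_on_cball_unit using Q(1) that R(1) unfolding sep_holomorphic_def by blast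
  have QE_an: "(\<lambda>t. Q t s / E (t, s)) analytic_on cball 0 1" if "s \<in> ball 0 1" for s
    by (intro analytic_intros Q_an E_an that E_nz)
  have split_m: "t ^ i * t ^ (m - i) = t ^ m" for t :: complex
    using i by (simp flip: power_add)
  have arc_coords_s: "arc_coords (\<lambda>t. t ^ i * E (t, s)) (\<lambda>t. t ^ (m - i) * (Q t s / E (t, s))) (\<lambda>t. F (t, s))"
    if s: "s \<in> ball 0 1" for s
    unfolding arc_coords_def
  proof (intro conjI ballI)
    show "(\<lambda>t. t ^ i * E (t, s)) analytic_on cball 0 1"
      "(\<lambda>t. t ^ (m - i) * (Q t s / E (t, s))) analytic_on cball 0 1"
      by (intro analytic_on_mult analytic_on_power analytic_on_ident E_an QE_an s)+
    show "(\<lambda>t. F (t, s)) holomorphic_map_on cball 0 1"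
      by (rule Fs)
    fix t :: complex assume t: "t \<in> cball 0 1"
    show "F (t, s) \<in> U"
      by (rule FU[OF D1[OF t] s])
    have "t ^ i * E (t, s) * (t ^ (m - i) * (Q t s / E (t, s))) = (t ^ i * t ^ (m - i)) * Q t s"
      using E_nz by simp
    thus "t ^ i * E (t, s) * (t ^ (m - i) * (Q t s / E (t, s))) = f (F (t, s))"
      using Q(2) D1[OF t] s by (simp add: split_m)
    show "t ^ i * E (t, s) = 0 \<and> t ^ (m - i) * (Q t s / E (t, s)) = 0 \<and> F (t, s) = 0 \<longleftrightarrow> t = 0"
      using E_nz i F0 by auto
  qed
  have "arc_at \<Phi> s \<in> component i" if s: "s \<in> ball 0 1" for s
    unfolding \<Phi>_arc component_iff[OF arc_coords_s[OF s]]
    using factored_order_cball(1)[OF E_an[of s] refl] factored_order_cball(1)[OF QE_an[OF s] refl]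
    by (rule conjI)
  moreover have "short_arc_deformation X 0 \<Phi>"
    unfolding short_arc_deformation_def
  proof (intro conjI ballI)
    show "\<Phi> holomorphic_map_on cball 0 1 \<times> ball 0 1"
      unfolding holomorphic_map_on_iff_hol_at
      using hol\<Phi> D1 by (intro exI[of _ "ball 0 R \<times> ball 0 1"]) (auto simp: open_Times)
    show "arc_at \<Phi> s \<in> short_arcs X 0" if "s \<in> ball 0 1" for s
      unfolding \<Phi>_arc by (rule arc_of_short[OF arc_coords_s[OF that]])
  qed
  moreover have endpoint: "arc_at \<Phi> s = arc_of (\<lambda>t. t ^ i * v t) \<chi>' \<theta>"
    if s: "s \<in> ball 0 1" and Pv: "arc_coords (\<lambda>t. t ^ i * v t) \<chi>' \<theta>"
      and Ev: "\<And>t. t \<in> cball 0 1 \<Longrightarrow> E (t, s) = v t" and F\<theta>: "\<And>t. t \<in> cball 0 1 \<Longrightarrow> F (t, s) = \<theta> t"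
    for s v \<chi>' \<theta>
    unfolding \<Phi>_arc arc_of_def
  proof (rule restrict_ext)
    fix t :: complex assume t: "t \<in> cball 0 1"
    have "t ^ (m - i) * (Q t s / E (t, s)) = \<chi>' t"
    proof (cases "t = 0")
      case True
      thus ?thesis
        using arc_coords_at_0[OF Pv] i by simp
    next
      case False
      have "t ^ i * E (t, s) * (t ^ (m - i) * (Q t s / E (t, s))) = f (F (t, s))"
        using arc_coords_s[OF s] t unfolding arc_coords_def by blast
      also have "\<dots> = t ^ i * v t * \<chi>' t"
        using Pv t F\<theta>[OF t] unfolding arc_coords_def by simp
      finally have "(t ^ i * E (t, s)) * (t ^ (m - i) * (Q t s / E (t, s))) = (t ^ i * E (t, s)) * \<chi>' t"
        using Ev[OF t] by simp
      moreover have "t ^ i * E (t, s) \<noteq> 0"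
        using False E_nz by simp
      ultimately show ?thesis
        using mult_left_cancel by blast
    qed
    thus "(t ^ i * E (t, s), t ^ (m - i) * (Q t s / E (t, s)), F (t, s)) = (t ^ i * v t, \<chi>' t, \<theta> t)"
      using Ev[OF t] F\<theta>[OF t] by simp
  qed
  have "arc_at \<Phi> 0 = arc_of (\<lambda>t. t ^ i * u t) \<psi> \<phi>"
    by (rule endpoint[OF _ P1]) (use l(2) D1 in \<open>simp_all add: E_def F_def\<close>)
  moreover have "arc_at \<Phi> (1 / 2) = arc_of (\<lambda>t. t ^ i * u' t) \<psi>' \<phi>'"
    by (rule endpoint[OF _ P2]) (use l'(2) D1 in \<open>simp_all add: E_def F_def\<close>)
  ultimately show ?thesis
    by blast
qed

text \<open>
  Small arcs outside \<open>A\<close> and outside \<open>B\<close> are put into one deformation inside \<open>A \<union> B\<close>. Since it avoids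
  \<open>A\<close> near its first arc, it runs in \<open>B\<close> there, and then everywhere.
\<close>

lemma component_irreducible:
  fixes p q :: 'n
  assumes pq: "p \<noteq> q" and i: "0 < i" "i < m"
  shows "irreducible_arc_set X 0 (component i)"
proof -
  obtain \<rho> where \<rho>: "\<rho> > 0" "ball 0 \<rho> \<subseteq> U"
    using open_U zero_U openE by blast
  have rho6: "\<rho> / 6 > 0"
    using \<rho>(1) by simp
  have small: "\<exists>u \<psi> \<phi>. arc_coords (\<lambda>t. t ^ i * u t) \<psi> \<phi> \<and> arc_of (\<lambda>t. t ^ i * u t) \<psi> \<phi> \<notin> A \<and>
      u analytic_on cball 0 1 \<and> (\<forall>t\<in>cball 0 1. u t \<noteq> 0 \<and> norm (\<phi> t) < \<rho> / 6)"
    if A: "analytic_arc_set X 0 A" "\<not> component i \<subseteq> A" for A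
  proof -
    obtain \<gamma> where \<gamma>: "\<gamma> \<in> component i" "\<gamma> \<notin> A"
      using A(2) by blast
    have "\<gamma> \<in> short_arcs X 0"
      using \<gamma>(1) by (simp add: component_def x_order_locus_def)
    from analytic_arc_set_separated[OF A(1) this \<gamma>(2)] obtain \<epsilon> where
      \<epsilon>: "\<epsilon> > 0" "\<forall>\<delta>\<in>short_arcs X 0. arc_close \<epsilon> \<gamma> \<delta> \<longrightarrow> \<delta> \<notin> A"
      by blast
    obtain \<delta> where \<delta>: "\<delta> \<in> generic_part i" "arc_close \<epsilon> \<gamma> \<delta>"
      using generic_part_dense[OF pq i \<gamma>(1) \<epsilon>(1)] by blast
    have \<delta>_arc: "\<delta> \<in> short_arcs X 0"
      using \<delta>(1) by (simp add: generic_part_def)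
    hence "\<delta> \<notin> A"
      using \<epsilon>(2) \<delta>(2) by blast
    obtain \<psi>1 \<psi>2 \<phi> where P: "arc_coords \<psi>1 \<psi>2 \<phi>" "\<delta> = arc_of \<psi>1 \<psi>2 \<phi>"
      using \<delta>_arc by (rule short_arc_coords)
    have "i \<le> m"
      using i by simp
    hence ord: "vanishes_to_order i \<psi>1" "(deriv ^^ i) \<psi>1 0 \<noteq> 0" "vanishes_to_order (m - i) \<psi>2"
      using generic_part_iff[OF P(1)] \<delta>(1) P(2) by auto
    show ?thesis
      by (rule small_arc_outside[OF P(1) ord(1,2) A(1) _ rho6]) (use \<open>\<delta> \<notin> A\<close> P(2) in simp)
  qed
  have "component i = A \<or> component i = B"
    if A: "analytic_arc_set X 0 A" and B: "analytic_arc_set X 0 B" and AB: "component i = A \<union> B" for A B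
  proof (rule ccontr)
    assume neg: "\<not> (component i = A \<or> component i = B)"
    have nA: "\<not> component i \<subseteq> A" and nB: "\<not> component i \<subseteq> B"
      using neg AB by blast+
    obtain u \<psi> \<phi> where 1: "arc_coords (\<lambda>t. t ^ i * u t) \<psi> \<phi>" "arc_of (\<lambda>t. t ^ i * u t) \<psi> \<phi> \<notin> A"
      "u analytic_on cball 0 1" "\<forall>t\<in>cball 0 1. u t \<noteq> 0 \<and> norm (\<phi> t) < \<rho> / 6"
      using small[OF A nA] by (elim exE conjE)
    obtain u' \<psi>' \<phi>' where 2: "arc_coords (\<lambda>t. t ^ i * u' t) \<psi>' \<phi>'" "arc_of (\<lambda>t. t ^ i * u' t) \<psi>' \<phi>' \<notin> B"
      "u' analytic_on cball 0 1" "\<forall>t\<in>cball 0 1. u' t \<noteq> 0 \<and> norm (\<phi>' t) < \<rho> / 6"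
      using small[OF B nB] by (elim exE conjE)
    obtain \<Phi> where \<Phi>: "short_arc_deformation X 0 \<Phi>" "\<forall>s\<in>ball 0 1. arc_at \<Phi> s \<in> component i"
      "arc_at \<Phi> 0 = arc_of (\<lambda>t. t ^ i * u t) \<psi> \<phi>" "arc_at \<Phi> (1 / 2) = arc_of (\<lambda>t. t ^ i * u' t) \<psi>' \<phi>'"
      using linking_deformation[OF i \<rho> 1(1,3,4) 2(1,3,4)] by (elim exE conjE)
    have hol: "\<Phi> holomorphic_map_on cball 0 1 \<times> ball 0 1"
      and arcs: "\<forall>s\<in>ball 0 1. arc_at \<Phi> s \<in> short_arcs X 0"
      using \<Phi>(1) unfolding short_arc_deformation_def by blast+
    have 0: "(0::complex) \<in> ball 0 1" and half: "(1 / 2 :: complex) \<in> ball 0 1"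
      by (simp_all add: norm_divide)
    have "arc_at \<Phi> 0 \<notin> A"
      using 1(2) \<Phi>(3) by simp
    then obtain \<epsilon> where \<epsilon>: "\<epsilon> > 0" "\<forall>\<delta>\<in>short_arcs X 0. arc_close \<epsilon> (arc_at \<Phi> 0) \<delta> \<longrightarrow> \<delta> \<notin> A"
      using analytic_arc_set_separated[OF A bspec[OF arcs 0]] by blast
    obtain r where r: "r > 0" "ball (0::complex) r \<subseteq> ball 0 1"
      "\<forall>s\<in>ball 0 r. arc_close \<epsilon> (arc_at \<Phi> 0) (arc_at \<Phi> s)"
      using arc_at_continuous[OF hol 0 \<epsilon>(1)] by (elim exE conjE)
    have inB: "arc_at \<Phi> s \<in> B" if s: "s \<in> ball 0 r" for s
    proof -
      have s1: "s \<in> ball 0 1"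
        using s r(2) by blast
      have "arc_at \<Phi> s \<notin> A"
        using \<epsilon>(2) bspec[OF arcs s1] bspec[OF r(3) s] by blast
      thus ?thesis
        using bspec[OF \<Phi>(2) s1] AB by blast
    qed
    have "ball (0::complex) r \<noteq> {}"
      using r(1) by simp
    from deformation_identity[OF \<Phi>(1) B open_ball this r(2) inB half]
    have "arc_at \<Phi> (1 / 2) \<in> B" .
    thus False
      using 2(2) \<Phi>(4) by simp
  qed
  thus ?thesis
    unfolding irreducible_arc_set_def using component_analytic component_nonempty[OF i] by blast
qed

lemma component_subset_closure:
  fixes p q :: 'n
  assumes pq: "p \<noteq> q" and i: "0 < i" "i < m"
  shows "component i \<subseteq> short_arc_topology X 0 closure_of generic_part i"
proof
  fix \<gamma> assume \<gamma>: "\<gamma> \<in> component i"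
  have "\<gamma> \<in> short_arcs X 0"
    using \<gamma> by (simp add: component_def x_order_locus_def)
  thus "\<gamma> \<in> short_arc_topology X 0 closure_of generic_part i"
  proof (rule in_closure_of_short_arcs)
    fix \<epsilon> :: real assume "\<epsilon> > 0"
    then obtain \<delta> where "\<delta> \<in> generic_part i" "arc_close \<epsilon> \<gamma> \<delta>"
      using generic_part_dense[OF pq i \<gamma>] by blast
    thus "\<exists>\<delta>\<in>generic_part i. \<delta> \<in> short_arcs X 0 \<and> arc_close \<epsilon> \<gamma> \<delta>"
      unfolding generic_part_def by blast
  qed
qed

lemma arc_components_eq:
  fixes p q :: 'n
  assumes pq: "p \<noteq> q"
  shows "arc_components X 0 = component ` {0<..<m}"
proof (intro set_eqI iffI)
  fix Z assume "Z \<in> arc_components X 0"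
  hence Z: "irreducible_arc_set X 0 Z" "\<And>Z'. irreducible_arc_set X 0 Z' \<Longrightarrow> Z \<subseteq> Z' \<Longrightarrow> Z' = Z"
    unfolding arc_components_def by blast+
  obtain i where i: "0 < i" "i < m" "Z \<subseteq> component i"
    using irreducible_subset_component[OF Z(1)] by blast
  have "component i = Z"
    by (rule Z(2)[OF component_irreducible[OF pq i(1,2)] i(3)])
  thus "Z \<in> component ` {0<..<m}"
    using i by auto
next
  fix Z assume "Z \<in> component ` {0<..<m}"
  then obtain i where i: "0 < i" "i < m" "Z = component i"
    by auto
  have "Z' = component i" if Z': "irreducible_arc_set X 0 Z'" "component i \<subseteq> Z'" for Z'
  proof -
    obtain j where j: "0 < j" "j < m" "Z' \<subseteq> component j"
      using irreducible_subset_component[OF Z'(1)] by blast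
    have "i = j"
      using component_subset_imp_eq[OF pq i(1,2) j(1,2)] Z'(2) j(3) by blast
    thus ?thesis
      using Z'(2) j(3) by blast
  qed
  thus "Z \<in> arc_components X 0"
    unfolding arc_components_def i(3) using component_irreducible[OF pq i(1,2)] by blast
qed

lemma component_bij:
  fixes p q :: 'n
  assumes pq: "p \<noteq> q"
  shows "bij_betw component {0<..<m} (arc_components X 0)"
  unfolding bij_betw_def arc_components_eq[OF pq]
proof
  show "inj_on component {0<..<m}"
    using component_subset_imp_eq[OF pq] by (intro inj_onI) auto
qed simp

text \<open>
  In one variable the equations \<open>x = y\<close> and \<open>z = 0\<close> leave only \<open>x\<^sup>2 = f 0 = 0\<close>. Hence a local dimension of
  at least 3 provides the two different coordinates that density needs.
\<close>

lemma local_dim_le_2: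
  assumes "\<forall>p q :: 'n. p = q"
  shows "local_dim X 0 \<le> 2"
proof -
  fix k :: 'n
  define g :: "nat \<Rightarrow> complex \<times> complex \<times> (complex ^ 'n) \<Rightarrow> complex" where
    "g j x = (if j = 0 then fst x - fst (snd x) else vec_nth (snd (snd x)) k)" for j x
  have g: "g j holomorphic_map_on UNIV" for j
  proof -
    have "hol_at (g j) x" for x
      by (cases "j = 0") (simp_all add: g_def[abs_def] hol_at_intros)
    thus ?thesis
      unfolding holomorphic_map_on_iff_hol_at by blast
  qed
  have "{x \<in> X \<inter> UNIV. \<forall>j<2. g j x = 0} = {0}"
  proof (intro set_eqI iffI)
    fix x assume x: "x \<in> {x \<in> X \<inter> UNIV. \<forall>j<2. g j x = 0}"
    obtain a b z where abz: "x = (a, b, z)"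
      by (cases x)
    have "g 0 x = 0" "g 1 x = 0"
      using x by auto
    hence ab: "a = b" and zk: "vec_nth z k = 0"
      by (auto simp: g_def abz)
    have z: "z = 0"
      using zk assms by (metis vec_eq_iff zero_index)
    have "a * b = 0"
      using x z f_0 by (simp add: abz cA_hypersurface_def)
    thus "x \<in> {0}"
      using ab z by (simp add: abz zero_prod_def)
  next
    fix x :: "complex \<times> complex \<times> (complex ^ 'n)" assume "x \<in> {0}"
    thus "x \<in> {x \<in> X \<inter> UNIV. \<forall>j<2. g j x = 0}"
      using zero_U f_0 by (simp add: cA_hypersurface_def zero_prod_def g_def)
  qed
  hence "\<exists>(g :: nat \<Rightarrow> complex \<times> complex \<times> (complex ^ 'n) \<Rightarrow> complex) U. open U \<and> 0 \<in> U \<and> (\<forall>j<2. g j holomorphic_map_on U) \<and>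
      {q \<in> X \<inter> U. \<forall>j<2. g j q = 0} = {0}"
    using g by (intro exI[of _ g] exI[of _ UNIV]) simp
  thus ?thesis
    unfolding local_dim_def by (rule Least_le)
qed

end

theorem theorem28:
  fixes f :: "complex ^ 'n \<Rightarrow> complex" and U :: "(complex ^ 'n) set" and m :: nat
    and X :: "(complex \<times> complex \<times> (complex ^ 'n)) set"
  assumes "open U" and "0 \<in> U" and "f holomorphic_map_on U"
    and "mult0 f = enat m" and "m \<ge> 2"
    and "X = cA_hypersurface U f"
    and "local_dim X 0 \<ge> 3"
  shows "\<exists>ShArc ShArc\<^sub>0.
    bij_betw ShArc {0<..<m} (arc_components X 0) \<and>
    (\<forall>i\<in>{0<..<m}.
       ShArc\<^sub>0 i \<subseteq> ShArc i \<and>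
       openin (subtopology (short_arc_topology X 0) (ShArc i)) (ShArc\<^sub>0 i) \<and>
       ShArc i \<subseteq> short_arc_topology X 0 closure_of ShArc\<^sub>0 i \<and>
       (\<forall>\<gamma>\<in>short_arcs X 0.
          \<gamma> \<in> ShArc\<^sub>0 i \<longleftrightarrow>
            vanishing_order (\<lambda>t. fst (\<gamma> t)) = enat i \<and>
            vanishing_order (\<lambda>t. fst (snd (\<gamma> t))) = enat (m - i) \<and>
            vanishing_order (\<lambda>t. f (snd (snd (\<gamma> t)))) = enat m))"
proof -
  interpret cA_equation f U m
    using assms(1-3,5) mult0_eq_imp[OF assms(4)]
    by unfold_locales (auto simp: holomorphic_map_on_open)
  have X: "X = cA_hypersurface U f"
    by (rule assms(6))
  obtain p q :: 'n where pq: "p \<noteq> q"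
    using local_dim_le_2 assms(7) unfolding X by force
  show ?thesis
    unfolding X
  proof (rule exI[of _ component], rule exI[of _ generic_part], intro conjI ballI)
    show "bij_betw component {0<..<m} (arc_components (cA_hypersurface U f) 0)"
      by (rule component_bij[OF pq])
    fix i assume "i \<in> {0<..<m}"
    hence i: "0 < i" "i < m" "i \<le> m"
      by auto
    show "generic_part i \<subseteq> component i"
      by (rule generic_part_subset[OF i(3)])
    show "openin (subtopology (short_arc_topology (cA_hypersurface U f) 0) (component i)) (generic_part i)"
      by (rule generic_part_open[OF i(3)])
    show "component i \<subseteq> short_arc_topology (cA_hypersurface U f) 0 closure_of generic_part i"
      by (rule component_subset_closure[OF pq i(1,2)])
    show "\<gamma> \<in> generic_part i \<longleftrightarrow>
            vanishing_order (\<lambda>t. fst (\<gamma> t)) = enat i \<and>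
            vanishing_order (\<lambda>t. fst (snd (\<gamma> t))) = enat (m - i) \<and>
            vanishing_order (\<lambda>t. f (snd (snd (\<gamma> t)))) = enat m"
      if "\<gamma> \<in> short_arcs (cA_hypersurface U f) 0" for \<gamma>
      using that unfolding generic_part_def by blast
  qed
qed


end
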